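(* Let $V$ be a non-projective diffeological vector space. Then there exist a diffeological vector space $W$ and a non-trivial diffeological principal $W$-bundle over $V$. Consequently, for this $W$, there is no classifying space for principal $W$-bundles, i.e., there is no diffeological space $Z$ such that for every diffeological space $X$ the set of isomorphism classes of principal $W$-bundles over $X$ is in bijection, naturally in $X$, with the set $[X,Z]$ of smooth homotopy classes of smooth maps $X \to Z$.
   Context: A diffeological space is a set $X$ with a specified set of functions $U \to X$ (plots) for each open $U \subseteq \mathbb{R}^n$, $n \in \mathbb{N}$, such that constant functions are plots, precomposing a plot $U\to X$ with a smooth map $V \to U$ between open subsets of Euclidean spaces gives a plot, and a function $U\to X$ that is locally a plot is a plot. A map $f : X \to Y$ is smooth if $f\circ p$ is a plot of $Y$ for every plot $p$ of $X$; a diffeomorphism is an invertible smooth map with smooth inverse. Manifolds carry the standard diffeology (plots are the usual smooth maps). A function into a product is a plot iff its components are; a subset $A \subseteq Y$ has the sub-diffeology (plots of $Y$ landing in $A$); a quotient $X/{\sim}$ has the quotient diffeology (functions that locally lift to plots of $X$). A subduction is a smooth map $X \to Y$ such that the plots of $Y$ are exactly the functions that locally lift to plots of $X$. A subset $A \subseteq X$ is $D$-open if $p^{-1}(A)$ is open for every plot $p$. A diffeological vector space is a diffeological space with an $\mathbb{R}$-vector space structure whose addition and scalar multiplication are smooth; it is in particular a diffeological group (a diffeological space with a group structure whose operations are smooth) under addition. A diffeological vector space $P$ is projective if for any linear subduction $\pi : W_1 \to W_2$ of diffeological vector spaces and any smooth linear map $f : P \to W_2$ there is a smooth linear map $g :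 P \to W_1$ with $f = \pi \circ g$. Let $G$ be a diffeological group, $\pi : E \to B$ a smooth map, and let $G$ act smoothly on $E$ from the right (i.e. $E \times G \to E$ is smooth) with $\pi(x\cdot g)=\pi(x)$. Then $\pi$ is a trivial principal $G$-bundle if there is a $G$-equivariant diffeomorphism $E \to B \times G$ over $B$ (with $(b,g)\cdot g' = (b,gg')$); locally trivial if $B$ has a $D$-open cover $\{B_i\}$ such that each $\pi^{-1}(B_i) \to B_i$ is trivial; and a (diffeological) principal $G$-bundle if its pullback along every plot of $B$ is a locally trivial principal $G$-bundle. Two principal $G$-bundles over $B$ are isomorphic if there is a $G$-equivariant diffeomorphism between their total spaces over $B$. Principal bundles over $X$ are natural in $X$ via pullback. Smooth maps $f,g: X \to Y$ are smoothly homotopic if there is a smooth $F : X \times \mathbb{R} \to Y$ with $F(x,0)=f(x)$ and $F(x,1)=g(x)$ for all $x$; this is an equivalence relation, with quotient set $[X,Y]$. *)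

theory Defs
  imports "HOL-Analysis.Analysis" "HOL-Analysis.Finite_Function_Topology"
begin

section \<open>Smooth maps between open subsets of Euclidean spaces\<close>

text \<open>
  \<open>\<real>\<^sup>n\<close> is the library's \<^const>\<open>Euclidean_space\<close> \<open>n\<close>: the sequences vanishing from index \<open>n\<close> on,
  with the product topology.  This lets \<open>n\<close> range over all natural numbers inside one definition.
\<close>

type_synonym rvec = "nat \<Rightarrow> real"

text \<open>
  \<open>Ck_on k n U f\<close>: on the open set \<open>U \<subseteq> \<real>\<^sup>n\<close> all partial derivatives of \<open>f\<close> of order at most
  \<open>k\<close> exist and are continuous.  The \<open>i\<close>-th partial derivative at \<open>x\<close> is the derivative of
  \<open>t \<mapsto> f (x(i := t))\<close> at \<open>x i\<close>.
\<close>

fun Ck_on :: "nat \<Rightarrow> nat \<Rightarrow> rvec set \<Rightarrow> (rvec \<Rightarrow> real) \<Rightarrow> bool" where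
  "Ck_on 0 n U f \<longleftrightarrow> continuous_on U f"
| "Ck_on (Suc k) n U f \<longleftrightarrow> continuous_on U f \<and>
     (\<forall>i<n. \<exists>g. (\<forall>x\<in>U. ((\<lambda>t. f (x(i := t))) has_real_derivative g x) (at (x i))) \<and> Ck_on k n U g)"

definition smooth_fun_on :: "nat \<Rightarrow> rvec set \<Rightarrow> (rvec \<Rightarrow> real) \<Rightarrow> bool" where
  "smooth_fun_on n U f \<longleftrightarrow> openin (Euclidean_space n) U \<and> (\<forall>k. Ck_on k n U f)"

definition smooth_euclidean :: "nat \<Rightarrow> rvec set \<Rightarrow> nat \<Rightarrow> rvec set \<Rightarrow> (rvec \<Rightarrow> rvec) \<Rightarrow> bool" where
  "smooth_euclidean m V n U h \<longleftrightarrow>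
     openin (Euclidean_space m) V \<and> openin (Euclidean_space n) U \<and> h ` V \<subseteq> U \<and>
     (\<forall>i<n. smooth_fun_on m V (\<lambda>v. h v i))"


section \<open>Diffeological spaces\<close>

text \<open>
  \<open>plot X n U p\<close> says that the restriction of \<open>p\<close> to \<open>U \<subseteq> \<real>\<^sup>n\<close> is a plot of \<open>X\<close>.  HOL functions are
  total, so the axiom \<open>plot_cong\<close> expresses that values of \<open>p\<close> outside \<open>U\<close> are irrelevant.
\<close>

record 'a dspace =
  points :: "'a set"
  plot :: "nat \<Rightarrow> rvec set \<Rightarrow> (rvec \<Rightarrow> 'a) \<Rightarrow> bool"

locale diffeological_space =
  fixes X :: "'a dspace"
  assumes plot_domain: "plot X n U p \<Longrightarrow> openin (Euclidean_space n) U"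
    and plot_range: "plot X n U p \<Longrightarrow> p ` U \<subseteq> points X"
    and plot_cong: "plot X n U p \<Longrightarrow> (\<And>u. u \<in> U \<Longrightarrow> q u = p u) \<Longrightarrow> plot X n U q"
    and plot_const: "openin (Euclidean_space n) U \<Longrightarrow> x \<in> points X \<Longrightarrow> plot X n U (\<lambda>_. x)"
    and plot_compose: "plot X n U p \<Longrightarrow> smooth_euclidean m V n U h \<Longrightarrow> plot X m V (p \<circ> h)"
    and plot_local: "openin (Euclidean_space n) U \<Longrightarrow>
      (\<And>u. u \<in> U \<Longrightarrow> \<exists>V. openin (Euclidean_space n) V \<and> u \<in> V \<and> V \<subseteq> U \<and> plot X n V p) \<Longrightarrow>
      plot X n U p"

definition smooth_map :: "'a dspace \<Rightarrow> 'b dspace \<Rightarrow> ('a \<Rightarrow> 'b) \<Rightarrow> bool" where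
  "smooth_map X Y f \<longleftrightarrow> f ` points X \<subseteq> points Y \<and>
     (\<forall>n U p. plot X n U p \<longrightarrow> plot Y n U (f \<circ> p))"

definition diffeomorphism :: "'a dspace \<Rightarrow> 'b dspace \<Rightarrow> ('a \<Rightarrow> 'b) \<Rightarrow> bool" where
  "diffeomorphism X Y f \<longleftrightarrow> smooth_map X Y f \<and>
     (\<exists>g. smooth_map Y X g \<and> (\<forall>x\<in>points X. g (f x) = x) \<and> (\<forall>y\<in>points Y. f (g y) = y))"

definition open_dspace :: "nat \<Rightarrow> rvec set \<Rightarrow> rvec dspace" where
  "open_dspace n U = \<lparr>points = U, plot = (\<lambda>m V p. smooth_euclidean m V n U p)\<rparr>"

definition real_dspace :: "real dspace" where
  "real_dspace = \<lparr>points = UNIV, plot = smooth_fun_on\<rparr>"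

definition prod_dspace :: "'a dspace \<Rightarrow> 'b dspace \<Rightarrow> ('a \<times> 'b) dspace" where
  "prod_dspace X Y = \<lparr>points = points X \<times> points Y,
     plot = (\<lambda>n U p. plot X n U (fst \<circ> p) \<and> plot Y n U (snd \<circ> p))\<rparr>"

definition sub_dspace :: "'a dspace \<Rightarrow> 'a set \<Rightarrow> 'a dspace" where
  "sub_dspace X A = \<lparr>points = points X \<inter> A, plot = (\<lambda>n U p. plot X n U p \<and> p ` U \<subseteq> A)\<rparr>"

definition D_open :: "'a dspace \<Rightarrow> 'a set \<Rightarrow> bool" where
  "D_open X A \<longleftrightarrow> A \<subseteq> points X \<and>
     (\<forall>n U p. plot X n U p \<longrightarrow> openin (Euclidean_space n) {u\<in>U. p u \<in> A})"

definition locally_lifts ::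
    "'a dspace \<Rightarrow> ('a \<Rightarrow> 'b) \<Rightarrow> nat \<Rightarrow> rvec set \<Rightarrow> (rvec \<Rightarrow> 'b) \<Rightarrow> bool" where
  "locally_lifts X f n U q \<longleftrightarrow> openin (Euclidean_space n) U \<and>
     (\<forall>u\<in>U. \<exists>V p. openin (Euclidean_space n) V \<and> u \<in> V \<and> V \<subseteq> U \<and> plot X n V p \<and>
        (\<forall>v\<in>V. q v = f (p v)))"

definition subduction :: "'a dspace \<Rightarrow> 'b dspace \<Rightarrow> ('a \<Rightarrow> 'b) \<Rightarrow> bool" where
  "subduction X Y f \<longleftrightarrow> smooth_map X Y f \<and> (\<forall>n U q. plot Y n U q \<longleftrightarrow> locally_lifts X f n U q)"


section \<open>Diffeological groups and vector spaces\<close>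

text \<open>
  The algebraic operations are those of the ambient type; the carrier \<^const>\<open>points\<close> is a subgroup or
  subspace of it.  Groups are written additively but are not assumed to be commutative.
\<close>

definition diffeological_group :: "'g::group_add dspace \<Rightarrow> bool" where
  "diffeological_group G \<longleftrightarrow> diffeological_space G \<and> 0 \<in> points G \<and>
     smooth_map (prod_dspace G G) G (\<lambda>(x, y). x + y) \<and> smooth_map G G uminus"

definition diffeological_vector_space :: "'v::real_vector dspace \<Rightarrow> bool" where
  "diffeological_vector_space V \<longleftrightarrow> diffeological_space V \<and> subspace (points V) \<and>
     smooth_map (prod_dspace V V) V (\<lambda>(x, y). x + y) \<and>
     smooth_map (prod_dspace real_dspace V) V (\<lambda>(r, x). r *\<^sub>R x)"

definition smooth_linear ::
    "'v::real_vector dspace \<Rightarrow> 'w::real_vector dspace \<Rightarrow> ('v \<Rightarrow> 'w) \<Rightarrow> bool" where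
  "smooth_linear V W f \<longleftrightarrow> smooth_map V W f \<and>
     (\<forall>x\<in>points V. \<forall>y\<in>points V. f (x + y) = f x + f y) \<and>
     (\<forall>r. \<forall>x\<in>points V. f (r *\<^sub>R x) = r *\<^sub>R f x)"

text \<open>
  HOL cannot quantify over types inside a formula, so the types of the test spaces \<open>W\<^sub>1\<close>, \<open>W\<^sub>2\<close> are
  a parameter.  A space is non-projective iff \<^term>\<open>\<not> projective TYPE('a \<times> 'b) P\<close> for some types
  \<open>'a\<close>, \<open>'b\<close>; a theorem with this hypothesis for arbitrary \<open>'a\<close>, \<open>'b\<close> thus covers every
  non-projective space.
\<close>

definition projective ::
    "('a::real_vector \<times> 'b::real_vector) itself \<Rightarrow> 'v::real_vector dspace \<Rightarrow> bool" where
  "projective _ P \<longleftrightarrow>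
     (\<forall>(W\<^sub>1 :: 'a dspace) (W\<^sub>2 :: 'b dspace) \<pi> f.
        diffeological_vector_space W\<^sub>1 \<and> diffeological_vector_space W\<^sub>2 \<and>
        smooth_linear W\<^sub>1 W\<^sub>2 \<pi> \<and> subduction W\<^sub>1 W\<^sub>2 \<pi> \<and> smooth_linear P W\<^sub>2 f \<longrightarrow>
        (\<exists>g. smooth_linear P W\<^sub>1 g \<and> (\<forall>x\<in>points P. f x = \<pi> (g x))))"


section \<open>Principal bundles\<close>

record ('e, 'b, 'g) gbundle =
  total_space :: "'e dspace"
  proj :: "'e \<Rightarrow> 'b"
  act :: "'e \<Rightarrow> 'g \<Rightarrow> 'e"

definition fibrewise_action ::
    "'g::group_add dspace \<Rightarrow> 'b dspace \<Rightarrow> ('e, 'b, 'g) gbundle \<Rightarrow> bool" where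
  "fibrewise_action G B E \<longleftrightarrow>
     diffeological_group G \<and> diffeological_space B \<and> diffeological_space (total_space E) \<and>
     smooth_map (total_space E) B (proj E) \<and>
     smooth_map (prod_dspace (total_space E) G) (total_space E) (\<lambda>(x, g). act E x g) \<and>
     (\<forall>x\<in>points (total_space E). act E x 0 = x) \<and>
     (\<forall>x\<in>points (total_space E). \<forall>g\<in>points G. \<forall>h\<in>points G. act E (act E x g) h = act E x (g + h)) \<and>
     (\<forall>x\<in>points (total_space E). \<forall>g\<in>points G. proj E (act E x g) = proj E x)"

text \<open>Existence of a \<open>G\<close>-equivariant diffeomorphism of total spaces over the common base.\<close>

definition bundle_isomorphic ::
    "'g dspace \<Rightarrow> ('e, 'b, 'g) gbundle \<Rightarrow> ('f, 'b, 'g) gbundle \<Rightarrow> bool" where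
  "bundle_isomorphic G E F \<longleftrightarrow>
     (\<exists>\<phi>. diffeomorphism (total_space E) (total_space F) \<phi> \<and>
        (\<forall>x\<in>points (total_space E). proj F (\<phi> x) = proj E x) \<and>
        (\<forall>x\<in>points (total_space E). \<forall>g\<in>points G. \<phi> (act E x g) = act F (\<phi> x) g))"

definition product_bundle :: "'g::group_add dspace \<Rightarrow> 'b dspace \<Rightarrow> ('b \<times> 'g, 'b, 'g) gbundle" where
  "product_bundle G B = \<lparr>total_space = prod_dspace B G, proj = fst, act = (\<lambda>(b, g) g'. (b, g + g'))\<rparr>"

definition restrict_bundle :: "('e, 'b, 'g) gbundle \<Rightarrow> 'b set \<Rightarrow> ('e, 'b, 'g) gbundle" where
  "restrict_bundle E A = E\<lparr>total_space := sub_dspace (total_space E) (proj E -` A)\<rparr>"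

definition pullback_bundle ::
    "'c dspace \<Rightarrow> ('c \<Rightarrow> 'b) \<Rightarrow> ('e, 'b, 'g) gbundle \<Rightarrow> ('c \<times> 'e, 'c, 'g) gbundle" where
  "pullback_bundle C f E =
     \<lparr>total_space = sub_dspace (prod_dspace C (total_space E)) {(c, x). f c = proj E x},
      proj = fst, act = (\<lambda>(c, x) g. (c, act E x g))\<rparr>"

definition trivial_bundle ::
    "'g::group_add dspace \<Rightarrow> 'b dspace \<Rightarrow> ('e, 'b, 'g) gbundle \<Rightarrow> bool" where
  "trivial_bundle G B E \<longleftrightarrow>
     fibrewise_action G B E \<and> bundle_isomorphic G E (product_bundle G B)"

definition locally_trivial_bundle ::
    "'g::group_add dspace \<Rightarrow> 'b dspace \<Rightarrow> ('e, 'b, 'g) gbundle \<Rightarrow> bool" where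
  "locally_trivial_bundle G B E \<longleftrightarrow> fibrewise_action G B E \<and>
     (\<exists>\<C>. (\<forall>A\<in>\<C>. D_open B A) \<and> \<Union>\<C> = points B \<and>
        (\<forall>A\<in>\<C>. trivial_bundle G (sub_dspace B A) (restrict_bundle E A)))"

definition principal_bundle ::
    "'g::group_add dspace \<Rightarrow> 'b dspace \<Rightarrow> ('e, 'b, 'g) gbundle \<Rightarrow> bool" where
  "principal_bundle G B E \<longleftrightarrow> fibrewise_action G B E \<and>
     (\<forall>n U p. plot B n U p \<longrightarrow>
        locally_trivial_bundle G (open_dspace n U) (pullback_bundle (open_dspace n U) p E))"


section \<open>Isomorphism classes, homotopy classes and classifying spaces\<close>

text \<open>
  Every fibre of a principal \<open>G\<close>-bundle over \<open>X\<close> is in bijection with \<open>G\<close>, so every such bundle, on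
  whatever type its total space lives, is isomorphic to one whose total space lives on the product
  of the types of \<open>X\<close> and \<open>G\<close>.  Using only those total spaces loses no isomorphism class.
\<close>

type_synonym ('x, 'g) std_bundle = "('x \<times> 'g, 'x, 'g) gbundle"

definition iso_classes :: "'g::group_add dspace \<Rightarrow> 'x dspace \<Rightarrow> ('x, 'g) std_bundle set set" where
  "iso_classes G X = {E. principal_bundle G X E} //
     {(E, F). principal_bundle G X E \<and> principal_bundle G X F \<and> bundle_isomorphic G E F}"

definition pullback_class ::
    "'g::group_add dspace \<Rightarrow> 'x dspace \<Rightarrow> ('x \<Rightarrow> 'y) \<Rightarrow> ('y, 'g) std_bundle set
      \<Rightarrow> ('x, 'g) std_bundle set" where
  "pullback_class G X f c =
     {F. principal_bundle G X F \<and> (\<exists>E\<in>c. bundle_isomorphic G (pullback_bundle X f E) F)}"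

definition smoothly_homotopic :: "'x dspace \<Rightarrow> 'z dspace \<Rightarrow> ('x \<Rightarrow> 'z) \<Rightarrow> ('x \<Rightarrow> 'z) \<Rightarrow> bool" where
  "smoothly_homotopic X Z f g \<longleftrightarrow> smooth_map X Z f \<and> smooth_map X Z g \<and>
     (\<exists>F. smooth_map (prod_dspace X real_dspace) Z F \<and>
        (\<forall>x\<in>points X. F (x, 0) = f x \<and> F (x, 1) = g x))"

text \<open>
  Functions that agree on \<open>X\<close> are smoothly homotopic, so the arbitrary values of HOL functions outside
  \<open>X\<close> do not affect the quotient \<open>[X, Z]\<close>.
\<close>

definition homotopy_classes :: "'x dspace \<Rightarrow> 'z dspace \<Rightarrow> ('x \<Rightarrow> 'z) set set" where
  "homotopy_classes X Z = {f. smooth_map X Z f} // {(f, g). smoothly_homotopic X Z f g}"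

definition precompose_class ::
    "'x dspace \<Rightarrow> 'z dspace \<Rightarrow> ('x \<Rightarrow> 'y) \<Rightarrow> ('y \<Rightarrow> 'z) set \<Rightarrow> ('x \<Rightarrow> 'z) set" where
  "precompose_class X Z f d = {h. \<exists>k\<in>d. smoothly_homotopic X Z (k \<circ> f) h}"

text \<open>
  \<open>Z\<close> classifies principal \<open>G\<close>-bundles over the diffeological spaces \<open>X\<close> whose points lie in the
  type \<open>'x\<close>.
\<close>

definition classifying_space ::
    "'x itself \<Rightarrow> 'g::group_add dspace \<Rightarrow> 'z dspace \<Rightarrow> bool" where
  "classifying_space _ G Z \<longleftrightarrow> diffeological_space Z \<and>
     (\<exists>\<Phi> :: 'x dspace \<Rightarrow> ('x, 'g) std_bundle set \<Rightarrow> ('x \<Rightarrow> 'z) set.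
        (\<forall>X. diffeological_space X \<longrightarrow>
           bij_betw (\<Phi> X) (iso_classes G X) (homotopy_classes X Z)) \<and>
        (\<forall>X Y f. diffeological_space X \<and> diffeological_space Y \<and> smooth_map X Y f \<longrightarrow>
           (\<forall>c\<in>iso_classes G Y.
              \<Phi> X (pullback_class G X f c) = precompose_class X Z f (\<Phi> Y c))))"

text \<open>
  The existence of a vector space \<open>W\<close> must be asserted at a definite type.  We use the real vector
  space freely spanned by all pairs of a triple \<open>(n, U, p)\<close> (a candidate plot of \<open>V\<close>) and a sequence
  (a candidate point of \<open>U\<close>).  This is no restriction.  Given a principal \<open>W'\<close>-bundle over \<open>V\<close>, for
  \<open>W'\<close> on any type, let \<open>M\<close> be the disjoint union of the domains of the plots along which its
  pullback is trivial.  The bundle is then given by a cocycle \<open>M \<times>\<^sub>V M \<rightarrow> W'\<close>, and is induced from a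
  universal one for the vector space of formal combinations of points of \<open>M\<close> whose coefficients
  sum to zero over each fibre of \<open>M \<rightarrow> V\<close>, with the diffeology making \<open>(u, u') \<mapsto> [u] - [u']\<close>
  universal among smooth cocycles.  If the given bundle is non-trivial, so is the universal one.
\<close>

type_synonym 'v plot_vectors =
  "((nat \<times> rvec set \<times> (rvec \<Rightarrow> 'v)) \<times> rvec, real) poly_mapping"

end

theory Submission
  imports Defs
begin

text \<open>
  Let \<open>M\<close> be the set of all pairs of a plot \<open>j = (n, U, p)\<close> of \<open>V\<close> and a point \<open>x \<in> U\<close>, and let \<open>F\<close> be the
  real vector space freely spanned by the symbols \<open>[j, x]\<close>.  Its plots are the maps that are locally a
  finite sum of smooth multiples of symbols \<open>[j, x]\<close> with fixed \<open>j\<close> and smoothly moving \<open>x\<close>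
  (\<open>free_space\<close>).  Evaluation \<open>[j, x] \<mapsto> [p x]\<close> takes \<open>F\<close> to the formal combinations of points of \<open>V\<close>.
  The structure group \<open>W\<close> is the kernel of evaluation, and the fibre of the bundle over \<open>v\<close> is the set of all
  \<open>w \<in> F\<close> that evaluate to \<open>[v]\<close>.  Along a plot \<open>j\<close> this bundle has the smooth section \<open>u \<mapsto> [j, u]\<close>, so it is
  principal (\<open>universal_bundle_principal\<close>).

  If it is trivial, there is a smooth map \<open>s\<close> from \<open>V\<close> to \<open>F\<close> such that \<open>s v\<close> evaluates to \<open>[v]\<close>: pairing
  \<open>s v\<close> with \<open>f \<circ> plot_value\<close> gives \<open>f v\<close>, for every function \<open>f\<close> on \<open>V\<close> whatsoever.  This is a strong
  condition.  It forces each plot of \<open>V\<close> to run, locally, through a finite-dimensional subspace with smooth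
  coordinates (\<open>locally_finite_plot\<close>).  On such a \<open>V\<close> all linear maps to diffeological vector spaces are
  smooth, so that a smooth linear map lifts through a linear subduction by lifting the images of the members
  of a Hamel basis: \<open>V\<close> is projective (\<open>projective_if_locally_finite\<close>).

  To see that \<open>s\<close> has this consequence, differentiate \<open>s (r v)\<close> at \<open>r = 0\<close>.  The result is a finite sum of
  monopoles and dipoles at points of \<open>M\<close>.  The coefficient \<open>dipole v (j, x) c\<close> of the dipole at \<open>(j, x)\<close> in
  direction \<open>c\<close> is linear in \<open>v\<close>.  Four facts lead to the conclusion.

  \<^item> A smooth linear functional \<open>l\<close> is determined by the dipoles alone: \<open>l v\<close> is the sum of all
    \<open>dipole v (j, x) c\<close> times the derivative of \<open>l \<circ> p\<close> at \<open>x\<close> in direction \<open>c\<close> (\<open>linear_by_dipoles\<close>).  The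
    monopoles disappear because \<open>s\<close> may be paired with \<open>\<theta> \<circ> l\<close> for a non-linear \<open>\<theta>\<close> that shifts the finitely many
    values of \<open>l\<close> at the places of the monopoles to \<open>0\<close>.  It follows that \<open>v = 0\<close> if \<open>v\<close> has no dipoles
    (\<open>dipole_injective\<close>).

  \<^item> Dipoles do not move along plots.  A smooth function on \<open>V\<close> and its directional derivative at \<open>0\<close>
    have equal derivatives along curves through \<open>0\<close> (\<open>differential_at_zero\<close>).  Applied to test functions
    with vanishing first jet, this shows that a dipole \<open>B\<close> at a point moving with velocity \<open>M\<close> satisfies
    \<open>B \<otimes> M + M \<otimes> B = 0\<close>, so that \<open>B = 0\<close> or \<open>M = 0\<close>.

  \<^item> Near each parameter, the dipoles along a plot lie at finitely many fixed points
    (\<open>dipole_support_locally_finite\<close>).  Suppose that \<open>\<mu>\<close> is the largest dipole coefficient away from these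
    points.  Sum the dipole coefficients with weights given by a bump function around the place of \<open>\<mu>\<close>.
    This is a smooth linear functional, so its value, which has absolute value \<open>\<mu>\<close>, is a combination of
    dipole coefficients, where those at the fixed points contribute nothing and the others are at most \<open>\<mu>\<close>.
    As dipoles do not move, the factors in this combination are small near the fixed points, uniformly in
    the bump function.  Hence \<open>\<mu>\<close> is at most a small multiple of \<open>\<mu>\<close>, which is absurd.

  \<^item> The finitely many remaining dipole coefficients are smooth along the plot and separate the vectors on
    it, and so they are coordinates on a finite-dimensional space that contains it.

  For the second half, let a principal bundle \<open>E\<close> over \<open>V\<close> be given and let \<open>Z\<close> be a classifying space.  Since
  \<open>V\<close> contracts smoothly to \<open>0\<close>, the identity and the constant map \<open>0\<close> induce the same map on \<open>[V, Z]\<close>.  By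
  naturality the pullbacks of \<open>E\<close> along these two maps are isomorphic.  One of them is \<open>E\<close> and the
  other is a product, so \<open>E\<close> is trivial (\<open>nontrivial_bundle_not_classified\<close>).
\<close>

section \<open>Coordinate boxes\<close>

text \<open>
  The box lies in the copy of \<open>\<real>\<^sup>n\<close> inside the space of all sequences, where the coordinates from \<open>n\<close> on
  vanish.
\<close>

definition ebox :: "nat \<Rightarrow> rvec \<Rightarrow> real \<Rightarrow> rvec set" where
  "ebox n x e = {y. (\<forall>i\<ge>n. y i = 0) \<and> (\<forall>i<n. \<bar>y i - x i\<bar> < e)}"

abbreviation "eopen n \<equiv> openin (Euclidean_space n)"

lemma open_coordinate_box: "open {y :: rvec. \<forall>i<n::nat. \<bar>y i - x i\<bar> < e}"
proof -
  have "{y :: rvec. \<forall>i<n. \<bar>y i - x i\<bar> < e} = (\<Inter>i\<in>{..<n}. {y. \<bar>y i - x i\<bar> < e})" by auto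
  moreover have "open {y :: rvec. \<bar>y i - x i\<bar> < e}" for i
    by (intro open_Collect_less continuous_intros continuous_on_product_coordinates)
  ultimately show ?thesis by (auto intro!: open_INT)
qed

text \<open>
  The topology of \<^const>\<open>Euclidean_space\<close> comes from an infinite product; boxes turn it into
  \<open>\<epsilon>\<close>-arguments on the first \<open>n\<close> coordinates.
\<close>

lemma eopen_iff:
  "eopen n U \<longleftrightarrow> U \<subseteq> {x. \<forall>i\<ge>n. x i = 0} \<and> (\<forall>x\<in>U. \<exists>e>0. ebox n x e \<subseteq> U)"
  (is "_ = (_ \<and> ?R)")
proof
  assume o: "eopen n U"
  then obtain T where T: "openin (powertop_real UNIV) T" "U = T \<inter> {x. \<forall>i\<ge>n. x i = 0}"
    unfolding Euclidean_space_def openin_subtopology by auto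
  have "\<exists>e>0. ebox n x e \<subseteq> U" if x: "x \<in> U" for x
  proof -
    from T x have "x \<in> T" by auto
    from product_topology_open_contains_basis[OF T(1) this] obtain X where
      X: "x \<in> (\<Pi>\<^sub>E i\<in>UNIV. X i)" "\<And>i. openin euclideanreal (X i)"
        "finite {i. X i \<noteq> topspace euclideanreal}" "(\<Pi>\<^sub>E i\<in>UNIV. X i) \<subseteq> T" by blast
    have "\<exists>e>0. \<forall>y. \<bar>y - x i\<bar> < e \<longrightarrow> y \<in> X i" for i
      using X(1) X(2)[of i] by (auto simp: open_dist dist_real_def PiE_iff)
    then obtain e where e: "\<And>i. e i > 0" "\<And>i y. \<bar>y - x i\<bar> < e i \<Longrightarrow> y \<in> X i" by metis
    define d where "d = Min (insert 1 (e ` {..<n}))"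
    have d: "d > 0" "\<And>i. i < n \<Longrightarrow> d \<le> e i" unfolding d_def using e(1) by auto
    have "ebox n x d \<subseteq> U"
    proof
      fix y assume y: "y \<in> ebox n x d"
      have "y i \<in> X i" for i
      proof (cases "i < n")
        case True then show ?thesis using e(2) d(2)[of i] y by (force simp: ebox_def)
      next
        case False
        then have "y i = 0" "x i = 0" using y x T(2) by (simp_all add: ebox_def)
        then have "y i = x i" by simp
        then show ?thesis using e by simp
      qed
      then have "y \<in> T" using X(4) by (auto simp: PiE_iff)
      then show "y \<in> U" using y T(2) by (simp add: ebox_def)
    qed
    then show ?thesis using d by auto
  qed
  then show "U \<subseteq> {x. \<forall>i\<ge>n. x i = 0} \<and> ?R" using T by auto
next
  assume a: "U \<subseteq> {x. \<forall>i\<ge>n. x i = 0} \<and> ?R"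
  then obtain e where e: "\<And>x. x \<in> U \<Longrightarrow> e x > 0 \<and> ebox n x (e x) \<subseteq> U" by metis
  define T where "T = (\<Union>x\<in>U. {y :: rvec. \<forall>i<n. \<bar>y i - x i\<bar> < e x})"
  have "open T" unfolding T_def using open_coordinate_box by (intro open_UN) blast
  moreover have "U = T \<inter> {x. \<forall>i\<ge>n. x i = 0}"
  proof (intro subset_antisym subsetI IntI)
    fix y assume y: "y \<in> U"
    then show "y \<in> T" unfolding T_def using e[OF y] by (intro UN_I[of y]) auto
    show "y \<in> {x. \<forall>i\<ge>n. x i = 0}" using a y by blast
  next
    fix y assume "y \<in> T \<inter> {x. \<forall>i\<ge>n. x i = 0}"
    then obtain x where x: "x \<in> U" "\<forall>i<n. \<bar>y i - x i\<bar> < e x" "\<forall>i\<ge>n. y i = 0" unfolding T_def by blast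
    then have "y \<in> ebox n x (e x)" by (simp add: ebox_def)
    then show "y \<in> U" using e[OF x(1)] by blast
  qed
  ultimately show "eopen n U"
    unfolding Euclidean_space_def openin_subtopology by (auto simp: euclidean_product_topology)
qed

lemma eopen_zero: "eopen n U \<Longrightarrow> x \<in> U \<Longrightarrow> i \<ge> n \<Longrightarrow> x i = 0"
  unfolding eopen_iff by auto

lemma eopen_ebox: "eopen n U \<Longrightarrow> x \<in> U \<Longrightarrow> \<exists>e>0. ebox n x e \<subseteq> U"
  unfolding eopen_iff by auto

lemma ebox_mono: "d \<le> e \<Longrightarrow> ebox n x d \<subseteq> ebox n x e"
  unfolding ebox_def by fastforce

lemma ebox_center: "eopen n U \<Longrightarrow> x \<in> U \<Longrightarrow> e > 0 \<Longrightarrow> x \<in> ebox n x e"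
  by (auto simp: ebox_def eopen_zero)

lemma eopen_ebox_self: "eopen n (ebox n x e)"
  unfolding eopen_iff
proof (intro conjI ballI)
  show "ebox n x e \<subseteq> {x. \<forall>i\<ge>n. x i = 0}" by (auto simp: ebox_def)
  fix y assume y: "y \<in> ebox n x e"
  define d where "d = Min (insert 1 ((\<lambda>i. e - \<bar>y i - x i\<bar>) ` {..<n}))"
  have d: "d > 0" "\<And>i. i < n \<Longrightarrow> d \<le> e - \<bar>y i - x i\<bar>" unfolding d_def using y by (auto simp: ebox_def)
  have "ebox n y d \<subseteq> ebox n x e"
    using d by (fastforce simp: ebox_def)
  with d show "\<exists>d>0. ebox n y d \<subseteq> ebox n x e" by auto
qed

lemma eopen_UNIV: "eopen n {x. \<forall>i\<ge>n. x i = 0}"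
  by (metis openin_topspace topspace_Euclidean_space)

lemma continuous_on_iff_ebox:
  fixes f :: "rvec \<Rightarrow> real"
  assumes U: "eopen n U"
  shows "continuous_on U f \<longleftrightarrow> (\<forall>x\<in>U. \<forall>e>0. \<exists>d>0. ebox n x d \<subseteq> U \<and> (\<forall>y\<in>ebox n x d. \<bar>f y - f x\<bar> < e))"
proof (intro iffI ballI allI impI)
  fix x e :: "_" assume c: "continuous_on U f" and x: "x \<in> U" and e: "(e::real) > 0"
  have "openin (top_of_set U) (U \<inter> f -` ball (f x) e)"
    by (rule continuous_openin_preimage_gen[OF c]) simp
  moreover have "top_of_set U = subtopology (Euclidean_space n) U"
  proof -
    have "{x. \<forall>i\<ge>n. x i = 0} \<inter> U = U" using U unfolding eopen_iff by blast
    then show ?thesis by (simp add: Euclidean_space_def subtopology_subtopology euclidean_product_topology)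
  qed
  ultimately have "eopen n (U \<inter> f -` ball (f x) e)"
    using U by (metis openin_trans_full)
  from eopen_ebox[OF this, of x] x e show "\<exists>d>0. ebox n x d \<subseteq> U \<and> (\<forall>y\<in>ebox n x d. \<bar>f y - f x\<bar> < e)"
    by (fastforce simp: dist_real_def abs_minus_commute)
next
  assume a: "\<forall>x\<in>U. \<forall>e>0. \<exists>d>0. ebox n x d \<subseteq> U \<and> (\<forall>y\<in>ebox n x d. \<bar>f y - f x\<bar> < e)"
  show "continuous_on U f"
    unfolding continuous_on_topological
  proof (intro ballI allI impI)
    fix x B assume x: "x \<in> U" and "open B" "f x \<in> B"
    then obtain e where e: "e > 0" "ball (f x) e \<subseteq> B" by (meson openE)
    then obtain d where d: "d > 0" "\<forall>y\<in>ebox n x d. \<bar>f y - f x\<bar> < e" using a x by blast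
    let ?A = "{y :: rvec. \<forall>i<n. \<bar>y i - x i\<bar> < d}"
    have "f y \<in> B" if "y \<in> U" "y \<in> ?A" for y
    proof -
      have "y \<in> ebox n x d" using that eopen_zero[OF U] by (auto simp: ebox_def)
      then show ?thesis using d e by (auto simp: dist_real_def abs_minus_commute subset_iff)
    qed
    then show "\<exists>A. open A \<and> x \<in> A \<and> (\<forall>y\<in>U. y \<in> A \<longrightarrow> f y \<in> B)"
      using open_coordinate_box[of n x d] d by (intro exI[of _ ?A]) auto
  qed
qed

lemma continuous_ebox:
  fixes f :: "rvec \<Rightarrow> real"
  assumes "eopen n U" "continuous_on U f" "x \<in> U" "e > 0"
  shows "\<exists>d>0. ebox n x d \<subseteq> U \<and> (\<forall>y\<in>ebox n x d. \<bar>f y - f x\<bar> < e)"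
  using continuous_on_iff_ebox[OF assms(1), of f] assms by blast

lemma eventually_update_in:
  assumes U: "eopen n U" and x: "x \<in> U" and i: "i < n"
  shows "\<forall>\<^sub>F t in nhds (x i). x(i := t) \<in> U"
proof -
  obtain e where e: "e > 0" "ebox n x e \<subseteq> U" using eopen_ebox[OF U x] by auto
  have "\<forall>\<^sub>F t in nhds (x i). dist t (x i) < e"
    using e(1) eventually_nhds_metric by blast
  then show ?thesis
  proof eventually_elim
    case (elim t)
    then have "x(i := t) \<in> ebox n x e"
      using i e eopen_zero[OF U x] by (auto simp: ebox_def dist_real_def)
    then show ?case using e by auto
  qed
qed

section \<open>Partial derivatives\<close>

definition pd :: "nat \<Rightarrow> (rvec \<Rightarrow> real) \<Rightarrow> rvec \<Rightarrow> real" where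
  "pd i f x = deriv (\<lambda>t. f (x(i := t))) (x i)"

lemma pd_I: "((\<lambda>t. f (x(i := t))) has_real_derivative D) (at (x i)) \<Longrightarrow> pd i f x = D"
  unfolding pd_def by (rule DERIV_imp_deriv)

lemma pd_cong:
  assumes U: "eopen n U" and x: "x \<in> U" and i: "i < n" and fg: "\<And>x. x \<in> U \<Longrightarrow> f x = g x"
  shows "pd i f x = pd i g x"
  unfolding pd_def
proof (rule deriv_cong_ev)
  show "\<forall>\<^sub>F t in nhds (x i). f (x(i := t)) = g (x(i := t))"
    using eventually_update_in[OF U x i] by eventually_elim (simp add: fg)
qed simp

lemma has_pd_cong:
  assumes U: "eopen n U" and x: "x \<in> U" and i: "i < n" and fg: "\<And>x. x \<in> U \<Longrightarrow> f x = g x"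
    and d: "((\<lambda>t. f (x(i := t))) has_real_derivative D) (at (x i))"
  shows "((\<lambda>t. g (x(i := t))) has_real_derivative D) (at (x i))"
proof -
  have "\<forall>\<^sub>F t in nhds (x i). g (x(i := t)) = f (x(i := t))"
    using eventually_update_in[OF U x i] by eventually_elim (simp add: fg)
  from DERIV_cong_ev[OF refl this refl] show ?thesis using d by blast
qed

lemma Ck_on_cong:
  assumes "eopen n U" "\<And>x. x \<in> U \<Longrightarrow> f x = g x" "Ck_on k n U f"
  shows "Ck_on k n U g"
proof (cases k)
  case 0 then show ?thesis using assms continuous_on_cong[of U U f g] by simp
next
  case (Suc k')
  have "continuous_on U g" using assms Suc continuous_on_cong[of U U f g] by simp
  moreover have "\<exists>h. (\<forall>x\<in>U. ((\<lambda>t. g (x(i := t))) has_real_derivative h x) (at (x i))) \<and> Ck_on k' n U h"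
    if i: "i < n" for i
  proof -
    obtain h where h: "\<forall>x\<in>U. ((\<lambda>t. f (x(i := t))) has_real_derivative h x) (at (x i))" "Ck_on k' n U h"
      using assms(3) Suc i by auto
    have "((\<lambda>t. g (x(i := t))) has_real_derivative h x) (at (x i))" if "x \<in> U" for x
      using has_pd_cong[OF assms(1) that i assms(2) h(1)[rule_format, OF that]] by blast
    then show ?thesis using h(2) by blast
  qed
  ultimately show ?thesis using Suc by simp
qed

text \<open>
  The definition of \<^const>\<open>Ck_on\<close> asserts the existence of derivatives; by uniqueness the existing one is
  \<^const>\<open>pd\<close>, so later proofs can compute with partial derivatives.
\<close>

lemma Ck_on_SucD:
  assumes U: "eopen n U" and f: "Ck_on (Suc k) n U f" and i: "i < n"
  shows "x \<in> U \<Longrightarrow> ((\<lambda>t. f (x(i := t))) has_real_derivative pd i f x) (at (x i))"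
    and "Ck_on k n U (pd i f)"
proof -
  obtain g where g: "\<forall>x\<in>U. ((\<lambda>t. f (x(i := t))) has_real_derivative g x) (at (x i))" "Ck_on k n U g"
    using f i by auto
  have eq: "pd i f x = g x" if "x \<in> U" for x using g(1) that pd_I by blast
  show "x \<in> U \<Longrightarrow> ((\<lambda>t. f (x(i := t))) has_real_derivative pd i f x) (at (x i))" using g eq by simp
  show "Ck_on k n U (pd i f)" using Ck_on_cong[OF U _ g(2)] eq by simp
qed

lemma Ck_on_continuous: "Ck_on k n U f \<Longrightarrow> continuous_on U f"
  by (cases k) auto

lemma Ck_on_Suc_imp: "Ck_on (Suc k) n U f \<Longrightarrow> Ck_on k n U f"
proof (induction k arbitrary: f)
  case 0 then show ?case by simp
next
  case (Suc k) then show ?case by (metis Ck_on.simps(2))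
qed

lemma Ck_on_subset: "Ck_on k n U f \<Longrightarrow> V \<subseteq> U \<Longrightarrow> Ck_on k n V f"
proof (induction k arbitrary: f)
  case 0 then show ?case using continuous_on_subset by auto
next
  case (Suc k)
  then have "continuous_on V f" using continuous_on_subset by auto
  moreover have "\<exists>g. (\<forall>x\<in>V. ((\<lambda>t. f (x(i := t))) has_real_derivative g x) (at (x i))) \<and> Ck_on k n V g"
    if i: "i < n" for i
  proof -
    obtain g where g: "\<forall>x\<in>U. ((\<lambda>t. f (x(i := t))) has_real_derivative g x) (at (x i))" "Ck_on k n U g"
      using Suc.prems(1) i by auto
    then show ?thesis using Suc.IH[OF g(2) Suc.prems(2)] Suc.prems(2) by blast
  qed
  ultimately show ?case by simp
qed

lemma Ck_on_const: "Ck_on k n U (\<lambda>_. c)"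
proof (induction k arbitrary: c)
  case (Suc k)
  then have "\<exists>g. (\<forall>x\<in>U. ((\<lambda>t. c) has_real_derivative g x) (at (x i))) \<and> Ck_on k n U g" for i
    by (intro exI[of _ "\<lambda>_. 0"]) auto
  then show ?case by simp
qed simp

lemma continuous_on_coordinate: "continuous_on U (\<lambda>x :: rvec. x j)"
  by (rule continuous_on_subset[OF continuous_on_product_coordinates]) auto

lemma Ck_on_coordinate: "Ck_on k n U (\<lambda>x. x j)"
proof (cases k)
  case (Suc k')
  have "\<exists>g. (\<forall>x\<in>U. ((\<lambda>t. (x(i := t)) j) has_real_derivative g x) (at (x i))) \<and> Ck_on k' n U g" for i
    by (intro exI[of _ "\<lambda>_. if i = j then 1 else 0"]) (auto simp: Ck_on_const)
  then show ?thesis using Suc continuous_on_coordinate by simp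
qed (simp add: continuous_on_coordinate)

lemma Ck_on_add: "Ck_on k n U f \<Longrightarrow> Ck_on k n U g \<Longrightarrow> Ck_on k n U (\<lambda>x. f x + g x)"
proof (induction k arbitrary: f g)
  case 0 then show ?case by (auto intro: continuous_intros)
next
  case (Suc k)
  have 1: "\<exists>h. (\<forall>x\<in>U. ((\<lambda>t. f (x(i := t)) + g (x(i := t))) has_real_derivative h x) (at (x i))) \<and> Ck_on k n U h"
    if i: "i < n" for i
  proof -
    obtain f' where f': "\<forall>x\<in>U. ((\<lambda>t. f (x(i := t))) has_real_derivative f' x) (at (x i))" "Ck_on k n U f'"
      using Suc.prems(1) i by auto
    obtain g' where g': "\<forall>x\<in>U. ((\<lambda>t. g (x(i := t))) has_real_derivative g' x) (at (x i))" "Ck_on k n U g'"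
      using Suc.prems(2) i by auto
    show ?thesis using f' g' Suc.IH by (intro exI[of _ "\<lambda>x. f' x + g' x"]) (auto intro: DERIV_add)
  qed
  have 2: "continuous_on U (\<lambda>x. f x + g x)"
    by (intro continuous_on_add Ck_on_continuous[OF Suc.prems(1)] Ck_on_continuous[OF Suc.prems(2)])
  show ?case unfolding Ck_on.simps using 1 2 by blast
qed

lemma Ck_on_mult: "Ck_on k n U f \<Longrightarrow> Ck_on k n U g \<Longrightarrow> Ck_on k n U (\<lambda>x. f x * g x)"
proof (induction k arbitrary: f g)
  case 0 then show ?case by (auto intro: continuous_intros)
next
  case (Suc k)
  have 1: "\<exists>h. (\<forall>x\<in>U. ((\<lambda>t. f (x(i := t)) * g (x(i := t))) has_real_derivative h x) (at (x i))) \<and> Ck_on k n U h"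
    if i: "i < n" for i
  proof -
    obtain f' where f': "\<forall>x\<in>U. ((\<lambda>t. f (x(i := t))) has_real_derivative f' x) (at (x i))" "Ck_on k n U f'"
      using Suc.prems(1) i by auto
    obtain g' where g': "\<forall>x\<in>U. ((\<lambda>t. g (x(i := t))) has_real_derivative g' x) (at (x i))" "Ck_on k n U g'"
      using Suc.prems(2) i by auto
    have "Ck_on k n U (\<lambda>x. f' x * g x + g' x * f x)"
      by (intro Ck_on_add Suc.IH f'(2) g'(2) Ck_on_Suc_imp[OF Suc.prems(1)] Ck_on_Suc_imp[OF Suc.prems(2)])
    moreover have "((\<lambda>t. f (x(i := t)) * g (x(i := t))) has_real_derivative f' x * g x + g' x * f x) (at (x i))"
      if "x \<in> U" for x using DERIV_mult[OF f'(1)[rule_format, OF that] g'(1)[rule_format, OF that]] by simp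
    ultimately show ?thesis by (intro exI[of _ "\<lambda>x. f' x * g x + g' x * f x"]) auto
  qed
  have 2: "continuous_on U (\<lambda>x. f x * g x)"
    by (intro continuous_on_mult Ck_on_continuous[OF Suc.prems(1)] Ck_on_continuous[OF Suc.prems(2)])
  show ?case unfolding Ck_on.simps using 1 2 by blast
qed

lemma Ck_on_sum: "(\<And>j. j \<in> A \<Longrightarrow> Ck_on k n U (f j)) \<Longrightarrow> Ck_on k n U (\<lambda>x. \<Sum>j\<in>A. f j x)"
  by (induction A rule: infinite_finite_induct) (simp_all add: Ck_on_const Ck_on_add)

lemma Ck_on_local:
  assumes U: "eopen n U"
    and l: "\<And>x. x \<in> U \<Longrightarrow> \<exists>N. eopen n N \<and> x \<in> N \<and> N \<subseteq> U \<and> Ck_on k n N f"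
  shows "Ck_on k n U f"
  using l
proof (induction k arbitrary: f)
  case 0
  show ?case unfolding Ck_on.simps continuous_on_iff_ebox[OF U]
  proof (intro ballI allI impI)
    fix x and e :: real assume x: "x \<in> U" and e: "e > 0"
    obtain N where N: "eopen n N" "x \<in> N" "N \<subseteq> U" "continuous_on N f" using 0[OF x] by auto
    from continuous_ebox[OF N(1) N(4) N(2) e] N(3)
    show "\<exists>d>0. ebox n x d \<subseteq> U \<and> (\<forall>y\<in>ebox n x d. \<bar>f y - f x\<bar> < e)" by (meson subset_trans)
  qed
next
  case (Suc k)
  have "Ck_on k n U f"
  proof (rule Suc.IH)
    fix x assume "x \<in> U"
    from Suc.prems[OF this] obtain N where "eopen n N" "x \<in> N" "N \<subseteq> U" "Ck_on (Suc k) n N f" by (elim exE conjE)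
    then show "\<exists>N. eopen n N \<and> x \<in> N \<and> N \<subseteq> U \<and> Ck_on k n N f" by (metis Ck_on_Suc_imp)
  qed
  moreover have "((\<lambda>t. f (x(i := t))) has_real_derivative pd i f x) (at (x i))" if "x \<in> U" "i < n" for x i
  proof -
    from Suc.prems[OF that(1)] obtain N where N: "eopen n N" "x \<in> N" "Ck_on (Suc k) n N f" by (elim exE conjE)
    show ?thesis by (rule Ck_on_SucD(1)[OF N(1,3) that(2) N(2)])
  qed
  moreover have "Ck_on k n U (pd i f)" if i: "i < n" for i
  proof (rule Suc.IH)
    fix x assume "x \<in> U"
    from Suc.prems[OF this] obtain N where N: "eopen n N" "x \<in> N" "N \<subseteq> U" "Ck_on (Suc k) n N f" by (elim exE conjE)
    from Ck_on_SucD(2)[OF N(1,4) i] N(1-3)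
    show "\<exists>N. eopen n N \<and> x \<in> N \<and> N \<subseteq> U \<and> Ck_on k n N (pd i f)" by (intro exI[of _ N] conjI)
  qed
  ultimately show ?case unfolding Ck_on.simps using Ck_on_continuous[of k n U f] by metis
qed

section \<open>The chain rule\<close>

text \<open>
  Pass from \<open>x\<close> to \<open>y\<close> by changing one coordinate at a time.  Each step is a mean value estimate in one
  variable, and by continuity the partial derivatives at the intermediate points are close to those at \<open>x\<close>.
\<close>

lemma first_order_approximation:
  assumes U: "eopen n U" and f: "Ck_on (Suc k) n U f" and x: "x \<in> U" and e: "e > 0"
  shows "\<exists>d>0. ebox n x d \<subseteq> U \<and> (\<forall>y\<in>ebox n x d.
    \<bar>f y - f x - (\<Sum>j<n. pd j f x * (y j - x j))\<bar> \<le> e * (\<Sum>j<n. \<bar>y j - x j\<bar>))"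
proof -
  have "\<exists>d>0. ebox n x d \<subseteq> U \<and> (\<forall>y\<in>ebox n x d. \<bar>pd j f y - pd j f x\<bar> < e)" if "j < n" for j
    using continuous_ebox[OF U Ck_on_continuous[OF Ck_on_SucD(2)[OF U f that]] x e] .
  then obtain d0 where d0: "\<And>j. j < n \<Longrightarrow> d0 j > 0 \<and> (\<forall>y\<in>ebox n x (d0 j). \<bar>pd j f y - pd j f x\<bar> < e)"
    by metis
  obtain d1 where d1: "d1 > 0" "ebox n x d1 \<subseteq> U" using eopen_ebox[OF U x] by auto
  define d where "d = Min (insert d1 (d0 ` {..<n}))"
  have d: "d > 0" "d \<le> d1" "\<And>j. j < n \<Longrightarrow> d \<le> d0 j" unfolding d_def using d0 d1 by auto
  have dU: "ebox n x d \<subseteq> U" using d d1 ebox_mono by blast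
  have dp: "\<bar>pd j f y - pd j f x\<bar> < e" if "j < n" "y \<in> ebox n x d" for j y
    using d0 d(3) that ebox_mono by blast
  have "\<bar>f y - f x - (\<Sum>j<n. pd j f x * (y j - x j))\<bar> \<le> e * (\<Sum>j<n. \<bar>y j - x j\<bar>)" if y: "y \<in> ebox n x d" for y
  proof -
    \<comment> \<open>the path from \<open>x\<close> to \<open>y\<close>: the first \<open>k\<close> coordinates have been changed\<close>
    define z where "z k = (\<lambda>j. if j < k then y j else x j)" for k :: nat
    have z0: "z 0 = x" by (auto simp: z_def)
    have zn: "z n = y" using y eopen_zero[OF U x] by (auto simp: z_def ebox_def fun_eq_iff)
    have step: "\<bar>f (z (Suc j)) - f (z j) - pd j f x * (y j - x j)\<bar> \<le> e * \<bar>y j - x j\<bar>" if j: "j < n" for j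
    proof -
      let ?S = "ball (x j) d"
      let ?g = "\<lambda>t. f ((z j)(j := t)) - pd j f x * t"
      have inb: "(z j)(j := t) \<in> ebox n x d" if "t \<in> ?S" for t
        using that y j d eopen_zero[OF U x] by (auto simp: z_def ebox_def dist_real_def abs_minus_commute)
      have der: "(?g has_field_derivative pd j f ((z j)(j := t)) - pd j f x) (at t within ?S)" if "t \<in> ?S" for t
      proof -
        have "((\<lambda>s. f ((z j)(j := t, j := s))) has_real_derivative pd j f ((z j)(j := t))) (at (((z j)(j := t)) j))"
          using Ck_on_SucD(1)[OF U f j] inb[OF that] dU by blast
        then have "((\<lambda>s. f ((z j)(j := s))) has_real_derivative pd j f ((z j)(j := t))) (at t)" by simp
        then have "(?g has_real_derivative pd j f ((z j)(j := t)) - pd j f x) (at t)"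
          by (auto intro!: derivative_eq_intros)
        then show ?thesis by (rule has_field_derivative_at_within)
      qed
      have "norm (?g (y j) - ?g (x j)) \<le> e * norm (y j - x j)"
        by (rule field_differentiable_bound[OF convex_ball der])
          (use dp[OF j inb] d y j in \<open>auto simp: ebox_def dist_real_def abs_minus_commute less_imp_le\<close>)
      moreover have "(z j)(j := y j) = z (Suc j)" "(z j)(j := x j) = z j" by (auto simp: z_def fun_eq_iff)
      ultimately show ?thesis by (simp add: algebra_simps)
    qed
    have "f y - f x = (\<Sum>j<n. f (z (Suc j)) - f (z j))"
      using sum_lessThan_telescope[of "\<lambda>j. f (z j)" n] by (simp add: z0 zn)
    then have "\<bar>f y - f x - (\<Sum>j<n. pd j f x * (y j - x j))\<bar>
        = \<bar>\<Sum>j<n. f (z (Suc j)) - f (z j) - pd j f x * (y j - x j)\<bar>"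
      by (simp add: sum_subtractf)
    also have "\<dots> \<le> (\<Sum>j<n. \<bar>f (z (Suc j)) - f (z j) - pd j f x * (y j - x j)\<bar>)" by (rule sum_abs)
    also have "\<dots> \<le> (\<Sum>j<n. e * \<bar>y j - x j\<bar>)" by (rule sum_mono) (use step in auto)
    finally show ?thesis by (simp add: sum_distrib_left)
  qed
  then show ?thesis using d(1) dU by blast
qed

text \<open>
  The first-order remainder of \<open>f\<close> along \<open>c\<close> is small compared with the increment of \<open>c\<close>, which is at most a
  constant multiple of \<open>\<bar>t - s\<bar>\<close>.  So the remainder has derivative \<open>0\<close>, and what is left is affine in \<open>c t\<close>.
\<close>

lemma chain_rule_curve:
  assumes U: "eopen n U" and f: "Ck_on (Suc k) n U f" and x: "c s \<in> U"
    and cz: "\<forall>\<^sub>F t in nhds s. \<forall>i\<ge>n. c t i = 0"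
    and c: "\<And>j. j < n \<Longrightarrow> ((\<lambda>t. c t j) has_real_derivative c' j) (at s)"
  shows "((\<lambda>t. f (c t)) has_real_derivative (\<Sum>j<n. pd j f (c s) * c' j)) (at s)"
proof -
  define R where "R t = f (c t) - f (c s) - (\<Sum>j<n. pd j f (c s) * (c t j - c s j))" for t
  define C where "C = (\<Sum>j<n. \<bar>c' j\<bar> + 1)"
  have C0: "C \<ge> 0" unfolding C_def by (intro sum_nonneg) auto
  have quot: "((\<lambda>t. (c t j - c s j) / (t - s)) \<longlongrightarrow> c' j) (at s)" if "j < n" for j
    using c[OF that] by (simp add: has_field_derivative_iff)
  have cont: "((\<lambda>t. c t j) \<longlongrightarrow> c s j) (at s)" if "j < n" for j
    using c[OF that] by (metis DERIV_continuous isContD isCont_def)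
  have lim: "((\<lambda>t. (R t - R s) / (t - s)) \<longlongrightarrow> 0) (at s)"
  proof (rule tendstoI)
    fix e :: real assume e: "e > 0"
    define e' where "e' = e / (C + 1)"
    have e': "e' > 0" "e' * C < e" using e C0 by (auto simp: e'_def field_simps)
    obtain d where d: "d > 0" "\<forall>y\<in>ebox n (c s) d.
        \<bar>f y - f (c s) - (\<Sum>j<n. pd j f (c s) * (y j - c s j))\<bar> \<le> e' * (\<Sum>j<n. \<bar>y j - c s j\<bar>)"
      using first_order_approximation[OF U f x e'(1)] by blast
    have ev1: "\<forall>\<^sub>F t in at s. \<forall>j\<in>{..<n}. \<bar>c t j - c s j\<bar> < d"
      using cont d(1) by (intro eventually_ball_finite) (auto simp: tendsto_iff dist_real_def)
    have ev2: "\<forall>\<^sub>F t in at s. \<forall>j\<in>{..<n}. \<bar>(c t j - c s j) / (t - s) - c' j\<bar> < 1"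
      using quot by (intro eventually_ball_finite) (auto simp: tendsto_iff dist_real_def)
    have ev3: "\<forall>\<^sub>F t in at s. \<forall>i\<ge>n. c t i = 0"
      using cz by (simp add: eventually_nhds_conv_at)
    have ev4: "\<forall>\<^sub>F t in at s. t \<noteq> s" by (simp add: eventually_at_filter)
    show "\<forall>\<^sub>F t in at s. dist ((R t - R s) / (t - s)) 0 < e"
      using ev1 ev2 ev3 ev4
    proof eventually_elim
      case (elim t)
      have "c t \<in> ebox n (c s) d" using elim by (auto simp: ebox_def)
      then have "\<bar>R t\<bar> \<le> e' * (\<Sum>j<n. \<bar>c t j - c s j\<bar>)" using d(2) by (simp add: R_def)
      also have "(\<Sum>j<n. \<bar>c t j - c s j\<bar>) \<le> (\<Sum>j<n. (\<bar>c' j\<bar> + 1) * \<bar>t - s\<bar>)"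
      proof (rule sum_mono)
        fix j assume "j \<in> {..<n}"
        then have "\<bar>(c t j - c s j) / (t - s) - c' j\<bar> < 1" using elim(2) by blast
        then have "\<bar>(c t j - c s j) / (t - s)\<bar> \<le> \<bar>c' j\<bar> + 1" by linarith
        then show "\<bar>c t j - c s j\<bar> \<le> (\<bar>c' j\<bar> + 1) * \<bar>t - s\<bar>"
          using elim(4) by (simp add: abs_divide field_simps)
      qed
      also have "\<dots> = C * \<bar>t - s\<bar>" by (simp add: C_def sum_distrib_right)
      finally have "\<bar>R t\<bar> \<le> e' * C * \<bar>t - s\<bar>" using e' by (simp add: mult_left_mono mult.assoc)
      then have "\<bar>R t\<bar> / \<bar>t - s\<bar> \<le> e' * C" using elim(4) by (simp add: field_simps)
      moreover have "R s = 0" by (simp add: R_def)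
      ultimately show ?case using e'(2) by (simp add: abs_divide)
    qed
  qed
  then have dR: "(R has_real_derivative 0) (at s)" by (simp add: has_field_derivative_iff)
  have "((\<lambda>t. R t + (f (c s) + (\<Sum>j<n. pd j f (c s) * (c t j - c s j)))) has_real_derivative
      0 + (0 + (\<Sum>j<n. pd j f (c s) * (c' j - 0)))) (at s)"
    by (intro DERIV_add dR DERIV_const DERIV_sum DERIV_cmult DERIV_diff c) auto
  then show ?thesis by (simp add: R_def)
qed

lemma chain_rule_pd:
  assumes U: "eopen n U" and V: "eopen m V" and f: "Ck_on (Suc k) n U f" and hU: "h ` V \<subseteq> U"
    and h: "\<And>j. j < n \<Longrightarrow> Ck_on (Suc l) m V (\<lambda>v. h v j)" and v: "v \<in> V" and i: "i < m"
  shows "((\<lambda>t. f (h (v(i := t)))) has_real_derivative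
    (\<Sum>j<n. pd j f (h v) * pd i (\<lambda>v. h v j) v)) (at (v i))"
proof -
  have "((\<lambda>t. f (h (v(i := t)))) has_real_derivative
      (\<Sum>j<n. pd j f (h (v(i := v i))) * pd i (\<lambda>v. h v j) v)) (at (v i))"
  proof (rule chain_rule_curve[OF U f])
    show "h (v(i := v i)) \<in> U" using hU v by auto
    show "\<forall>\<^sub>F t in nhds (v i). \<forall>ia\<ge>n. h (v(i := t)) ia = 0"
      using eventually_update_in[OF V v i] by eventually_elim (use hU eopen_zero[OF U] in blast)
    show "((\<lambda>t. h (v(i := t)) j) has_real_derivative pd i (\<lambda>v. h v j) v) (at (v i))" if "j < n" for j
      using Ck_on_SucD(1)[OF V h[OF that] i v] .
  qed
  then show ?thesis by simp
qed

lemma continuous_on_coordinatewise_compose: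
  fixes f :: "rvec \<Rightarrow> real"
  assumes U: "eopen n U" and f: "continuous_on U f" and hU: "h ` V \<subseteq> U"
    and h: "\<And>j. j < n \<Longrightarrow> continuous_on V (\<lambda>v. h v j)"
  shows "continuous_on (V :: rvec set) (\<lambda>v. f (h v))"
proof -
  have "continuous_on V (\<lambda>v. h v j)" for j
  proof (cases "j < n")
    case False
    then have "h v j = 0" if "v \<in> V" for v
      using eopen_zero[OF U, of "h v" j] hU that by (simp add: image_subset_iff)
    then have "continuous_on V (\<lambda>v. h v j) = continuous_on V (\<lambda>_. 0 :: real)"
      by (intro continuous_on_cong) auto
    then show ?thesis by simp
  qed (use h in auto)
  then have "continuous_on V h" by (rule continuous_on_coordinatewise_then_product)
  then show ?thesis using continuous_on_compose2[OF f _ hU] by blast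
qed

lemma Ck_on_compose:
  assumes U: "eopen n U" and V: "eopen m V" and hU: "h ` V \<subseteq> U"
  shows "Ck_on k n U f \<Longrightarrow> (\<And>j. j < n \<Longrightarrow> Ck_on k m V (\<lambda>v. h v j)) \<Longrightarrow> Ck_on k m V (\<lambda>v. f (h v))"
proof (induction k arbitrary: f)
  case 0 show ?case unfolding Ck_on.simps
    by (rule continuous_on_coordinatewise_compose[OF U _ hU]) (use 0 in simp_all)
next
  case (Suc k)
  have "continuous_on V (\<lambda>v. f (h v))"
    by (rule continuous_on_coordinatewise_compose[OF U Ck_on_continuous[OF Suc.prems(1)] hU])
      (rule Ck_on_continuous[OF Suc.prems(2)])
  moreover have "\<exists>g. (\<forall>x\<in>V. ((\<lambda>t. f (h (x(i := t)))) has_real_derivative g x) (at (x i))) \<and> Ck_on k m V g"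
    if i: "i < m" for i
  proof (intro exI[of _ "\<lambda>v. \<Sum>j<n. pd j f (h v) * pd i (\<lambda>v. h v j) v"] conjI ballI)
    fix v assume "v \<in> V"
    show "((\<lambda>t. f (h (v(i := t)))) has_real_derivative
       (\<Sum>j<n. pd j f (h v) * pd i (\<lambda>v. h v j) v)) (at (v i))"
      by (rule chain_rule_pd[OF U V Suc.prems(1) hU Suc.prems(2) \<open>v \<in> V\<close> i])
  next
    have "Ck_on k m V (\<lambda>v. pd j f (h v) * pd i (\<lambda>v. h v j) v)" if "j < n" for j
    proof -
      have "Ck_on k m V (\<lambda>v. pd j f (h v))"
        by (rule Suc.IH[OF Ck_on_SucD(2)[OF U Suc.prems(1) that] Ck_on_Suc_imp[OF Suc.prems(2)]])
      then show ?thesis by (rule Ck_on_mult[OF _ Ck_on_SucD(2)[OF V Suc.prems(2)[OF that] i]])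
    qed
    then show "Ck_on k m V (\<lambda>v. \<Sum>j<n. pd j f (h v) * pd i (\<lambda>v. h v j) v)"
      by (intro Ck_on_sum) auto
  qed
  ultimately show ?case by simp
qed

section \<open>Smooth functions\<close>

lemma smooth_open: "smooth_fun_on n U f \<Longrightarrow> eopen n U"
  by (simp add: smooth_fun_on_def)

lemma smooth_Ck: "smooth_fun_on n U f \<Longrightarrow> Ck_on k n U f"
  by (simp add: smooth_fun_on_def)

lemma smooth_continuous: "smooth_fun_on n U f \<Longrightarrow> continuous_on U f"
  using smooth_Ck[of n U f 0] by simp

lemma smooth_cong: "smooth_fun_on n U f \<Longrightarrow> (\<And>x. x \<in> U \<Longrightarrow> f x = g x) \<Longrightarrow> smooth_fun_on n U g"
  unfolding smooth_fun_on_def using Ck_on_cong by blast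

lemma smooth_subset: "smooth_fun_on n U f \<Longrightarrow> eopen n V \<Longrightarrow> V \<subseteq> U \<Longrightarrow> smooth_fun_on n V f"
  unfolding smooth_fun_on_def using Ck_on_subset by blast

lemma smooth_const: "eopen n U \<Longrightarrow> smooth_fun_on n U (\<lambda>_. c)"
  by (simp add: smooth_fun_on_def Ck_on_const)

lemma smooth_coordinate: "eopen n U \<Longrightarrow> smooth_fun_on n U (\<lambda>x. x j)"
  by (simp add: smooth_fun_on_def Ck_on_coordinate)

lemma smooth_add: "smooth_fun_on n U f \<Longrightarrow> smooth_fun_on n U g \<Longrightarrow> smooth_fun_on n U (\<lambda>x. f x + g x)"
  by (simp add: smooth_fun_on_def Ck_on_add)

lemma smooth_mult: "smooth_fun_on n U f \<Longrightarrow> smooth_fun_on n U g \<Longrightarrow> smooth_fun_on n U (\<lambda>x. f x * g x)"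
  by (simp add: smooth_fun_on_def Ck_on_mult)

lemma smooth_diff:
  assumes "smooth_fun_on n U f" "smooth_fun_on n U g" shows "smooth_fun_on n U (\<lambda>x. f x - g x)"
  using smooth_add[OF assms(1) smooth_mult[OF smooth_const[OF smooth_open[OF assms(2)], of "-1"] assms(2)]]
  by simp

lemma smooth_sum: "eopen n U \<Longrightarrow> (\<And>j. j \<in> A \<Longrightarrow> smooth_fun_on n U (f j)) \<Longrightarrow> smooth_fun_on n U (\<lambda>x. \<Sum>j\<in>A. f j x)"
  by (simp add: smooth_fun_on_def Ck_on_sum)

lemma smooth_local:
  assumes "eopen n U" "\<And>x. x \<in> U \<Longrightarrow> \<exists>N. eopen n N \<and> x \<in> N \<and> N \<subseteq> U \<and> smooth_fun_on n N f"
  shows "smooth_fun_on n U f"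
  unfolding smooth_fun_on_def
proof (intro conjI allI)
  fix k show "Ck_on k n U f"
  proof (rule Ck_on_local[OF assms(1)])
    fix x assume "x \<in> U"
    from assms(2)[OF this] obtain N where "eopen n N" "x \<in> N" "N \<subseteq> U" "smooth_fun_on n N f" by (elim exE conjE)
    then show "\<exists>N. eopen n N \<and> x \<in> N \<and> N \<subseteq> U \<and> Ck_on k n N f" by (intro exI[of _ N] conjI smooth_Ck)
  qed
qed (rule assms(1))

lemma smooth_compose:
  assumes f: "smooth_fun_on n U f" and h: "\<And>j. j < n \<Longrightarrow> smooth_fun_on m V (\<lambda>v. h v j)"
    and V: "eopen m V" and hU: "h ` V \<subseteq> U"
  shows "smooth_fun_on m V (\<lambda>v. f (h v))"
  unfolding smooth_fun_on_def
proof (intro conjI allI)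
  fix k show "Ck_on k m V (\<lambda>v. f (h v))"
    using Ck_on_compose[OF smooth_open[OF f] V hU smooth_Ck[OF f] smooth_Ck[OF h]] .
qed (rule V)

lemma smooth_euclidean_compose_fun:
  assumes "smooth_euclidean m V n U h" "smooth_fun_on n U f"
  shows "smooth_fun_on m V (\<lambda>v. f (h v))"
  by (rule smooth_compose[OF assms(2)]) (use assms(1) in \<open>simp_all add: smooth_euclidean_def\<close>)

lemma smooth_has_pd:
  "smooth_fun_on n U f \<Longrightarrow> i < n \<Longrightarrow> x \<in> U \<Longrightarrow> ((\<lambda>t. f (x(i := t))) has_real_derivative pd i f x) (at (x i))"
  by (rule Ck_on_SucD(1)[OF smooth_open smooth_Ck])

lemma smooth_pd: "smooth_fun_on n U f \<Longrightarrow> i < n \<Longrightarrow> smooth_fun_on n U (pd i f)"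
  unfolding smooth_fun_on_def by (metis Ck_on_SucD(2))

lemma pd_add: "smooth_fun_on n U f \<Longrightarrow> smooth_fun_on n U g \<Longrightarrow> i < n \<Longrightarrow> x \<in> U \<Longrightarrow>
    pd i (\<lambda>x. f x + g x) x = pd i f x + pd i g x"
  by (intro pd_I DERIV_add smooth_has_pd)

lemma pd_const: "pd i (\<lambda>x. c) x = 0"
  by (intro pd_I DERIV_const)

lemma pd_coordinate: "pd i (\<lambda>x. x j) x = (if i = j then 1 else 0)"
  by (intro pd_I) auto

lemma pd_diff: "smooth_fun_on n U f \<Longrightarrow> smooth_fun_on n U g \<Longrightarrow> i < n \<Longrightarrow> x \<in> U \<Longrightarrow>
    pd i (\<lambda>x. f x - g x) x = pd i f x - pd i g x"
  by (intro pd_I DERIV_diff smooth_has_pd)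

lemma pd_mult:
  assumes "smooth_fun_on n U f" "smooth_fun_on n U g" "i < n" "x \<in> U"
  shows "pd i (\<lambda>x. f x * g x) x = pd i f x * g x + f x * pd i g x"
  using DERIV_mult[OF smooth_has_pd[OF assms(1,3,4)] smooth_has_pd[OF assms(2,3,4)]]
  by (intro pd_I) (simp add: mult.commute)

lemma pd_sum: "(\<And>j. j \<in> A \<Longrightarrow> smooth_fun_on n U (f j)) \<Longrightarrow> i < n \<Longrightarrow> x \<in> U \<Longrightarrow>
    pd i (\<lambda>x. \<Sum>j\<in>A. f j x) x = (\<Sum>j\<in>A. pd i (f j) x)"
  by (intro pd_I DERIV_sum smooth_has_pd)

lemma pd_compose:
  assumes f: "smooth_fun_on n U f" and h: "smooth_euclidean m V n U h" and "i < m" "v \<in> V"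
  shows "pd i (\<lambda>v. f (h v)) v = (\<Sum>j<n. pd j f (h v) * pd i (\<lambda>v. h v j) v)"
  by (intro pd_I chain_rule_pd[OF smooth_open[OF f] _ smooth_Ck[OF f] _ smooth_Ck])
    (use h assms in \<open>auto simp: smooth_euclidean_def\<close>)

section \<open>Bump functions\<close>

text \<open>
  The flat function \<open>exp (- 1 / t)\<close> is the case \<open>k = 0\<close>; the factors \<open>t\<^sup>-\<^sup>k\<close> appear in its derivatives.
\<close>

definition flat_exp :: "nat \<Rightarrow> real \<Rightarrow> real" where
  "flat_exp k t = (if t > 0 then (1 / t) ^ k * exp (- (1 / t)) else 0)"

lemma flat_exp_tendsto: "((\<lambda>h. flat_exp k h) \<longlongrightarrow> 0) (at_right 0)"
proof -
  have "((\<lambda>x. x ^ k / exp x) \<longlongrightarrow> (0 :: real)) at_top" by (rule tendsto_power_div_exp_0)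
  moreover have "filterlim (\<lambda>h :: real. inverse h) at_top (at_right 0)" by (rule filterlim_inverse_at_top_right)
  ultimately have "((\<lambda>h. (inverse h) ^ k / exp (inverse h)) \<longlongrightarrow> (0 :: real)) (at_right 0)"
    by (rule filterlim_compose)
  moreover have "\<forall>\<^sub>F h in at_right 0. (inverse h) ^ k / exp (inverse h) = flat_exp k h"
    by (simp add: eventually_at_right_less eventually_at_filter flat_exp_def exp_minus divide_inverse)
  ultimately show ?thesis by (simp add: tendsto_cong)
qed

text \<open>
  The family is closed under differentiation, so all its members are smooth.  At \<open>0\<close> this holds because the
  difference quotient of member \<open>k\<close> from the right is member \<open>k + 1\<close>, which tends to \<open>0\<close>.
\<close>

lemma flat_exp_deriv:
  "(flat_exp k has_real_derivative (flat_exp (k + 2) t - real k * flat_exp (Suc k) t)) (at t)"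
proof -
  consider "t > 0" | "t < 0" | "t = 0" by linarith
  then show ?thesis
  proof cases
    case 1
    have ev: "\<forall>\<^sub>F x in nhds t. flat_exp k x = (1 / x) ^ k * exp (- (1 / x))"
      using eventually_nhds_in_open[of "{0<..}" t] 1 by (auto simp: flat_exp_def elim!: eventually_mono)
    have "((\<lambda>x. (1 / x) ^ k * exp (- (1 / x))) has_real_derivative
        (real k * (1 / t) ^ (k - 1) * (- (1 / t\<^sup>2))) * exp (- (1 / t))
          + (exp (- (1 / t)) * (1 / t\<^sup>2)) * (1 / t) ^ k) (at t)"
      using 1 by (auto intro!: derivative_eq_intros simp: power2_eq_square)
    also have "(real k * (1 / t) ^ (k - 1) * (- (1 / t\<^sup>2))) * exp (- (1 / t))
          + (exp (- (1 / t)) * (1 / t\<^sup>2)) * (1 / t) ^ k = flat_exp (k + 2) t - real k * flat_exp (Suc k) t"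
    proof (cases k)
      case 0 then show ?thesis using 1 by (simp add: flat_exp_def power2_eq_square)
    next
      case (Suc j) then show ?thesis using 1 by (simp add: flat_exp_def power2_eq_square field_simps)
    qed
    finally show ?thesis using DERIV_cong_ev[OF refl ev refl] by blast
  next
    case 2
    have ev: "\<forall>\<^sub>F x in nhds t. flat_exp k x = 0"
      using eventually_nhds_in_open[of "{..<0}" t] 2 by (auto simp: flat_exp_def elim!: eventually_mono)
    have "((\<lambda>_. 0) has_real_derivative 0) (at t)" by simp
    then have "(flat_exp k has_real_derivative 0) (at t)" using DERIV_cong_ev[OF refl ev refl] by blast
    then show ?thesis using 2 by (simp add: flat_exp_def)
  next
    case 3
    have "((\<lambda>h. flat_exp k h / h) \<longlongrightarrow> 0) (at_left 0)"
      by (rule tendsto_eventually) (simp add: flat_exp_def eventually_at_filter)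
    moreover have "((\<lambda>h. flat_exp k h / h) \<longlongrightarrow> 0) (at_right 0)"
    proof -
      have "\<forall>\<^sub>F h in at_right 0. flat_exp (Suc k) h = flat_exp k h / h"
        by (simp add: eventually_at_filter flat_exp_def)
      then show ?thesis using flat_exp_tendsto[of "Suc k"] by (simp add: tendsto_cong)
    qed
    ultimately have "((\<lambda>h. flat_exp k h / h) \<longlongrightarrow> 0) (at 0)" by (rule filterlim_split_at)
    then show ?thesis using 3 by (simp add: has_field_derivative_iff flat_exp_def)
  qed
qed

lemma Ck_on_flat_exp:
  assumes U: "eopen n U"
  shows "Ck_on j n U f \<Longrightarrow> Ck_on j n U (\<lambda>x. flat_exp k (f x))"
proof (induction j arbitrary: k)
  case 0
  have "continuous_on UNIV (flat_exp k)"
    using flat_exp_deriv by (meson DERIV_continuous continuous_at_imp_continuous_on)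
  then show ?case using 0 continuous_on_compose2[of UNIV "flat_exp k" U f] by simp
next
  case (Suc j)
  have 1: "continuous_on U (\<lambda>x. flat_exp k (f x))"
  proof -
    have "continuous_on UNIV (flat_exp k)"
      using flat_exp_deriv by (meson DERIV_continuous continuous_at_imp_continuous_on)
    then show ?thesis using Ck_on_continuous[OF Suc.prems] continuous_on_compose2[of UNIV "flat_exp k" U f] by simp
  qed
  have 2: "\<exists>g. (\<forall>x\<in>U. ((\<lambda>t. flat_exp k (f (x(i := t)))) has_real_derivative g x) (at (x i))) \<and> Ck_on j n U g"
    if i: "i < n" for i
  proof (intro exI[of _ "\<lambda>x. (flat_exp (k + 2) (f x) + (- real k) * flat_exp (Suc k) (f x)) * pd i f x"] conjI ballI)
    fix x assume x: "x \<in> U"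
    have "(flat_exp k has_real_derivative (flat_exp (k + 2) (f x) - real k * flat_exp (Suc k) (f x))) (at (f (x(i := x i))))"
      using flat_exp_deriv[of k "f x"] by simp
    from DERIV_chain2[OF this Ck_on_SucD(1)[OF U Suc.prems i x]]
    show "((\<lambda>t. flat_exp k (f (x(i := t)))) has_real_derivative
        (flat_exp (k + 2) (f x) + (- real k) * flat_exp (Suc k) (f x)) * pd i f x) (at (x i))"
      unfolding mult_minus_left add_uminus_conv_diff .
  next
    note c = Ck_on_Suc_imp[OF Suc.prems]
    show "Ck_on j n U (\<lambda>x. (flat_exp (k + 2) (f x) + (- real k) * flat_exp (Suc k) (f x)) * pd i f x)"
      by (rule Ck_on_mult[OF Ck_on_add[OF Suc.IH[OF c] Ck_on_mult[OF Ck_on_const Suc.IH[OF c]]]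
            Ck_on_SucD(2)[OF U Suc.prems i]])
  qed
  show ?case unfolding Ck_on.simps using 1 2 by blast
qed

lemma smooth_flat_exp: "smooth_fun_on n U f \<Longrightarrow> smooth_fun_on n U (\<lambda>x. flat_exp k (f x))"
  unfolding smooth_fun_on_def using Ck_on_flat_exp by blast

lemma flat_exp_nonneg: "0 \<le> flat_exp k t" by (simp add: flat_exp_def)

text \<open>
  The factor \<^term>\<open>exp 1 :: real\<close> makes the value at the centre \<open>y\<close> equal to \<open>1\<close>.
\<close>

definition bump :: "nat \<Rightarrow> rvec \<Rightarrow> real \<Rightarrow> rvec \<Rightarrow> real" where
  "bump n y e z = exp 1 * flat_exp 0 (1 - (\<Sum>i<n. ((z i - y i) / e)\<^sup>2))"

lemma bump_smooth: assumes U: "eopen n U" shows "smooth_fun_on n U (bump m y e)"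
proof -
  have 1: "smooth_fun_on n U (\<lambda>z. ((z i - y i) / e)\<^sup>2)" for i
  proof -
    have a: "smooth_fun_on n U (\<lambda>z. (z i - y i) * inverse e)"
      by (rule smooth_mult[OF smooth_diff[OF smooth_coordinate[OF U] smooth_const[OF U]] smooth_const[OF U]])
    show ?thesis using smooth_mult[OF a a] by (simp add: power2_eq_square divide_inverse)
  qed
  have 2: "smooth_fun_on n U (\<lambda>z. 1 - (\<Sum>i<m. ((z i - y i) / e)\<^sup>2))"
    by (rule smooth_diff[OF smooth_const[OF U] smooth_sum[OF U 1]])
  show ?thesis unfolding bump_def by (rule smooth_mult[OF smooth_const[OF U] smooth_flat_exp[OF 2]])
qed

lemma bump_center: "bump n y e y = 1"
  by (simp add: bump_def flat_exp_def exp_minus)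

lemma bump_bounds: "0 \<le> bump n y e z" "bump n y e z \<le> 1"
proof -
  show "0 \<le> bump n y e z" by (simp add: bump_def flat_exp_nonneg)
  let ?s = "\<Sum>i<n. ((z i - y i) / e)\<^sup>2"
  have s: "?s \<ge> 0" by (intro sum_nonneg) auto
  show "bump n y e z \<le> 1"
  proof (cases "1 - ?s > 0")
    case True
    then have 1: "1 \<le> 1 / (1 - ?s)" using s by simp
    have "exp 1 * exp (- (1 / (1 - ?s))) = exp (1 + - (1 / (1 - ?s)))" by (rule exp_add[symmetric])
    also have "\<dots> \<le> 1" using 1 by simp
    finally have "exp 1 * exp (- (1 / (1 - ?s))) \<le> 1" .
    then show ?thesis using True by (simp add: bump_def flat_exp_def)
  qed (simp add: bump_def flat_exp_def)
qed

lemma bump_zero: assumes "i < n" "\<bar>z i - y i\<bar> \<ge> e" "e > 0" shows "bump n y e z = 0"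
proof -
  have "1 \<le> \<bar>(z i - y i) / e\<bar>" using assms by (simp add: abs_divide)
  then have "1 \<le> ((z i - y i) / e)\<^sup>2" using abs_le_square_iff[of 1 "(z i - y i) / e"] by simp
  also have "\<dots> \<le> (\<Sum>i<n. ((z i - y i) / e)\<^sup>2)"
    using assms(1) by (intro member_le_sum[of i]) auto
  finally show ?thesis by (simp add: bump_def flat_exp_def)
qed

section \<open>Adding one parameter to a domain\<close>

text \<open>
  This is \<open>U \<times> \<real>\<close>, with the new coordinate in position \<open>n\<close>.  It is the domain of families \<open>r p(u)\<close> in
  which a plot \<open>p\<close> is multiplied by a parameter \<open>r\<close>; the slice \<open>r = 0\<close> is \<open>U\<close> itself.
\<close>

definition cylinder :: "nat \<Rightarrow> rvec set \<Rightarrow> rvec set" where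
  "cylinder n U = {w. (\<forall>i\<ge>Suc n. w i = 0) \<and> w(n := 0) \<in> U}"

lemma cylinder_open: assumes U: "eopen n U" shows "eopen (Suc n) (cylinder n U)"
  unfolding eopen_iff
proof (intro conjI ballI)
  show "cylinder n U \<subseteq> {x. \<forall>i\<ge>Suc n. x i = 0}" by (auto simp: cylinder_def)
  fix w assume w: "w \<in> cylinder n U"
  then have "w(n := 0) \<in> U" by (simp add: cylinder_def)
  then obtain e where e: "e > 0" "ebox n (w(n := 0)) e \<subseteq> U" using eopen_ebox[OF U] by blast
  have "ebox (Suc n) w e \<subseteq> cylinder n U"
  proof
    fix y assume y: "y \<in> ebox (Suc n) w e"
    then have "y(n := 0) \<in> ebox n (w(n := 0)) e" by (auto simp: ebox_def)
    then show "y \<in> cylinder n U" using e y by (auto simp: cylinder_def ebox_def)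
  qed
  then show "\<exists>e>0. ebox (Suc n) w e \<subseteq> cylinder n U" using e by blast
qed

lemma cylinder_subset: assumes U: "eopen n U" shows "U \<subseteq> cylinder n U"
proof
  fix u assume u: "u \<in> U"
  then have "u(n := 0) = u" using eopen_zero[OF U u] by (auto simp: fun_eq_iff)
  then show "u \<in> cylinder n U" using u eopen_zero[OF U u] by (simp add: cylinder_def)
qed

lemma cylinder_update: assumes U: "eopen n U" and u: "u \<in> U" shows "u(n := r) \<in> cylinder n U" "(u(n := r))(n := 0) = u"
proof -
  show *: "(u(n := r))(n := 0) = u" using eopen_zero[OF U u] by (auto simp: fun_eq_iff)
  then show "u(n := r) \<in> cylinder n U" using u eopen_zero[OF U u] by (simp add: cylinder_def)
qed

lemma cylinder_proj_smooth: assumes U: "eopen n U"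
  shows "smooth_euclidean (Suc n) (cylinder n U) n U (\<lambda>w. w(n := 0))"
  unfolding smooth_euclidean_def
proof (intro conjI allI impI)
  show "eopen (Suc n) (cylinder n U)" by (rule cylinder_open[OF U])
  show "(\<lambda>w. w(n := 0)) ` cylinder n U \<subseteq> U" by (auto simp: cylinder_def)
  fix i assume "i < n"
  then show "smooth_fun_on (Suc n) (cylinder n U) (\<lambda>v. (v(n := 0)) i)"
    using smooth_coordinate[OF cylinder_open[OF U], of i] by simp
qed (rule U)

lemma slice_open: assumes "eopen (Suc n) N" shows "eopen n {u\<in>N. u n = 0}"
  unfolding eopen_iff
proof (intro conjI ballI)
  show "{u\<in>N. u n = 0} \<subseteq> {x. \<forall>i\<ge>n. x i = 0}"
  proof (intro subsetI CollectI allI impI)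
    fix x i assume x: "x \<in> {u\<in>N. u n = 0}" and i: "n \<le> i"
    show "x i = 0" using eopen_zero[OF assms, of x i] x i by (cases "i = n") auto
  qed
  fix u assume u: "u \<in> {u\<in>N. u n = 0}"
  then obtain e where e: "e > 0" "ebox (Suc n) u e \<subseteq> N" using eopen_ebox[OF assms] by blast
  have "ebox n u e \<subseteq> {u\<in>N. u n = 0}"
  proof
    fix y assume y: "y \<in> ebox n u e"
    then have "y \<in> ebox (Suc n) u e" using u e by (auto simp: ebox_def less_Suc_eq)
    then show "y \<in> {u\<in>N. u n = 0}" using e y by (auto simp: ebox_def)
  qed
  then show "\<exists>e>0. ebox n u e \<subseteq> {u\<in>N. u n = 0}" using e by blast
qed

lemma Ck_on_fewer: "Ck_on k m U f \<Longrightarrow> n \<le> m \<Longrightarrow> Ck_on k n U f"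
proof (induction k arbitrary: f)
  case (Suc k)
  have "\<exists>g. (\<forall>x\<in>U. ((\<lambda>t. f (x(i := t))) has_real_derivative g x) (at (x i))) \<and> Ck_on k n U g" if i: "i < n" for i
  proof -
    have "i < m" using i Suc.prems(2) by simp
    then obtain g where "\<forall>x\<in>U. ((\<lambda>t. f (x(i := t))) has_real_derivative g x) (at (x i))" "Ck_on k m U g"
      using Suc.prems(1) by auto
    then show ?thesis using Suc.IH[of g] Suc.prems(2) by blast
  qed
  then show ?case using Suc.prems(1) by simp
qed simp

lemma smooth_slice: "smooth_fun_on (Suc n) N f \<Longrightarrow> smooth_fun_on n {u\<in>N. u n = 0} f"
  unfolding smooth_fun_on_def
  using slice_open Ck_on_subset[of _ _ N f "{u\<in>N. u n = 0}"] Ck_on_fewer[of _ "Suc n"] by auto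

lemma smooth_euclidean_slice:
  "smooth_euclidean (Suc n) N m U h \<Longrightarrow> smooth_euclidean n {u\<in>N. u n = 0} m U h"
  unfolding smooth_euclidean_def using slice_open smooth_slice by blast

section \<open>Diffeological spaces\<close>

lemma smooth_euclidean_comp:
  assumes h: "smooth_euclidean m V n U h" and p: "smooth_euclidean n U k W p"
  shows "smooth_euclidean m V k W (p \<circ> h)"
  unfolding smooth_euclidean_def
proof (intro conjI allI impI)
  show "eopen m V" "eopen k W" using h p by (auto simp: smooth_euclidean_def)
  have "h ` V \<subseteq> U" "p ` U \<subseteq> W" using h p by (auto simp: smooth_euclidean_def)
  then show "(p \<circ> h) ` V \<subseteq> W" unfolding image_comp[symmetric] by (meson image_mono order_trans)
  fix i assume "i < k"
  then have "smooth_fun_on n U (\<lambda>v. p v i)" using p by (simp add: smooth_euclidean_def)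
  from smooth_euclidean_compose_fun[OF h this] show "smooth_fun_on m V (\<lambda>v. (p \<circ> h) v i)" by simp
qed

lemma smooth_euclidean_restrict:
  "smooth_euclidean m V n U h \<Longrightarrow> eopen m V' \<Longrightarrow> V' \<subseteq> V \<Longrightarrow> smooth_euclidean m V' n U h"
  unfolding smooth_euclidean_def using smooth_subset by blast

lemma smooth_euclidean_id: "eopen n V \<Longrightarrow> eopen n U \<Longrightarrow> V \<subseteq> U \<Longrightarrow> smooth_euclidean n V n U (\<lambda>v. v)"
  unfolding smooth_euclidean_def using smooth_coordinate by auto

lemma open_dspace_diffeological: assumes U: "eopen n U" shows "diffeological_space (open_dspace n U)"
proof
  show "plot (open_dspace n U) m V p \<Longrightarrow> eopen m V" for m V p
    by (simp add: open_dspace_def smooth_euclidean_def)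
  show "plot (open_dspace n U) m V p \<Longrightarrow> p ` V \<subseteq> points (open_dspace n U)" for m V p
    by (simp add: open_dspace_def smooth_euclidean_def)
  show "plot (open_dspace n U) m V q" if p: "plot (open_dspace n U) m V p" and q: "\<And>u. u \<in> V \<Longrightarrow> q u = p u" for m V p q
  proof -
    have "smooth_fun_on m V (\<lambda>v. q v i)" if "i < n" for i
      by (rule smooth_cong[of m V "\<lambda>v. p v i"]) (use p that q in \<open>simp_all add: open_dspace_def smooth_euclidean_def\<close>)
    then show ?thesis using p q by (auto simp: open_dspace_def smooth_euclidean_def)
  qed
  show "plot (open_dspace n U) m V (\<lambda>_. x)" if "eopen m V" "x \<in> points (open_dspace n U)" for m V x
    using that U by (auto simp: open_dspace_def smooth_euclidean_def smooth_const)
  show "plot (open_dspace n U) k W (p \<circ> h)" if "plot (open_dspace n U) m V p" "smooth_euclidean k W m V h" for m V p k W h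
    using that smooth_euclidean_comp by (auto simp: open_dspace_def)
  show "plot (open_dspace n U) m V p" if V: "eopen m V"
    and l: "\<And>u. u \<in> V \<Longrightarrow> \<exists>W. eopen m W \<and> u \<in> W \<and> W \<subseteq> V \<and> plot (open_dspace n U) m W p" for m V p
  proof -
    have l': "\<exists>W. eopen m W \<and> u \<in> W \<and> W \<subseteq> V \<and> p ` W \<subseteq> U \<and> (\<forall>i<n. smooth_fun_on m W (\<lambda>v. p v i))" if "u \<in> V" for u
      using l[OF that] by (auto simp: open_dspace_def smooth_euclidean_def)
    have "smooth_fun_on m V (\<lambda>v. p v i)" if i: "i < n" for i
    proof (rule smooth_local[OF V])
      fix u assume "u \<in> V" from l'[OF this] i
      show "\<exists>N. eopen m N \<and> u \<in> N \<and> N \<subseteq> V \<and> smooth_fun_on m N (\<lambda>v. p v i)" by blast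
    qed
    moreover have "p ` V \<subseteq> U" using l' by blast
    ultimately show ?thesis using V U by (simp add: open_dspace_def smooth_euclidean_def)
  qed
qed

lemma prod_dspace_diffeological:
  assumes "diffeological_space X" "diffeological_space Y"
  shows "diffeological_space (prod_dspace X Y)"
proof -
  interpret X: diffeological_space X by fact
  interpret Y: diffeological_space Y by fact
  show ?thesis
  proof
    show "plot (prod_dspace X Y) n U p \<Longrightarrow> eopen n U" for n U p
      using X.plot_domain by (auto simp: prod_dspace_def)
    show "plot (prod_dspace X Y) n U p \<Longrightarrow> p ` U \<subseteq> points (prod_dspace X Y)" for n U p
      using X.plot_range[of n U "fst \<circ> p"] Y.plot_range[of n U "snd \<circ> p"]
      by (auto simp: prod_dspace_def image_subset_iff mem_Times_iff)
    show "plot (prod_dspace X Y) n U q" if "plot (prod_dspace X Y) n U p" "\<And>u. u \<in> U \<Longrightarrow> q u = p u" for n U p q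
      using that X.plot_cong[of n U "fst \<circ> p" "fst \<circ> q"] Y.plot_cong[of n U "snd \<circ> p" "snd \<circ> q"]
      by (simp add: prod_dspace_def)
    show "plot (prod_dspace X Y) n U (\<lambda>_. x)" if "eopen n U" "x \<in> points (prod_dspace X Y)" for n U x
      using that X.plot_const[of n U "fst x"] Y.plot_const[of n U "snd x"]
      by (auto simp: prod_dspace_def o_def)
    show "plot (prod_dspace X Y) m V (p \<circ> h)" if "plot (prod_dspace X Y) n U p" "smooth_euclidean m V n U h" for n U p m V h
      using that X.plot_compose[of n U "fst \<circ> p" m V h] Y.plot_compose[of n U "snd \<circ> p" m V h]
      by (simp add: prod_dspace_def o_assoc)
    show "plot (prod_dspace X Y) n U p" if U: "eopen n U" and
      l: "\<And>u. u \<in> U \<Longrightarrow> \<exists>V. eopen n V \<and> u \<in> V \<and> V \<subseteq> U \<and> plot (prod_dspace X Y) n V p" for n U p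
    proof -
      have "plot X n U (fst \<circ> p)" by (rule X.plot_local[OF U]) (use l in \<open>force simp: prod_dspace_def\<close>)
      moreover have "plot Y n U (snd \<circ> p)" by (rule Y.plot_local[OF U]) (use l in \<open>force simp: prod_dspace_def\<close>)
      ultimately show ?thesis by (simp add: prod_dspace_def)
    qed
  qed
qed

lemma sub_dspace_diffeological:
  assumes "diffeological_space X"
  shows "diffeological_space (sub_dspace X A)"
proof -
  interpret X: diffeological_space X by fact
  show ?thesis
  proof
    show "plot (sub_dspace X A) n U p \<Longrightarrow> eopen n U" for n U p
      using X.plot_domain by (auto simp: sub_dspace_def)
    show "plot (sub_dspace X A) n U p \<Longrightarrow> p ` U \<subseteq> points (sub_dspace X A)" for n U p
      using X.plot_range[of n U p] by (auto simp: sub_dspace_def)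
    show "plot (sub_dspace X A) n U q" if "plot (sub_dspace X A) n U p" "\<And>u. u \<in> U \<Longrightarrow> q u = p u" for n U p q
      using that X.plot_cong[of n U p q] by (auto simp: sub_dspace_def)
    show "plot (sub_dspace X A) n U (\<lambda>_. x)" if "eopen n U" "x \<in> points (sub_dspace X A)" for n U x
      using that X.plot_const[of n U x] by (auto simp: sub_dspace_def)
    show "plot (sub_dspace X A) m V (p \<circ> h)" if "plot (sub_dspace X A) n U p" "smooth_euclidean m V n U h" for n U p m V h
      using that X.plot_compose[of n U p m V h] by (auto simp: sub_dspace_def smooth_euclidean_def)
    show "plot (sub_dspace X A) n U p" if U: "eopen n U" and
      l: "\<And>u. u \<in> U \<Longrightarrow> \<exists>V. eopen n V \<and> u \<in> V \<and> V \<subseteq> U \<and> plot (sub_dspace X A) n V p" for n U p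
    proof -
      have "plot X n U p" by (rule X.plot_local[OF U]) (use l in \<open>force simp: sub_dspace_def\<close>)
      moreover have "p ` U \<subseteq> A" using l by (fastforce simp: sub_dspace_def)
      ultimately show ?thesis by (simp add: sub_dspace_def)
    qed
  qed
qed

lemma (in diffeological_space) plot_restrict:
  assumes "plot X n U p" "eopen n V" "V \<subseteq> U" shows "plot X n V p"
  using plot_compose[OF assms(1) smooth_euclidean_id[OF assms(2) plot_domain[OF assms(1)] assms(3)]]
  by (simp add: o_def)

lemma (in diffeological_space) plot_in: "plot X n U p \<Longrightarrow> u \<in> U \<Longrightarrow> p u \<in> points X"
  using plot_range by blast

lemma smooth_map_plot: "smooth_map X Y f \<Longrightarrow> plot X n U p \<Longrightarrow> plot Y n U (\<lambda>u. f (p u))"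
  by (simp add: smooth_map_def o_def)

lemma smooth_map_point: "smooth_map X Y f \<Longrightarrow> x \<in> points X \<Longrightarrow> f x \<in> points Y"
  by (auto simp: smooth_map_def)

lemma smooth_map_compose: "smooth_map X Y f \<Longrightarrow> smooth_map Y Z g \<Longrightarrow> smooth_map X Z (\<lambda>x. g (f x))"
  unfolding smooth_map_def o_def by (simp add: image_subset_iff)

section \<open>Diffeological vector spaces\<close>

locale dvs = diffeological_space V for V :: "'v::real_vector dspace" +
  assumes dvs: "diffeological_vector_space V"

lemma dvs_intro: "diffeological_vector_space V \<Longrightarrow> dvs V"
  by (simp add: dvs_def dvs_axioms_def diffeological_vector_space_def)

context dvs
begin

lemma points_subspace: "subspace (points V)"
  using dvs by (simp add: diffeological_vector_space_def)

lemma plot_add: "plot V n U p \<Longrightarrow> plot V n U q \<Longrightarrow> plot V n U (\<lambda>u. p u + q u)"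
  using dvs smooth_map_plot[of "prod_dspace V V" V "\<lambda>(x, y). x + y" n U "\<lambda>u. (p u, q u)"]
  by (simp add: diffeological_vector_space_def prod_dspace_def o_def)

lemma plot_scale: "smooth_fun_on n U a \<Longrightarrow> plot V n U q \<Longrightarrow> plot V n U (\<lambda>u. a u *\<^sub>R q u)"
  using dvs smooth_map_plot[of "prod_dspace real_dspace V" V "\<lambda>(r, x). r *\<^sub>R x" n U "\<lambda>u. (a u, q u)"]
  by (simp add: diffeological_vector_space_def prod_dspace_def real_dspace_def o_def)

lemma plot_diff: assumes p: "plot V n U p" and q: "plot V n U q" shows "plot V n U (\<lambda>u. p u - q u)"
  using plot_add[OF p plot_scale[OF smooth_const[OF plot_domain[OF q], of "-1"] q]] by simp

lemma plot_sum: "eopen n U \<Longrightarrow> (\<And>i. i < (k::nat) \<Longrightarrow> plot V n U (p i)) \<Longrightarrow> plot V n U (\<lambda>u. \<Sum>i<k. p i u)"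
proof (induction k)
  case 0 then show ?case using plot_const[of n U 0] subspace_0[OF points_subspace] by simp
next
  case (Suc k) then show ?case using plot_add[of n U "\<lambda>u. \<Sum>i<k. p i u" "p k"] by simp
qed

end

lemma diffeological_vector_spaceI:
  assumes "diffeological_space V" "subspace (points V)"
    and add: "\<And>n U p q. plot V n U p \<Longrightarrow> plot V n U q \<Longrightarrow> plot V n U (\<lambda>u. p u + q u)"
    and scale: "\<And>n U a q. smooth_fun_on n U a \<Longrightarrow> plot V n U q \<Longrightarrow> plot V n U (\<lambda>u. a u *\<^sub>R q u)"
  shows "diffeological_vector_space V"
  unfolding diffeological_vector_space_def smooth_map_def
proof (intro conjI allI impI)
  show "(\<lambda>(x, y). x + y) ` points (prod_dspace V V) \<subseteq> points V"
    using subspace_add[OF assms(2)] by (auto simp: prod_dspace_def)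
  show "(\<lambda>(r, x). r *\<^sub>R x) ` points (prod_dspace real_dspace V) \<subseteq> points V"
    using subspace_scale[OF assms(2)] by (auto simp: prod_dspace_def)
  show "plot V n U ((\<lambda>(x, y). x + y) \<circ> p)" if "plot (prod_dspace V V) n U p" for n U p
    using that add[of n U "fst \<circ> p" "snd \<circ> p"] by (simp add: prod_dspace_def o_def case_prod_beta)
  show "plot V n U ((\<lambda>(r, x). r *\<^sub>R x) \<circ> p)" if "plot (prod_dspace real_dspace V) n U p" for n U p
    using that scale[of n U "fst \<circ> p" "snd \<circ> p"] by (simp add: prod_dspace_def real_dspace_def o_def case_prod_beta)
qed (use assms in auto)

lemma dvs_group: assumes "diffeological_vector_space V" shows "diffeological_group V"
proof -
  interpret dvs V by (rule dvs_intro[OF assms])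
  have "smooth_map V V uminus"
    unfolding smooth_map_def
  proof (intro conjI allI impI)
    show "uminus ` points V \<subseteq> points V" using subspace_neg[OF points_subspace] by auto
    fix n U p assume p: "plot V n U p"
    show "plot V n U (uminus \<circ> p)"
      using plot_scale[OF smooth_const[OF plot_domain[OF p], of "-1"] p] by (simp add: o_def)
  qed
  then show ?thesis using assms subspace_0[OF points_subspace]
    by (simp add: diffeological_group_def diffeological_vector_space_def)
qed

section \<open>Finite formal sums\<close>

lemma lookup_scaleR: "Poly_Mapping.lookup (r *\<^sub>R w) k = r * Poly_Mapping.lookup w k"
  for w :: "('k, real) poly_mapping"
proof -
  have "finite {i. r *\<^sub>R Poly_Mapping.lookup w i \<noteq> 0}"
    by (rule finite_subset[OF _ finite_lookup[of w]]) auto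
  then show ?thesis by (simp add: scaleR_poly_mapping_def)
qed

abbreviation sgl :: "'k \<Rightarrow> ('k, real) poly_mapping" where "sgl k \<equiv> Poly_Mapping.single k 1"

text \<open>
  The pairing of functions with formal sums, linear in both arguments.
\<close>

definition ev :: "('k \<Rightarrow> real) \<Rightarrow> ('k, real) poly_mapping \<Rightarrow> real" where
  "ev f w = (\<Sum>k\<in>Poly_Mapping.keys w. Poly_Mapping.lookup w k * f k)"

lemma ev_superset:
  assumes "finite A" "Poly_Mapping.keys w \<subseteq> A"
  shows "ev f w = (\<Sum>k\<in>A. Poly_Mapping.lookup w k * f k)"
  unfolding ev_def by (rule sum.mono_neutral_left) (use assms in \<open>auto simp: in_keys_iff\<close>)

lemma ev_add: "ev f (v + w) = ev f v + ev f w"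
proof -
  let ?A = "Poly_Mapping.keys v \<union> Poly_Mapping.keys w"
  have "ev f (v + w) = (\<Sum>k\<in>?A. Poly_Mapping.lookup (v + w) k * f k)"
    using keys_add[of v w] by (intro ev_superset) auto
  also have "\<dots> = ev f v + ev f w"
    using ev_superset[of ?A v f] ev_superset[of ?A w f] by (simp add: lookup_add distrib_right sum.distrib)
  finally show ?thesis .
qed

lemma ev_scale: "ev f (r *\<^sub>R w) = r * ev f w"
proof -
  have "ev f (r *\<^sub>R w) = (\<Sum>k\<in>Poly_Mapping.keys w. Poly_Mapping.lookup (r *\<^sub>R w) k * f k)"
    by (rule ev_superset) (auto simp: in_keys_iff lookup_scaleR)
  then show ?thesis by (simp add: ev_def lookup_scaleR sum_distrib_left mult.assoc)
qed

lemma ev_zero: "ev f 0 = 0"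
  by (simp add: ev_def)

lemma ev_minus: "ev f (- w) = - ev f w"
  using ev_scale[of f "-1" w] by simp

lemma ev_diff: "ev f (v - w) = ev f v - ev f w"
  using ev_add[of f v "- w"] by (simp add: ev_minus)

lemma ev_sgl: "ev f (sgl k) = f k"
  by (simp add: ev_def)

lemma ev_sum: "ev f (\<Sum>i\<in>A. w i) = (\<Sum>i\<in>A. ev f (w i))"
  by (induction A rule: infinite_finite_induct) (simp_all add: ev_zero ev_add)

lemma formal_sum_expand:
  fixes w :: "('k, real) poly_mapping"
  shows "w = (\<Sum>k\<in>Poly_Mapping.keys w. Poly_Mapping.lookup w k *\<^sub>R sgl k)"
proof (rule poly_mapping_eqI)
  fix k
  have "(\<Sum>i\<in>Poly_Mapping.keys w. Poly_Mapping.lookup (Poly_Mapping.lookup w i *\<^sub>R sgl i) k)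
     = (\<Sum>i\<in>Poly_Mapping.keys w. if k = i then Poly_Mapping.lookup w i else 0)"
    by (rule sum.cong) (auto simp: lookup_scaleR lookup_single when_def)
  then show "Poly_Mapping.lookup w k = Poly_Mapping.lookup (\<Sum>k\<in>Poly_Mapping.keys w. Poly_Mapping.lookup w k *\<^sub>R sgl k) k"
    by (simp add: lookup_sum in_keys_iff)
qed

lemma sum_lessThan_split:
  "(\<Sum>i<k + l. g i) = (\<Sum>i<k. g i) + (\<Sum>i<l. g (k + i :: nat))" for g :: "nat \<Rightarrow> 'a::comm_monoid_add"
  by (induction l) (simp_all add: add.assoc)

section \<open>The free vector space on the plots\<close>

text \<open>
  An index \<open>j\<close> lists dimension, domain and map of a plot.  The pairs \<open>(j, x)\<close> with \<open>x \<in> idom j\<close> are the points of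
  the disjoint union of the domains of all plots.
\<close>

type_synonym 'v idx = "nat \<times> rvec set \<times> (rvec \<Rightarrow> 'v)"

abbreviation idim :: "'v idx \<Rightarrow> nat" where "idim j \<equiv> fst j"
abbreviation idom :: "'v idx \<Rightarrow> rvec set" where "idom j \<equiv> fst (snd j)"
abbreviation imap :: "'v idx \<Rightarrow> rvec \<Rightarrow> 'v" where "imap j \<equiv> snd (snd j)"

definition plot_value :: "'v idx \<times> rvec \<Rightarrow> 'v" where
  "plot_value k = imap (fst k) (snd k)"

definition valid :: "'v dspace \<Rightarrow> 'v idx \<Rightarrow> bool" where
  "valid V j \<longleftrightarrow> plot V (idim j) (idom j) (imap j)"

text \<open>
  The data of a smooth family of formal sums with \<open>k\<close> terms: each term stays in the domain of one plot.
\<close>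

definition smooth_terms :: "'v dspace \<Rightarrow> nat \<Rightarrow> rvec set \<Rightarrow> nat \<Rightarrow> (nat \<Rightarrow> rvec \<Rightarrow> real) \<Rightarrow> (nat \<Rightarrow> 'v idx) \<Rightarrow>
    (nat \<Rightarrow> rvec \<Rightarrow> rvec) \<Rightarrow> bool" where
  "smooth_terms V n N k a j x \<longleftrightarrow> eopen n N \<and> (\<forall>i<k. valid V (j i) \<and> smooth_fun_on n N (a i) \<and>
     smooth_euclidean n N (idim (j i)) (idom (j i)) (x i))"

definition formal_sum :: "nat \<Rightarrow> (nat \<Rightarrow> rvec \<Rightarrow> real) \<Rightarrow> (nat \<Rightarrow> 'v idx) \<Rightarrow> (nat \<Rightarrow> rvec \<Rightarrow> rvec) \<Rightarrow> rvec \<Rightarrow>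
    'v plot_vectors" where
  "formal_sum k a j x u = (\<Sum>i<k. a i u *\<^sub>R sgl (j i, x i u))"

text \<open>
  The free vector space on the disjoint union of the plot domains.  Its diffeology is the one generated, under
  linear combinations with smooth coefficients, by the maps \<open>x \<mapsto> [j, x]\<close>.
\<close>

definition free_space :: "'v dspace \<Rightarrow> 'v plot_vectors dspace" where
  "free_space V = \<lparr>points = {w. \<forall>k\<in>Poly_Mapping.keys w. valid V (fst k) \<and> snd k \<in> idom (fst k)},
     plot = (\<lambda>n U q. eopen n U \<and> (\<forall>u\<in>U. \<exists>N k a j x. u \<in> N \<and> N \<subseteq> U \<and> smooth_terms V n N k a j x \<and>
        (\<forall>v\<in>N. q v = formal_sum k a j x v)))\<rparr>"

lemma free_space_plotD:
  assumes "plot (free_space V) n U q" "u \<in> U"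
  obtains N k a j x where "u \<in> N" "N \<subseteq> U" "smooth_terms V n N k a j x" "\<And>v. v \<in> N \<Longrightarrow> q v = formal_sum k a j x v"
  using assms unfolding free_space_def by simp blast

lemma free_space_plotI:
  assumes "eopen n U" "\<And>u. u \<in> U \<Longrightarrow> \<exists>N k a j x. u \<in> N \<and> N \<subseteq> U \<and> smooth_terms V n N k a j x \<and>
        (\<forall>v\<in>N. q v = formal_sum k a j x v)"
  shows "plot (free_space V) n U q"
  using assms unfolding free_space_def by simp

lemma ev_formal_sum: "ev f (formal_sum k a j x u) = (\<Sum>i<k. a i u * f (j i, x i u))"
  by (simp add: formal_sum_def ev_sum ev_scale ev_sgl)

lemma free_space_subspace: "subspace (points (free_space V))"
  unfolding subspace_def
proof (intro conjI ballI allI)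
  show "0 \<in> points (free_space V)" by (simp add: free_space_def)
  fix v w assume "v \<in> points (free_space V)" "w \<in> points (free_space V)"
  then show "v + w \<in> points (free_space V)" using keys_add[of v w] by (fastforce simp: free_space_def)
next
  fix c and w assume w: "w \<in> points (free_space V)"
  have "Poly_Mapping.keys (c *\<^sub>R w) \<subseteq> Poly_Mapping.keys w" by (auto simp: in_keys_iff lookup_scaleR)
  then show "c *\<^sub>R w \<in> points (free_space V)" using w by (auto simp: free_space_def)
qed

lemma sgl_in_free_space: "valid V j \<Longrightarrow> x \<in> idom j \<Longrightarrow> sgl (j, x) \<in> points (free_space V)"
  by (simp add: free_space_def)

lemma formal_sum_in_free_space: assumes l: "smooth_terms V n N k a j x" and u: "u \<in> N" shows "formal_sum k a j x u \<in> points (free_space V)"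
  unfolding formal_sum_def
proof (intro subspace_sum[OF free_space_subspace] subspace_scale[OF free_space_subspace] sgl_in_free_space)
  fix i assume i: "i \<in> {..<k}"
  show "valid V (j i)" using l i by (simp add: smooth_terms_def)
  have "x i ` N \<subseteq> idom (j i)" using l i by (simp add: smooth_terms_def smooth_euclidean_def)
  then show "x i u \<in> idom (j i)" using u by blast
qed

lemma smooth_terms_restrict: "smooth_terms V n N k a j x \<Longrightarrow> eopen n N' \<Longrightarrow> N' \<subseteq> N \<Longrightarrow> smooth_terms V n N' k a j x"
  unfolding smooth_terms_def by (metis smooth_subset smooth_euclidean_restrict)

lemma smooth_terms_append:
  assumes "smooth_terms V n N k a j x" "smooth_terms V n N l b i y"
  shows "smooth_terms V n N (k + l) (\<lambda>t. if t < k then a t else b (t - k)) (\<lambda>t. if t < k then j t else i (t - k))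
     (\<lambda>t. if t < k then x t else y (t - k))"
    and "formal_sum (k + l) (\<lambda>t. if t < k then a t else b (t - k)) (\<lambda>t. if t < k then j t else i (t - k))
     (\<lambda>t. if t < k then x t else y (t - k)) u = formal_sum k a j x u + formal_sum l b i y u"
proof -
  show "smooth_terms V n N (k + l) (\<lambda>t. if t < k then a t else b (t - k)) (\<lambda>t. if t < k then j t else i (t - k))
     (\<lambda>t. if t < k then x t else y (t - k))"
    using assms unfolding smooth_terms_def by auto
qed (simp add: formal_sum_def sum_lessThan_split)

lemma smooth_preimage_open:
  assumes h: "smooth_euclidean m W n U h" and N: "eopen n N"
  shows "eopen m {v\<in>W. h v \<in> N}"
  unfolding eopen_iff
proof (intro conjI ballI)
  have W: "eopen m W" and U: "eopen n U" using h by (simp_all add: smooth_euclidean_def)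
  show "{v\<in>W. h v \<in> N} \<subseteq> {x. \<forall>i\<ge>m. x i = 0}" using W unfolding eopen_iff by blast
  fix v assume v: "v \<in> {v\<in>W. h v \<in> N}"
  then obtain e where e: "e > 0" "ebox n (h v) e \<subseteq> N" using eopen_ebox[OF N] by blast
  have hz: "\<forall>i\<ge>n. h y i = 0" if "y \<in> W" for y
    using eopen_zero[OF U, of "h y"] h that unfolding smooth_euclidean_def by (simp add: image_subset_iff)
  have "\<exists>d>0. ebox m v d \<subseteq> W \<and> (\<forall>y\<in>ebox m v d. \<bar>h y i - h v i\<bar> < e)" if i: "i < n" for i
  proof (rule continuous_ebox[OF W _ _ e(1)])
    show "continuous_on W (\<lambda>v. h v i)" using h i by (auto simp: smooth_euclidean_def intro: smooth_continuous)
    show "v \<in> W" using v by simp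
  qed
  then obtain d0 where d0: "\<And>i. i < n \<Longrightarrow> d0 i > 0 \<and> (\<forall>y\<in>ebox m v (d0 i). \<bar>h y i - h v i\<bar> < e)" by metis
  obtain d1 where d1: "d1 > 0" "ebox m v d1 \<subseteq> W" using eopen_ebox[OF W] v by blast
  define d where "d = Min (insert d1 (d0 ` {..<n}))"
  have d: "d > 0" "d \<le> d1" "\<And>i. i < n \<Longrightarrow> d \<le> d0 i" unfolding d_def using d0 d1 by auto
  have "ebox m v d \<subseteq> {v\<in>W. h v \<in> N}"
  proof
    fix y assume y: "y \<in> ebox m v d"
    then have yW: "y \<in> W" using ebox_mono[OF d(2)] d1 by blast
    have "\<bar>h y i - h v i\<bar> < e" if "i < n" for i using d0[OF that] ebox_mono[OF d(3)[OF that], of m v] y by blast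
    then have "h y \<in> ebox n (h v) e" using hz[OF yW] by (simp add: ebox_def)
    then show "y \<in> {v\<in>W. h v \<in> N}" using yW e by blast
  qed
  then show "\<exists>d>0. ebox m v d \<subseteq> {v\<in>W. h v \<in> N}" using d(1) by blast
qed

lemma smooth_euclidean_narrow:
  assumes h: "smooth_euclidean m W n U h" and N: "eopen n N"
  shows "smooth_euclidean m {v\<in>W. h v \<in> N} n N h"
proof -
  have o: "eopen m {v\<in>W. h v \<in> N}" by (rule smooth_preimage_open[OF assms])
  have "smooth_fun_on m {v\<in>W. h v \<in> N} (\<lambda>v. h v i)" if "i < n" for i
    by (rule smooth_subset[OF _ o]) (use h that in \<open>auto simp: smooth_euclidean_def\<close>)
  then show ?thesis using o N by (auto simp: smooth_euclidean_def)
qed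

lemma smooth_terms_compose:
  assumes l: "smooth_terms V n N k a j x" and h: "smooth_euclidean m W n N h"
  shows "smooth_terms V m W k (\<lambda>i v. a i (h v)) j (\<lambda>i v. x i (h v))"
  unfolding smooth_terms_def
proof (intro conjI allI impI)
  show "eopen m W" using h by (simp add: smooth_euclidean_def)
  fix i assume i: "i < k"
  show "valid V (j i)" using l i by (simp add: smooth_terms_def)
  have "smooth_fun_on n N (a i)" using l i by (simp add: smooth_terms_def)
  from smooth_euclidean_compose_fun[OF h this] show "smooth_fun_on m W (\<lambda>v. a i (h v))" .
  have "smooth_euclidean n N (idim (j i)) (idom (j i)) (x i)" using l i by (simp add: smooth_terms_def)
  from smooth_euclidean_comp[OF h this]
  show "smooth_euclidean m W (idim (j i)) (idom (j i)) (\<lambda>v. x i (h v))" by (simp add: o_def)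
qed

lemma free_space_diffeological: assumes V: "diffeological_space V" shows "diffeological_space (free_space V)"
proof
  show "eopen n U" if "plot (free_space V) n U p" for n U p
    using that by (simp add: free_space_def)
  show "p ` U \<subseteq> points (free_space V)" if p: "plot (free_space V) n U p" for n U p
  proof
    fix w assume "w \<in> p ` U"
    then obtain u where u: "u \<in> U" "w = p u" by blast
    obtain N k a j x where N: "u \<in> N" "smooth_terms V n N k a j x" "\<And>v. v \<in> N \<Longrightarrow> p v = formal_sum k a j x v"
      using free_space_plotD[OF p u(1)] by metis
    show "w \<in> points (free_space V)" using formal_sum_in_free_space[OF N(2,1)] N(3)[OF N(1)] u by simp
  qed
  show "plot (free_space V) n U q" if p: "plot (free_space V) n U p" and q: "\<And>u. u \<in> U \<Longrightarrow> q u = p u" for n U p q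
  proof (rule free_space_plotI)
    show "eopen n U" using p by (simp add: free_space_def)
    fix u assume "u \<in> U"
    then obtain N k a j x where "u \<in> N" "N \<subseteq> U" "smooth_terms V n N k a j x" "\<And>v. v \<in> N \<Longrightarrow> p v = formal_sum k a j x v"
      using free_space_plotD[OF p] by metis
    then show "\<exists>N k a j x. u \<in> N \<and> N \<subseteq> U \<and> smooth_terms V n N k a j x \<and> (\<forall>v\<in>N. q v = formal_sum k a j x v)"
      using q by (metis subsetD)
  qed
  show "plot (free_space V) n U (\<lambda>_. w)" if U: "eopen n U" and w: "w \<in> points (free_space V)" for n U w
  proof (rule free_space_plotI[OF U])
    fix u assume u: "u \<in> U"
    obtain h where h: "bij_betw h {0..<card (Poly_Mapping.keys w)} (Poly_Mapping.keys w)"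
      using ex_bij_betw_nat_finite[of "Poly_Mapping.keys w"] by auto
    define k where "k = card (Poly_Mapping.keys w)"
    have hk: "h i \<in> Poly_Mapping.keys w" if "i < k" for i using h that by (auto simp: bij_betw_def k_def)
    have "w = (\<Sum>k\<in>Poly_Mapping.keys w. Poly_Mapping.lookup w k *\<^sub>R sgl k)" by (rule formal_sum_expand)
    also have "\<dots> = (\<Sum>i\<in>{0..<card (Poly_Mapping.keys w)}. Poly_Mapping.lookup w (h i) *\<^sub>R sgl (h i))"
      by (rule sum.reindex_bij_betw[OF h, symmetric])
    finally have ws: "w = formal_sum k (\<lambda>i _. Poly_Mapping.lookup w (h i)) (\<lambda>i. fst (h i)) (\<lambda>i _. snd (h i)) v" for v
      by (simp add: formal_sum_def k_def atLeast0LessThan)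
    have "smooth_terms V n U k (\<lambda>i _. Poly_Mapping.lookup w (h i)) (\<lambda>i. fst (h i)) (\<lambda>i _. snd (h i))"
      unfolding smooth_terms_def
    proof (intro conjI allI impI U)
      fix i assume "i < k"
      then have v: "valid V (fst (h i))" "snd (h i) \<in> idom (fst (h i))" using w hk[of i] by (auto simp: free_space_def)
      show "valid V (fst (h i))" by (rule v)
      show "smooth_fun_on n U (\<lambda>_. Poly_Mapping.lookup w (h i))" by (rule smooth_const[OF U])
      show "smooth_euclidean n U (idim (fst (h i))) (idom (fst (h i))) (\<lambda>_. snd (h i))"
        using v U smooth_const[OF U] diffeological_space.plot_domain[OF V] unfolding smooth_euclidean_def valid_def
        by (auto simp: smooth_const)
    qed
    then show "\<exists>N k a j x. u \<in> N \<and> N \<subseteq> U \<and> smooth_terms V n N k a j x \<and> (\<forall>v\<in>N. w = formal_sum k a j x v)"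
      using u ws by blast
  qed
  show "plot (free_space V) m W (p \<circ> h)" if p: "plot (free_space V) n U p" and h: "smooth_euclidean m W n U h" for n U p m W h
  proof (rule free_space_plotI)
    show W: "eopen m W" using h by (simp add: smooth_euclidean_def)
    fix u assume u: "u \<in> W"
    then have "h u \<in> U" using h by (auto simp: smooth_euclidean_def)
    then obtain N k a j x where N: "h u \<in> N" "N \<subseteq> U" "smooth_terms V n N k a j x" "\<And>v. v \<in> N \<Longrightarrow> p v = formal_sum k a j x v"
      using free_space_plotD[OF p] by metis
    show "\<exists>N k a j x. u \<in> N \<and> N \<subseteq> W \<and> smooth_terms V m N k a j x \<and> (\<forall>v\<in>N. (p \<circ> h) v = formal_sum k a j x v)"
    proof (intro exI conjI)
      have N': "eopen n N" using N(3) by (simp add: smooth_terms_def)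
      show "u \<in> {v\<in>W. h v \<in> N}" using u N by simp
      show "{v\<in>W. h v \<in> N} \<subseteq> W" by blast
      show "smooth_terms V m {v\<in>W. h v \<in> N} k (\<lambda>i v. a i (h v)) j (\<lambda>i v. x i (h v))"
        by (rule smooth_terms_compose[OF N(3) smooth_euclidean_narrow[OF h N']])
      show "\<forall>v\<in>{v\<in>W. h v \<in> N}. (p \<circ> h) v = formal_sum k (\<lambda>i v. a i (h v)) j (\<lambda>i v. x i (h v)) v"
        using N(4) by (simp add: formal_sum_def)
    qed
  qed
  show "plot (free_space V) n U p" if U: "eopen n U" and
    l: "\<And>u. u \<in> U \<Longrightarrow> \<exists>W. eopen n W \<and> u \<in> W \<and> W \<subseteq> U \<and> plot (free_space V) n W p" for n U p
  proof (rule free_space_plotI[OF U])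
    fix u assume "u \<in> U"
    then obtain W where W: "u \<in> W" "W \<subseteq> U" "plot (free_space V) n W p" using l by metis
    then obtain N k a j x where "u \<in> N" "N \<subseteq> W" "smooth_terms V n N k a j x" "\<And>v. v \<in> N \<Longrightarrow> p v = formal_sum k a j x v"
      using free_space_plotD[OF W(3,1)] by metis
    then show "\<exists>N k a j x. u \<in> N \<and> N \<subseteq> U \<and> smooth_terms V n N k a j x \<and> (\<forall>v\<in>N. p v = formal_sum k a j x v)"
      using W(2) by (metis subset_trans)
  qed
qed

lemma free_space_dvs: assumes V: "diffeological_space V" shows "diffeological_vector_space (free_space V)"
proof (rule diffeological_vector_spaceI[OF free_space_diffeological[OF V] free_space_subspace])
  fix n U p q assume p: "plot (free_space V) n U p" and q: "plot (free_space V) n U q"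
  have U: "eopen n U" using p by (simp add: free_space_def)
  show "plot (free_space V) n U (\<lambda>u. p u + q u)"
  proof (rule free_space_plotI[OF U])
    fix u assume u: "u \<in> U"
    obtain N k a j x where N: "u \<in> N" "N \<subseteq> U" "smooth_terms V n N k a j x" "\<And>v. v \<in> N \<Longrightarrow> p v = formal_sum k a j x v"
      using free_space_plotD[OF p u] by metis
    obtain M l b i y where M: "u \<in> M" "M \<subseteq> U" "smooth_terms V n M l b i y" "\<And>v. v \<in> M \<Longrightarrow> q v = formal_sum l b i y v"
      using free_space_plotD[OF q u] by metis
    have o: "eopen n (N \<inter> M)" using N(3) M(3) by (auto simp: smooth_terms_def)
    note r = smooth_terms_append[OF smooth_terms_restrict[OF N(3) o] smooth_terms_restrict[OF M(3) o]]
    show "\<exists>N k a j x. u \<in> N \<and> N \<subseteq> U \<and> smooth_terms V n N k a j x \<and> (\<forall>v\<in>N. p v + q v = formal_sum k a j x v)"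
    proof (intro exI conjI)
      show "u \<in> N \<inter> M" "N \<inter> M \<subseteq> U" using N M by auto
      show "smooth_terms V n (N \<inter> M) (k + l) (\<lambda>t. if t < k then a t else b (t - k)) (\<lambda>t. if t < k then j t else i (t - k))
         (\<lambda>t. if t < k then x t else y (t - k))" by (rule r(1)) auto
      show "\<forall>v\<in>N \<inter> M. p v + q v = formal_sum (k + l) (\<lambda>t. if t < k then a t else b (t - k))
          (\<lambda>t. if t < k then j t else i (t - k)) (\<lambda>t. if t < k then x t else y (t - k)) v"
      proof
        fix v assume v: "v \<in> N \<inter> M"
        have "formal_sum (k + l) (\<lambda>t. if t < k then a t else b (t - k)) (\<lambda>t. if t < k then j t else i (t - k))
          (\<lambda>t. if t < k then x t else y (t - k)) v = formal_sum k a j x v + formal_sum l b i y v" by (rule r(2)) auto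
        then show "p v + q v = formal_sum (k + l) (\<lambda>t. if t < k then a t else b (t - k))
          (\<lambda>t. if t < k then j t else i (t - k)) (\<lambda>t. if t < k then x t else y (t - k)) v"
          using N(4) M(4) v by simp
      qed
    qed
  qed
next
  fix n U c q assume c: "smooth_fun_on n U c" and q: "plot (free_space V) n U q"
  have U: "eopen n U" using q by (simp add: free_space_def)
  show "plot (free_space V) n U (\<lambda>u. c u *\<^sub>R q u)"
  proof (rule free_space_plotI[OF U])
    fix u assume u: "u \<in> U"
    obtain N k a j x where N: "u \<in> N" "N \<subseteq> U" "smooth_terms V n N k a j x" "\<And>v. v \<in> N \<Longrightarrow> q v = formal_sum k a j x v"
      using free_space_plotD[OF q u] by metis
    have o: "eopen n N" using N(3) by (simp add: smooth_terms_def)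
    have "smooth_terms V n N k (\<lambda>i v. c v * a i v) j x"
      using N(3) smooth_mult[OF smooth_subset[OF c o N(2)]] unfolding smooth_terms_def by blast
    moreover have "c v *\<^sub>R q v = formal_sum k (\<lambda>i v. c v * a i v) j x v" if "v \<in> N" for v
      using N(4)[OF that] by (simp add: formal_sum_def scaleR_sum_right)
    ultimately show "\<exists>N k a j x. u \<in> N \<and> N \<subseteq> U \<and> smooth_terms V n N k a j x \<and> (\<forall>v\<in>N. c v *\<^sub>R q v = formal_sum k a j x v)"
      using N(1,2) by blast
  qed
qed

lemma sgl_plot:
  assumes j: "valid V j" and x: "smooth_euclidean n U (idim j) (idom j) x"
  shows "plot (free_space V) n U (\<lambda>u. sgl (j, x u))"
proof (rule free_space_plotI)
  show U: "eopen n U" using x by (simp add: smooth_euclidean_def)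
  fix u assume u: "u \<in> U"
  have "smooth_terms V n U 1 (\<lambda>_ _. 1) (\<lambda>_. j) (\<lambda>_. x)" using j x U smooth_const[OF U] by (simp add: smooth_terms_def)
  moreover have "sgl (j, x v) = formal_sum 1 (\<lambda>_ _. 1) (\<lambda>_. j) (\<lambda>_. x) v" for v by (simp add: formal_sum_def)
  ultimately show "\<exists>N k a j' x'. u \<in> N \<and> N \<subseteq> U \<and> smooth_terms V n N k a j' x' \<and> (\<forall>v\<in>N. sgl (j, x v) = formal_sum k a j' x' v)"
    using u by blast
qed

lemma sub_dspace_dvs:
  assumes V: "diffeological_vector_space V" and A: "subspace A"
  shows "diffeological_vector_space (sub_dspace V A)"
proof (rule diffeological_vector_spaceI)
  interpret dvs V by (rule dvs_intro[OF V])
  show "diffeological_space (sub_dspace V A)" by (rule sub_dspace_diffeological) (rule diffeological_space_axioms)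
  show "subspace (points (sub_dspace V A))"
    using points_subspace A by (simp add: sub_dspace_def subspace_inter)
  show "plot (sub_dspace V A) n U (\<lambda>u. p u + q u)" if "plot (sub_dspace V A) n U p" "plot (sub_dspace V A) n U q" for n U p q
    using that plot_add[of n U p q] subspace_add[OF A] by (auto simp: sub_dspace_def image_subset_iff)
  show "plot (sub_dspace V A) n U (\<lambda>u. a u *\<^sub>R q u)" if "smooth_fun_on n U a" "plot (sub_dspace V A) n U q" for n U a q
    using that plot_scale[of n U a q] subspace_scale[OF A] by (auto simp: sub_dspace_def image_subset_iff)
qed

section \<open>Fibrewise actions\<close>

lemma plot_prod_iff: "plot (prod_dspace X Y) n U p \<longleftrightarrow> plot X n U (\<lambda>u. fst (p u)) \<and> plot Y n U (\<lambda>u. snd (p u))"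
  by (simp add: prod_dspace_def o_def)

lemma points_prod: "points (prod_dspace X Y) = points X \<times> points Y"
  by (simp add: prod_dspace_def)

lemma plot_sub_iff: "plot (sub_dspace X A) n U p \<longleftrightarrow> plot X n U p \<and> (\<forall>u\<in>U. p u \<in> A)"
  by (auto simp: sub_dspace_def)

lemma points_sub: "points (sub_dspace X A) = points X \<inter> A"
  by (simp add: sub_dspace_def)

lemma smooth_mapI:
  assumes "\<And>x. x \<in> points X \<Longrightarrow> f x \<in> points Y" "\<And>n U p. plot X n U p \<Longrightarrow> plot Y n U (\<lambda>u. f (p u))"
  shows "smooth_map X Y f"
  using assms by (auto simp: smooth_map_def o_def)

lemma fibrewise_pullback:
  assumes E: "fibrewise_action G B E" and C: "diffeological_space C" and f: "smooth_map C B f"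
  shows "fibrewise_action G C (pullback_bundle C f E)"
proof -
  let ?T = "total_space E"
  let ?P = "sub_dspace (prod_dspace C ?T) {(c, x). f c = proj E x}"
  have G: "diffeological_group G" and T: "diffeological_space ?T"
    and a: "smooth_map (prod_dspace ?T G) ?T (\<lambda>(x, g). act E x g)"
    and a0: "\<And>x. x \<in> points ?T \<Longrightarrow> act E x 0 = x"
    and a1: "\<And>x g h. x \<in> points ?T \<Longrightarrow> g \<in> points G \<Longrightarrow> h \<in> points G \<Longrightarrow> act E (act E x g) h = act E x (g + h)"
    and a2: "\<And>x g. x \<in> points ?T \<Longrightarrow> g \<in> points G \<Longrightarrow> proj E (act E x g) = proj E x"
    using E by (simp_all add: fibrewise_action_def)
  have P: "diffeological_space ?P" by (intro sub_dspace_diffeological prod_dspace_diffeological C T)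
  have Gd: "diffeological_space G" using G by (simp add: diffeological_group_def)
  have ap: "act E x g \<in> points ?T" if "x \<in> points ?T" "g \<in> points G" for x g
    using smooth_map_point[OF a, of "(x, g)"] that by (simp add: points_prod)
  have 1: "smooth_map ?P C fst"
    by (rule smooth_mapI) (auto simp: points_sub points_prod plot_sub_iff plot_prod_iff)
  have 2: "smooth_map (prod_dspace ?P G) ?P (\<lambda>(x, g). (\<lambda>(c, x) g. (c, act E x g)) x g)"
  proof (rule smooth_mapI)
    fix z assume "z \<in> points (prod_dspace ?P G)"
    then show "(\<lambda>(x, g). (\<lambda>(c, x) g. (c, act E x g)) x g) z \<in> points ?P"
      by (auto simp: points_sub points_prod ap a2)
  next
    fix n U p assume p: "plot (prod_dspace ?P G) n U p"
    have px: "plot ?P n U (\<lambda>u. fst (p u))" and pg: "plot G n U (\<lambda>u. snd (p u))"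
      using p by (simp_all add: plot_prod_iff)
    have c: "plot C n U (\<lambda>u. fst (fst (p u)))" and x: "plot ?T n U (\<lambda>u. snd (fst (p u)))"
      and e: "\<And>u. u \<in> U \<Longrightarrow> f (fst (fst (p u))) = proj E (snd (fst (p u)))"
      using px by (auto simp: plot_sub_iff plot_prod_iff case_prod_beta)
    have "plot ?T n U (\<lambda>u. (\<lambda>(x, g). act E x g) (snd (fst (p u)), snd (p u)))"
      by (rule smooth_map_plot[OF a]) (simp add: plot_prod_iff x pg)
    moreover have "proj E (act E (snd (fst (p u))) (snd (p u))) = f (fst (fst (p u)))" if "u \<in> U" for u
      using e[OF that] a2 diffeological_space.plot_in[OF T x that] diffeological_space.plot_in[OF Gd pg that] by simp
    ultimately show "plot ?P n U (\<lambda>u. (\<lambda>(x, g). (\<lambda>(c, x) g. (c, act E x g)) x g) (p u))"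
      using c by (simp add: plot_sub_iff plot_prod_iff case_prod_beta)
  qed
  show ?thesis
    unfolding fibrewise_action_def pullback_bundle_def
    using G C P 1 2 by (auto simp: points_sub points_prod a0 a1)
qed

lemma bundle_isomorphicI:
  assumes "smooth_map (total_space E) (total_space F) f" "smooth_map (total_space F) (total_space E) g"
    and "\<And>x. x \<in> points (total_space E) \<Longrightarrow> g (f x) = x" "\<And>y. y \<in> points (total_space F) \<Longrightarrow> f (g y) = y"
    and "\<And>x. x \<in> points (total_space E) \<Longrightarrow> proj F (f x) = proj E x"
    and "\<And>x h. x \<in> points (total_space E) \<Longrightarrow> h \<in> points G \<Longrightarrow> f (act E x h) = act F (f x) h"
  shows "bundle_isomorphic G E F"
  unfolding bundle_isomorphic_def diffeomorphism_def using assms by blast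

lemma D_open_points: assumes "diffeological_space X" shows "D_open X (points X)"
proof -
  interpret diffeological_space X by fact
  have "{u\<in>U. p u \<in> points X} = U" if "plot X n U p" for n U p using plot_in[OF that] by blast
  then show ?thesis using plot_domain by (simp add: D_open_def)
qed

lemma sub_dspace_superset:
  assumes X: "diffeological_space X" and A: "points X \<subseteq> A" shows "sub_dspace X A = X"
proof -
  have "plot (sub_dspace X A) = plot X"
    using diffeological_space.plot_in[OF X] A by (intro ext) (auto simp: plot_sub_iff)
  then show ?thesis using A by (cases X) (auto simp: sub_dspace_def)
qed

text \<open>
  Restricting a bundle to the set of all points of its base returns the same record, so the cover by this one
  set will do.
\<close>

lemma trivial_locally_trivial:
  assumes "trivial_bundle G B E" shows "locally_trivial_bundle G B E"
proof -
  have fw: "fibrewise_action G B E" using assms by (simp add: trivial_bundle_def)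
  have B: "diffeological_space B" and T: "diffeological_space (total_space E)" and pr: "smooth_map (total_space E) B (proj E)"
    using fw by (simp_all add: fibrewise_action_def)
  have "sub_dspace (total_space E) (proj E -` points B) = total_space E"
    by (rule sub_dspace_superset[OF T]) (use smooth_map_point[OF pr] in blast)
  then have "restrict_bundle E (points B) = E" by (simp add: restrict_bundle_def)
  moreover have "sub_dspace B (points B) = B" by (rule sub_dspace_superset[OF B subset_refl])
  ultimately show ?thesis
    unfolding locally_trivial_bundle_def using fw D_open_points[OF B] assms
    by (intro conjI exI[of _ "{points B}"]) auto
qed

lemma smooth_map_of_plot: assumes B: "diffeological_space B" and p: "plot B n U p" shows "smooth_map (open_dspace n U) B p"
proof -
  interpret diffeological_space B by fact
  show ?thesis
    by (rule smooth_mapI) (use plot_in[OF p] plot_compose[OF p] in \<open>auto simp: open_dspace_def o_def\<close>)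
qed

section \<open>The universal bundle\<close>

text \<open>
  A formal combination of points of \<open>V\<close> is zero iff its pairing with every real function on \<open>V\<close> is zero; hence
  this is the kernel of the evaluation of \<open>[j, x]\<close> to \<open>[imap j x]\<close>.
\<close>

definition kernel_space :: "'v dspace \<Rightarrow> 'v plot_vectors dspace" where
  "kernel_space V = sub_dspace (free_space V) {w. \<forall>f :: 'v \<Rightarrow> real. ev (f \<circ> plot_value) w = 0}"

text \<open>
  The fibre over \<open>v\<close> consists of the formal sums that evaluate to \<open>[v]\<close>, a coset of \<^const>\<open>kernel_space\<close>.
\<close>

definition universal_bundle :: "'v dspace \<Rightarrow> ('v, 'v plot_vectors) std_bundle" where
  "universal_bundle V = \<lparr>total_space = sub_dspace (prod_dspace V (free_space V)) {(v, w). \<forall>f :: 'v \<Rightarrow> real. ev (f \<circ> plot_value) w = f v},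
     proj = fst, act = (\<lambda>(v, w) g. (v, w + g))\<rparr>"

lemma kernel_space_dvs: assumes "diffeological_space V" shows "diffeological_vector_space (kernel_space V)"
  unfolding kernel_space_def
  by (rule sub_dspace_dvs[OF free_space_dvs[OF assms]]) (simp add: subspace_def ev_zero ev_add ev_scale)

lemma universal_bundle_fibrewise: assumes V: "diffeological_space V" shows "fibrewise_action (kernel_space V) V (universal_bundle V)"
proof -
  let ?T = "sub_dspace (prod_dspace V (free_space V)) {(v, w). \<forall>f :: 'a \<Rightarrow> real. ev (f \<circ> plot_value) w = f v}"
  note F = free_space_diffeological[OF V]
  interpret F: dvs "free_space V" by (rule dvs_intro[OF free_space_dvs[OF V]])
  have T: "diffeological_space ?T" by (intro sub_dspace_diffeological prod_dspace_diffeological V F)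
  have 1: "smooth_map ?T V fst"
    by (rule smooth_mapI) (auto simp: points_sub points_prod plot_sub_iff plot_prod_iff)
  have 2: "smooth_map (prod_dspace ?T (kernel_space V)) ?T (\<lambda>(x, g). (\<lambda>(v, w) g. (v, w + g)) x g)"
  proof (rule smooth_mapI)
    fix z assume "z \<in> points (prod_dspace ?T (kernel_space V))"
    then show "(\<lambda>(x, g). (\<lambda>(v, w) g. (v, w + g)) x g) z \<in> points ?T"
      using subspace_add[OF free_space_subspace] by (auto simp: points_sub points_prod kernel_space_def ev_add)
  next
    fix n U p assume "plot (prod_dspace ?T (kernel_space V)) n U p"
    then show "plot ?T n U (\<lambda>u. (\<lambda>(x, g). (\<lambda>(v, w) g. (v, w + g)) x g) (p u))"
      using F.plot_add[of n U "\<lambda>u. snd (fst (p u))" "\<lambda>u. snd (p u)"]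
      by (auto simp: plot_sub_iff plot_prod_iff kernel_space_def ev_add case_prod_beta)
  qed
  show ?thesis
    unfolding fibrewise_action_def universal_bundle_def
    using dvs_group[OF kernel_space_dvs[OF V]] V T 1 2 by (auto simp: points_sub points_prod add.assoc)
qed

text \<open>
  The pullback along a plot \<open>(n, U, p)\<close> is trivial over all of \<open>U\<close>, because \<open>u \<mapsto> [(n, U, p), u]\<close> is a smooth
  section of it.
\<close>

lemma universal_bundle_principal: assumes V: "diffeological_space V" shows "principal_bundle (kernel_space V) V (universal_bundle V)"
  unfolding principal_bundle_def
proof (intro conjI allI impI universal_bundle_fibrewise[OF V])
  fix n U p assume p: "plot V n U p"
  interpret V: diffeological_space V by fact
  interpret F: dvs "free_space V" by (rule dvs_intro[OF free_space_dvs[OF V]])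
  let ?C = "open_dspace n U" and ?E = "pullback_bundle (open_dspace n U) p (universal_bundle V)"
  have U: "eopen n U" by (rule V.plot_domain[OF p])
  have C: "diffeological_space ?C" by (rule open_dspace_diffeological[OF U])
  have j: "valid V (n, U, p)" using p by (simp add: valid_def)
  have fw: "fibrewise_action (kernel_space V) ?C ?E"
    by (rule fibrewise_pullback[OF universal_bundle_fibrewise[OF V] C smooth_map_of_plot[OF V p]])
  have pC: "points ?C = U" by (simp add: open_dspace_def)
  let ?P = "product_bundle (kernel_space V) ?C"
  let ?\<sigma> = "\<lambda>u. sgl ((n, U, p), u)"
  have ev\<sigma>: "ev (f \<circ> plot_value) (?\<sigma> u) = f (p u)" for f :: "_ \<Rightarrow> real" and u by (simp add: ev_sgl plot_value_def)
  have \<sigma>: "plot (free_space V) m N (\<lambda>u. ?\<sigma> (x u))" if "plot ?C m N x" for m N x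
    using sgl_plot[OF j, of m N x] that by (simp add: open_dspace_def)
  have T: "points (total_space ?E) = {(u, (v, w)). u \<in> U \<and> v = p u \<and> v \<in> points V \<and> w \<in> points (free_space V) \<and>
      (\<forall>f :: 'a \<Rightarrow> real. ev (f \<circ> plot_value) w = f v)}"
    by (auto simp: pullback_bundle_def universal_bundle_def points_sub points_prod pC)
  have Tp: "plot (total_space ?E) m N q \<longleftrightarrow> plot ?C m N (\<lambda>u. fst (q u)) \<and> plot V m N (\<lambda>u. fst (snd (q u))) \<and>
      plot (free_space V) m N (\<lambda>u. snd (snd (q u))) \<and> (\<forall>u\<in>N. p (fst (q u)) = fst (snd (q u)) \<and>
      (\<forall>f :: 'a \<Rightarrow> real. ev (f \<circ> plot_value) (snd (snd (q u))) = f (fst (snd (q u)))))" for m N q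
    by (auto simp: pullback_bundle_def universal_bundle_def plot_sub_iff plot_prod_iff case_prod_beta)
  have "bundle_isomorphic (kernel_space V) ?E ?P"
  proof (rule bundle_isomorphicI[where f = "\<lambda>x. (fst x, snd (snd x) - ?\<sigma> (fst x))"
        and g = "\<lambda>y. (fst y, (p (fst y), snd y + ?\<sigma> (fst y)))"])
    show "smooth_map (total_space ?E) (total_space ?P) (\<lambda>x. (fst x, snd (snd x) - ?\<sigma> (fst x)))"
    proof (rule smooth_mapI)
      fix x assume "x \<in> points (total_space ?E)"
      then show "(fst x, snd (snd x) - ?\<sigma> (fst x)) \<in> points (total_space ?P)"
        using subspace_diff[OF free_space_subspace[of V]] sgl_in_free_space[OF j]
        by (auto simp: T product_bundle_def points_prod points_sub pC kernel_space_def ev_diff ev\<sigma>)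
    next
      fix m N q assume q: "plot (total_space ?E) m N q"
      then have "plot (free_space V) m N (\<lambda>u. snd (snd (q u)) - ?\<sigma> (fst (q u)))"
        by (intro F.plot_diff \<sigma>) (simp_all add: Tp)
      then show "plot (total_space ?P) m N (\<lambda>u. (fst (q u), snd (snd (q u)) - ?\<sigma> (fst (q u))))"
        using q by (simp add: Tp product_bundle_def plot_prod_iff plot_sub_iff kernel_space_def ev_diff ev\<sigma>)
    qed
    show "smooth_map (total_space ?P) (total_space ?E) (\<lambda>y. (fst y, (p (fst y), snd y + ?\<sigma> (fst y))))"
    proof (rule smooth_mapI)
      fix x assume "x \<in> points (total_space ?P)"
      then show "(fst x, (p (fst x), snd x + ?\<sigma> (fst x))) \<in> points (total_space ?E)"
        using subspace_add[OF free_space_subspace[of V]] sgl_in_free_space[OF j] V.plot_in[OF p]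
        by (auto simp: T product_bundle_def points_prod points_sub pC kernel_space_def ev_add ev\<sigma>)
    next
      fix m N q assume q: "plot (total_space ?P) m N q"
      have q1: "plot ?C m N (\<lambda>u. fst (q u))" "plot (free_space V) m N (\<lambda>u. snd (q u))"
        using q by (simp_all add: product_bundle_def plot_prod_iff plot_sub_iff kernel_space_def)
      then have "plot (free_space V) m N (\<lambda>u. snd (q u) + ?\<sigma> (fst (q u)))"
        by (intro F.plot_add \<sigma>)
      moreover have "plot V m N (\<lambda>u. p (fst (q u)))"
        using smooth_map_plot[OF smooth_map_of_plot[OF V p] q1(1)] .
      ultimately show "plot (total_space ?E) m N (\<lambda>u. (fst (q u), (p (fst (q u)), snd (q u) + ?\<sigma> (fst (q u)))))"
        using q by (simp add: Tp product_bundle_def plot_prod_iff plot_sub_iff kernel_space_def ev_add ev\<sigma>)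
    qed
    show "(fst (fst x, snd (snd x) - ?\<sigma> (fst x)), (p (fst (fst x, snd (snd x) - ?\<sigma> (fst x))),
        snd (fst x, snd (snd x) - ?\<sigma> (fst x)) + ?\<sigma> (fst (fst x, snd (snd x) - ?\<sigma> (fst x))))) = x"
      if "x \<in> points (total_space ?E)" for x using that by (auto simp: T)
  qed (auto simp: product_bundle_def pullback_bundle_def universal_bundle_def)
  then show "locally_trivial_bundle (kernel_space V) ?C ?E"
    by (intro trivial_locally_trivial) (simp add: trivial_bundle_def fw)
qed

text \<open>
  A trivialisation carries the zero section of the product bundle to a section \<open>s\<close>.
\<close>

lemma universal_bundle_section:
  assumes V: "diffeological_space V" and t: "trivial_bundle (kernel_space V) V (universal_bundle V)"
  shows "\<exists>s. smooth_map V (free_space V) s \<and> (\<forall>v\<in>points V. \<forall>f :: _ \<Rightarrow> real. ev (f \<circ> plot_value) (s v) = f v)"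
proof -
  let ?T = "total_space (universal_bundle V)" and ?P = "prod_dspace V (kernel_space V)"
  interpret W: dvs "kernel_space V" by (rule dvs_intro[OF kernel_space_dvs[OF V]])
  obtain h g where h: "smooth_map ?T ?P h" and g: "smooth_map ?P ?T g"
    and hg: "\<And>y. y \<in> points ?P \<Longrightarrow> h (g y) = y"
    and pr: "\<And>x. x \<in> points ?T \<Longrightarrow> fst (h x) = fst x"
    using t unfolding trivial_bundle_def bundle_isomorphic_def diffeomorphism_def
    by (auto simp: product_bundle_def universal_bundle_def)
  have W0: "0 \<in> points (kernel_space V)" by (rule subspace_0[OF W.points_subspace])
  have z: "smooth_map V ?P (\<lambda>v. (v, 0))"
    using W.plot_const[OF diffeological_space.plot_domain[OF V] W0]
    by (intro smooth_mapI) (auto simp: points_prod plot_prod_iff W0)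
  have gz: "smooth_map V ?T (\<lambda>v. g (v, 0))" by (rule smooth_map_compose[OF z g])
  have "smooth_map ?T (free_space V) snd"
    by (rule smooth_mapI) (auto simp: universal_bundle_def points_sub points_prod plot_sub_iff plot_prod_iff)
  from smooth_map_compose[OF gz this] have "smooth_map V (free_space V) (\<lambda>v. snd (g (v, 0)))" .
  moreover have "ev (f \<circ> plot_value) (snd (g (v, 0))) = f v" if v: "v \<in> points V" for v and f :: "_ \<Rightarrow> real"
  proof -
    have gT: "g (v, 0) \<in> points ?T" using smooth_map_point[OF gz v] .
    have "fst (g (v, 0)) = fst (h (g (v, 0)))" using pr[OF gT] by simp
    also have "\<dots> = v" using hg[of "(v, 0)"] v W0 by (simp add: points_prod)
    finally show ?thesis using gT by (auto simp: universal_bundle_def points_sub case_prod_beta)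
  qed
  ultimately show ?thesis by blast
qed

section \<open>Symmetry of second partial derivatives\<close>

text \<open>
  Two applications of the mean value theorem, first in direction \<open>i\<close> and then in direction \<open>j\<close>.
\<close>

lemma second_difference:
  assumes f: "smooth_fun_on n U f" and i: "i < n" and j: "j < n" and ij: "i \<noteq> j"
    and e: "ebox n x e \<subseteq> U" "x \<in> U" and h: "0 < h" "h < e"
  shows "\<exists>z\<in>ebox n x e. f (x(i := x i + h, j := x j + h)) - f (x(i := x i + h)) - f (x(j := x j + h)) + f x
      = h * (h * pd j (pd i f) z)"
proof -
  have U: "eopen n U" by (rule smooth_open[OF f])
  have inb: "x(i := s, j := t) \<in> ebox n x e" if "\<bar>s - x i\<bar> \<le> h" "\<bar>t - x j\<bar> \<le> h" for s t
    using that h i j eopen_zero[OF U e(2)] by (auto simp: ebox_def)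
  have xj: "x(i := s) = x(i := s, j := x j)" for s using ij by (auto simp: fun_eq_iff)
  define g where "g t = f (x(i := t, j := x j + h)) - f (x(i := t))" for t
  have dg: "(g has_real_derivative pd i f (x(i := t, j := x j + h)) - pd i f (x(i := t, j := x j))) (at t)"
    if "x i \<le> t" "t \<le> x i + h" for t
  proof -
    have tb: "\<bar>t - x i\<bar> \<le> h" using that by auto
    have "((\<lambda>s. f ((x(i := t, j := y))(i := s))) has_real_derivative pd i f (x(i := t, j := y))) (at t)"
      if "\<bar>y - x j\<bar> \<le> h" for y
      using smooth_has_pd[OF f i, of "x(i := t, j := y)"] inb[OF tb that] e(1) ij by auto
    moreover have tw: "(x(i := t, j := y))(i := s) = x(i := s, j := y)" for s y using ij by (auto simp: fun_eq_iff)
    ultimately have d: "((\<lambda>s. f (x(i := s, j := y))) has_real_derivative pd i f (x(i := t, j := y))) (at t)"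
      if "\<bar>y - x j\<bar> \<le> h" for y using that by (simp only: tw)
    have "((\<lambda>s. f (x(i := s, j := x j + h)) - f (x(i := s, j := x j))) has_real_derivative
       pd i f (x(i := t, j := x j + h)) - pd i f (x(i := t, j := x j))) (at t)"
      by (rule DERIV_diff[OF d d]) (use h in auto)
    then show ?thesis unfolding g_def xj[symmetric] .
  qed
  obtain t where t: "x i < t" "t < x i + h"
    "g (x i + h) - g (x i) = (x i + h - x i) * (pd i f (x(i := t, j := x j + h)) - pd i f (x(i := t, j := x j)))"
    using MVT2[of "x i" "x i + h" g "\<lambda>t. pd i f (x(i := t, j := x j + h)) - pd i f (x(i := t, j := x j))"] dg h by auto
  have dk: "((\<lambda>s. pd i f (x(i := t, j := s))) has_real_derivative pd j (pd i f) (x(i := t, j := s))) (at s)"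
    if "x j \<le> s" "s \<le> x j + h" for s
  proof -
    have "x(i := t, j := s) \<in> U" using inb[of t s] that t e(1) by auto
    from smooth_has_pd[OF smooth_pd[OF f i] j this] show ?thesis by simp
  qed
  obtain s where s: "x j < s" "s < x j + h"
    "pd i f (x(i := t, j := x j + h)) - pd i f (x(i := t, j := x j)) = (x j + h - x j) * pd j (pd i f) (x(i := t, j := s))"
    using MVT2[of "x j" "x j + h" "\<lambda>s. pd i f (x(i := t, j := s))" "\<lambda>s. pd j (pd i f) (x(i := t, j := s))"] dk h by auto
  have "x(i := t, j := s) \<in> ebox n x e" using inb[of t s] t s by auto
  moreover have "f (x(i := x i + h, j := x j + h)) - f (x(i := x i + h)) - f (x(j := x j + h)) + f x = g (x i + h) - g (x i)"
    by (simp add: g_def)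
  ultimately show ?thesis using t(3) s(3) by auto
qed

text \<open>
  Both mixed derivatives are approximated by the same second difference, which is symmetric in \<open>i\<close> and \<open>j\<close>.
\<close>

lemma pd_commute:
  assumes f: "smooth_fun_on n U f" and i: "i < n" and j: "j < n" and x: "x \<in> U"
  shows "pd i (pd j f) x = pd j (pd i f) x"
proof (cases "i = j")
  case False
  have U: "eopen n U" by (rule smooth_open[OF f])
  have "\<bar>pd j (pd i f) x - pd i (pd j f) x\<bar> \<le> 0 + e" if e: "e > 0" for e
  proof -
    obtain d1 where d1: "d1 > 0" "ebox n x d1 \<subseteq> U" "\<forall>y\<in>ebox n x d1. \<bar>pd j (pd i f) y - pd j (pd i f) x\<bar> < e / 2"
      using continuous_ebox[OF U smooth_continuous[OF smooth_pd[OF smooth_pd[OF f i] j]] x, of "e / 2"] e by auto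
    obtain d2 where d2: "d2 > 0" "ebox n x d2 \<subseteq> U" "\<forall>y\<in>ebox n x d2. \<bar>pd i (pd j f) y - pd i (pd j f) x\<bar> < e / 2"
      using continuous_ebox[OF U smooth_continuous[OF smooth_pd[OF smooth_pd[OF f j] i]] x, of "e / 2"] e by auto
    define h where "h = min d1 d2 / 2"
    have h: "0 < h" "h < d1" "h < d2" using d1 d2 by (auto simp: h_def)
    obtain z where z: "z \<in> ebox n x d1" "f (x(i := x i + h, j := x j + h)) - f (x(i := x i + h)) - f (x(j := x j + h)) + f x
      = h * (h * pd j (pd i f) z)" using second_difference[OF f i j False d1(2) x h(1,2)] by blast
    obtain y where y: "y \<in> ebox n x d2" "f (x(j := x j + h, i := x i + h)) - f (x(j := x j + h)) - f (x(i := x i + h)) + f x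
      = h * (h * pd i (pd j f) y)" using second_difference[OF f j i False[symmetric] d2(2) x h(1,3)] by blast
    have "x(j := x j + h, i := x i + h) = x(i := x i + h, j := x j + h)" using False by (simp add: fun_upd_twist)
    then have "h * (h * pd j (pd i f) z) = h * (h * pd i (pd j f) y)" unfolding z(2)[symmetric] y(2)[symmetric] by simp
    then have "pd j (pd i f) z = pd i (pd j f) y" using h(1) by simp
    moreover have "\<bar>pd j (pd i f) z - pd j (pd i f) x\<bar> < e / 2" "\<bar>pd i (pd j f) y - pd i (pd j f) x\<bar> < e / 2"
      using d1(3) d2(3) z(1) y(1) by auto
    ultimately show ?thesis by linarith
  qed
  then have "\<bar>pd j (pd i f) x - pd i (pd j f) x\<bar> \<le> 0" by (rule field_le_epsilon)
  then show ?thesis by simp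
qed simp

section \<open>Directional derivatives on diffeological vector spaces\<close>

abbreviation (input) smooth_real :: "'v dspace \<Rightarrow> ('v \<Rightarrow> real) \<Rightarrow> bool" where
  "smooth_real V \<phi> \<equiv> (\<forall>n U p. plot V n U p \<longrightarrow> smooth_fun_on n U (\<lambda>u. \<phi> (p u)))"

definition dirderiv :: "('v::real_vector \<Rightarrow> real) \<Rightarrow> 'v \<Rightarrow> 'v \<Rightarrow> real" where
  "dirderiv \<phi> x v = deriv (\<lambda>r. \<phi> (x + r *\<^sub>R v)) 0"

definition lin_on :: "'v::real_vector dspace \<Rightarrow> ('v \<Rightarrow> real) \<Rightarrow> bool" where
  "lin_on V l \<longleftrightarrow> (\<forall>v\<in>points V. \<forall>w\<in>points V. l (v + w) = l v + l w) \<and> (\<forall>r. \<forall>v\<in>points V. l (r *\<^sub>R v) = r * l v)"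

text \<open>
  The diagonal curve \<open>t \<mapsto> (t, t)\<close> in the plane.
\<close>

definition diag :: "real \<Rightarrow> rvec" where
  "diag t = (\<lambda>i. if i < 2 then t else 0)"

lemma diag_simps: "diag t 0 = t" "diag t 1 = t" "diag t (Suc 0) = t" "i \<ge> 2 \<Longrightarrow> diag t i = 0" "i < 2 \<Longrightarrow> diag t i = t"
  by (simp_all add: diag_def)

lemma diagonal_derivative:
  assumes F: "smooth_fun_on 2 D F" and t: "diag t \<in> D"
  shows "((\<lambda>r. F (diag r)) has_real_derivative pd 0 F (diag t) + pd 1 F (diag t)) (at t)"
proof -
  have "((\<lambda>r. F (diag r)) has_real_derivative (\<Sum>j<2. pd j F (diag t) * 1)) (at t)"
  proof (rule chain_rule_curve)
    show "eopen 2 D" "Ck_on (Suc 0) 2 D F" by (rule smooth_open[OF F]) (rule smooth_Ck[OF F])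
    show "diag t \<in> D" by (rule t)
    show "\<forall>\<^sub>F t in nhds t. \<forall>i\<ge>2. diag t i = 0" by (simp add: diag_simps)
    show "((\<lambda>t. diag t j) has_real_derivative 1) (at t)" if "j < 2" for j using that by (simp add: diag_simps)
  qed
  then show ?thesis by (simp add: numeral_2_eq_2)
qed

context dvs
begin

text \<open>
  The lines through \<open>x\<close> with direction \<open>p u\<close> form a plot in the time and \<open>u\<close> jointly, so that directional
  derivatives of functions on \<open>V\<close> become partial derivatives in the added coordinate.
\<close>

lemma plot_cylinder:
  assumes p: "plot V n U p" and x: "x \<in> points V"
  shows "plot V (Suc n) (cylinder n U) (\<lambda>w. x + w n *\<^sub>R p (w(n := 0)))"
proof -
  have U: "eopen n U" by (rule plot_domain[OF p])
  note C = cylinder_open[OF U]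
  have "plot V (Suc n) (cylinder n U) (\<lambda>w. p (w(n := 0)))"
    using plot_compose[OF p cylinder_proj_smooth[OF U]] by (simp add: o_def)
  then show ?thesis by (intro plot_add plot_scale plot_const C x smooth_coordinate)
qed

lemma dirderiv_eq_pd:
  assumes p: "plot V n U p" and u: "u \<in> U"
  shows "dirderiv \<phi> x (p u) = pd n (\<lambda>w. \<phi> (x + w n *\<^sub>R p (w(n := 0)))) u"
proof -
  have U: "eopen n U" by (rule plot_domain[OF p])
  have "u n = 0" using eopen_zero[OF U u] by simp
  then show ?thesis using cylinder_update(2)[OF U u] by (simp add: dirderiv_def pd_def)
qed

lemma dirderiv_smooth:
  assumes \<phi>: "smooth_real V \<phi>" and x: "x \<in> points V"
  shows "smooth_real V (dirderiv \<phi> x)"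
proof (intro allI impI)
  fix n U p assume p: "plot V n U p"
  have U: "eopen n U" by (rule plot_domain[OF p])
  have "smooth_fun_on (Suc n) (cylinder n U) (\<lambda>w. \<phi> (x + w n *\<^sub>R p (w(n := 0))))"
    using \<phi> plot_cylinder[OF p x] by blast
  from smooth_slice[OF smooth_pd[OF this, of n]]
  have "smooth_fun_on n {u \<in> cylinder n U. u n = 0} (pd n (\<lambda>w. \<phi> (x + w n *\<^sub>R p (w(n := 0)))))" by simp
  then have "smooth_fun_on n U (pd n (\<lambda>w. \<phi> (x + w n *\<^sub>R p (w(n := 0)))))"
    by (rule smooth_subset[OF _ U]) (use cylinder_subset[OF U] eopen_zero[OF U] in auto)
  then show "smooth_fun_on n U (\<lambda>u. dirderiv \<phi> x (p u))"
    by (rule smooth_cong) (rule dirderiv_eq_pd[OF p, symmetric])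
qed

lemma dirderiv_deriv0:
  assumes \<phi>: "smooth_real V \<phi>" and x: "x \<in> points V" and v: "v \<in> points V"
  shows "((\<lambda>r. \<phi> (x + r *\<^sub>R v)) has_real_derivative dirderiv \<phi> x v) (at 0)"
proof -
  let ?U = "{x :: rvec. \<forall>i\<ge>0. x i = 0}"
  have p: "plot V 0 ?U (\<lambda>_. v)" by (rule plot_const[OF eopen_UNIV v])
  have u: "(\<lambda>_. 0) \<in> ?U" by simp
  have s: "smooth_fun_on (Suc 0) (cylinder 0 ?U) (\<lambda>w. \<phi> (x + w 0 *\<^sub>R v))" using \<phi> plot_cylinder[OF p x] by blast
  have "(\<lambda>_. 0) \<in> cylinder 0 ?U" by (rule subsetD[OF cylinder_subset[OF eopen_UNIV] u])
  from smooth_has_pd[OF s _ this, of 0]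
  have "((\<lambda>t. \<phi> (x + t *\<^sub>R v)) has_real_derivative pd 0 (\<lambda>w. \<phi> (x + w 0 *\<^sub>R v)) (\<lambda>_. 0)) (at 0)" by simp
  then show ?thesis unfolding dirderiv_def by (metis DERIV_imp_deriv)
qed

lemma dirderiv_deriv:
  assumes \<phi>: "smooth_real V \<phi>" and x: "x \<in> points V" and v: "v \<in> points V"
  shows "((\<lambda>r. \<phi> (x + r *\<^sub>R v)) has_real_derivative dirderiv \<phi> (x + t *\<^sub>R v) v) (at t)"
proof -
  have "x + t *\<^sub>R v \<in> points V" using points_subspace x v by (simp add: subspace_add subspace_scale)
  from dirderiv_deriv0[OF \<phi> this v]
  have "((\<lambda>r. \<phi> (x + (r + t) *\<^sub>R v)) has_real_derivative dirderiv \<phi> (x + t *\<^sub>R v) v) (at 0)"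
    by (simp add: scaleR_add_left add_ac)
  then show ?thesis using DERIV_shift[of "\<lambda>r. \<phi> (x + r *\<^sub>R v)" _ 0 t] by simp
qed

lemma dirderiv_scale:
  assumes \<phi>: "smooth_real V \<phi>" and x: "x \<in> points V" and v: "v \<in> points V"
  shows "dirderiv \<phi> x (c *\<^sub>R v) = c * dirderiv \<phi> x v"
proof -
  have d: "((\<lambda>r. \<phi> (x + r *\<^sub>R v)) has_real_derivative dirderiv \<phi> x v) (at (c * 0))" using dirderiv_deriv0[OF assms] by simp
  have "((\<lambda>r. c * r) has_real_derivative c) (at 0)" by (auto intro!: derivative_eq_intros)
  from DERIV_chain2[OF d this] have "((\<lambda>r. \<phi> (x + r *\<^sub>R (c *\<^sub>R v))) has_real_derivative c * dirderiv \<phi> x v) (at 0)"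
    by (simp add: mult.commute)
  then show ?thesis unfolding dirderiv_def[of \<phi> x "c *\<^sub>R v"] by (rule DERIV_imp_deriv)
qed

text \<open>
  On the plane through \<open>x\<close> spanned by \<open>v\<close> and \<open>w\<close> the derivative along the diagonal is the sum of the two
  partial derivatives.
\<close>

lemma dirderiv_add:
  assumes \<phi>: "smooth_real V \<phi>" and x: "x \<in> points V" and v: "v \<in> points V" and w: "w \<in> points V"
  shows "dirderiv \<phi> x (v + w) = dirderiv \<phi> x v + dirderiv \<phi> x w"
proof -
  let ?D = "{x :: rvec. \<forall>i\<ge>2. x i = 0}" and ?z = "diag 0"
  let ?F = "\<lambda>z. \<phi> (x + z 0 *\<^sub>R v + z 1 *\<^sub>R w)"
  have "plot V 2 ?D (\<lambda>z. x + z 0 *\<^sub>R v + z 1 *\<^sub>R w)"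
    by (intro plot_add plot_scale plot_const eopen_UNIV x v w smooth_coordinate)
  then have F: "smooth_fun_on 2 ?D ?F" using \<phi> by blast
  have "((\<lambda>r. ?F (diag r)) has_real_derivative pd 0 ?F ?z + pd 1 ?F ?z) (at 0)"
    by (rule diagonal_derivative[OF F]) (simp add: diag_simps)
  then have "((\<lambda>r. \<phi> (x + r *\<^sub>R (v + w))) has_real_derivative pd 0 ?F ?z + pd 1 ?F ?z) (at 0)"
    by (simp add: diag_simps scaleR_add_right add.assoc)
  moreover have "pd 0 ?F ?z = dirderiv \<phi> x v" "pd 1 ?F ?z = dirderiv \<phi> x w"
    by (simp_all add: pd_def dirderiv_def diag_simps)
  ultimately show ?thesis unfolding dirderiv_def[of \<phi> x "v + w"] by (metis DERIV_imp_deriv)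
qed

lemma dirderiv_linear: "smooth_real V \<phi> \<Longrightarrow> x \<in> points V \<Longrightarrow> lin_on V (dirderiv \<phi> x)"
  by (simp add: lin_on_def dirderiv_add dirderiv_scale)

lemma lin_on_diff: "lin_on V l \<Longrightarrow> v \<in> points V \<Longrightarrow> w \<in> points V \<Longrightarrow> l (v - w) = l v - l w"
  using points_subspace subspace_neg[OF points_subspace, of w]
  unfolding lin_on_def by (metis (no_types, lifting) add_diff_cancel diff_add_cancel subspace_diff)

text \<open>
  The space \<open>V\<close> has no charts, so the chain rule does not apply to \<open>\<phi>\<close>.  Let \<open>K r\<close> be the derivative of
  \<open>\<phi> (r p)\<close> at \<open>u\<close> in direction \<open>l\<close>.  As \<open>p u = 0\<close>, the function \<open>\<phi> (r\<^sub>1 p + r\<^sub>2 p')\<close>, with independent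
  arguments for \<open>p\<close> and \<open>p'\<close>, has the partial derivatives \<open>K r\<^sub>1\<close> and \<open>K r\<^sub>2\<close>, so \<open>K\<close> is additive.  Hence \<open>K 1\<close>
  is the limit of \<open>K (1 / m) / (1 / m)\<close>, the derivative of \<open>K\<close> at \<open>0\<close>.  That is a mixed second derivative of
  \<open>\<phi> (r p)\<close>, and exchanging the order of differentiation gives the derivative of the directional derivative.
\<close>

lemma differential_at_zero:
  assumes \<phi>: "smooth_real V \<phi>" and p: "plot V n U p" and u: "u \<in> U" and pu: "p u = 0" and l: "l < n"
  shows "pd l (\<lambda>u. \<phi> (p u)) u = pd l (\<lambda>u. dirderiv \<phi> 0 (p u)) u"
proof -
  have U: "eopen n U" by (rule plot_domain[OF p])
  have V0: "0 \<in> points V" by (rule subspace_0[OF points_subspace])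
  have un: "u n = 0" using eopen_zero[OF U u] by simp
  let ?t = "u l"
  define K where "K r = pd l (\<lambda>u. \<phi> (r *\<^sub>R p u)) u" for r
  obtain e where e: "e > 0" "ebox n u e \<subseteq> U" using eopen_ebox[OF U u] by blast
  have K_add: "K (r1 + r2) = K r1 + K r2" for r1 r2
  proof -
    let ?z = "diag ?t"
    let ?D = "ebox 2 ?z e"
    have D: "eopen 2 ?D" by (rule eopen_ebox_self)
    have h: "smooth_euclidean 2 ?D n U (\<lambda>w. u(l := w m))" if m: "m < 2" for m
      unfolding smooth_euclidean_def
    proof (intro conjI allI impI)
      show "(\<lambda>w. u(l := w m)) ` ?D \<subseteq> U"
      proof
        fix y assume "y \<in> (\<lambda>w. u(l := w m)) ` ?D"
        then obtain w where w: "w \<in> ?D" "y = u(l := w m)" by blast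
        then have "\<bar>w m - ?t\<bar> < e" using m by (auto simp: ebox_def diag_simps)
        then have "y \<in> ebox n u e" using w(2) l e(1) eopen_zero[OF U u] by (auto simp: ebox_def)
        then show "y \<in> U" using e(2) by blast
      qed
      fix i show "smooth_fun_on 2 ?D (\<lambda>w. (u(l := w m)) i)"
        using smooth_coordinate[OF D] smooth_const[OF D] by (cases "i = l") simp_all
    qed (use D U in auto)
    let ?F = "\<lambda>w. \<phi> (r1 *\<^sub>R p (u(l := w 0)) + r2 *\<^sub>R p (u(l := w 1)))"
    have hp: "plot V 2 ?D (\<lambda>w. p (u(l := w m)))" if "m < 2" for m
      using plot_compose[OF p h[OF that]] by (simp add: o_def)
    have "plot V 2 ?D (\<lambda>w. r1 *\<^sub>R p (u(l := w 0)) + r2 *\<^sub>R p (u(l := w 1)))"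
      by (intro plot_add plot_scale[OF smooth_const[OF D]] hp) auto
    then have F: "smooth_fun_on 2 ?D ?F" using \<phi> by blast
    have "?z \<in> ?D" using e(1) by (simp add: ebox_def diag_simps)
    from diagonal_derivative[OF F this]
    have "((\<lambda>r. \<phi> ((r1 + r2) *\<^sub>R p (u(l := r)))) has_real_derivative pd 0 ?F ?z + pd 1 ?F ?z) (at ?t)"
      by (simp add: scaleR_add_left diag_simps)
    then have "K (r1 + r2) = pd 0 ?F ?z + pd 1 ?F ?z" unfolding K_def by (rule pd_I)
    moreover have "pd 0 ?F ?z = K r1" "pd 1 ?F ?z = K r2" by (simp_all add: pd_def K_def pu diag_simps)
    ultimately show ?thesis by simp
  qed
  have K0: "K 0 = 0" using K_add[of 0 0] by simp
  have Km: "K (real m * r) = real m * K r" for m r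
    by (induction m) (simp_all add: K0 K_add distrib_right)
  let ?G = "\<lambda>w. \<phi> (0 + w n *\<^sub>R p (w(n := 0)))"
  have G: "smooth_fun_on (Suc n) (cylinder n U) ?G" using \<phi> plot_cylinder[OF p V0] by blast
  have uC: "u \<in> cylinder n U" using cylinder_subset[OF U] u by blast
  have KG: "K r = pd l ?G (u(n := r))" for r
  proof -
    have "(u(n := r, l := t))(n := 0) = u(l := t)" for t
      using un l by (auto simp: fun_eq_iff)
    then show ?thesis using l by (simp add: K_def pd_def)
  qed
  have "((\<lambda>r. pd l ?G (u(n := r))) has_real_derivative pd n (pd l ?G) u) (at (u n))"
    using smooth_has_pd[OF smooth_pd[OF G, of l] _ uC, of n] l by simp
  moreover have "K = (\<lambda>r. pd l ?G (u(n := r)))" using KG by (rule ext)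
  ultimately have "(K has_real_derivative pd n (pd l ?G) u) (at 0)" unfolding un by (simp only:)
  then have "((\<lambda>h. (K (0 + h) - K 0) / h) \<longlongrightarrow> pd n (pd l ?G) u) (at 0)" by (simp add: DERIV_def)
  then have lim: "((\<lambda>h. K h / h) \<longlongrightarrow> pd n (pd l ?G) u) (at 0)" by (simp add: K0)
  have seq: "filterlim (\<lambda>m. inverse (real (Suc m))) (at 0) sequentially"
    by (rule filterlim_atI[OF LIMSEQ_inverse_real_of_nat]) simp
  have "(\<lambda>m. K (inverse (real (Suc m))) / inverse (real (Suc m))) \<longlonglongrightarrow> pd n (pd l ?G) u"
    by (rule filterlim_compose[OF lim seq])
  moreover have "K (inverse (real (Suc m))) / inverse (real (Suc m)) = K 1" for m
    using Km[of "Suc m" "inverse (real (Suc m))"] by (simp add: field_simps)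
  ultimately have "K 1 = pd n (pd l ?G) u" using LIMSEQ_const_iff[of "K 1"] by simp
  also have "\<dots> = pd l (pd n ?G) u" using pd_commute[OF G _ _ uC, of n l] l by simp
  also have "\<dots> = pd l (\<lambda>u. dirderiv \<phi> 0 (p u)) u"
    by (rule pd_cong[OF U u l]) (rule dirderiv_eq_pd[OF p, symmetric])
  finally show ?thesis by (simp add: K_def)
qed

end

section \<open>Jets of a section of the universal bundle\<close>

definition smooth_test :: "'v dspace \<Rightarrow> ('v idx \<times> rvec \<Rightarrow> real) \<Rightarrow> bool" where
  "smooth_test V f \<longleftrightarrow> (\<forall>j. valid V j \<longrightarrow> smooth_fun_on (idim j) (idom j) (\<lambda>z. f (j, z)))"

lemma smooth_testD: "smooth_test V f \<Longrightarrow> valid V j \<Longrightarrow> smooth_fun_on (idim j) (idom j) (\<lambda>z. f (j, z))"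
  unfolding smooth_test_def by blast

lemma finite_separation:
  assumes "finite (Y :: real set)"
  shows "\<exists>e>0. \<forall>y\<in>Y. \<forall>z\<in>Y. \<bar>y - z\<bar> < 2 * e \<longrightarrow> y = z"
proof -
  define D where "D = (\<lambda>(y, z). \<bar>y - z\<bar>) ` {(y, z) \<in> Y \<times> Y. y \<noteq> z}"
  have "finite {(y, z) \<in> Y \<times> Y. y \<noteq> z}" by (rule finite_subset[of _ "Y \<times> Y"]) (use assms in auto)
  then have f: "finite D" unfolding D_def by (rule finite_imageI)
  define e where "e = Min (insert 1 D) / 2"
  have "e > 0" using f by (auto simp: e_def D_def)
  moreover have "y = z" if "y \<in> Y" "z \<in> Y" "\<bar>y - z\<bar> < 2 * e" for y z
  proof (rule ccontr)
    assume "y \<noteq> z"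
    then have "\<bar>y - z\<bar> \<in> D" using that unfolding D_def by (intro image_eqI[of _ _ "(y, z)"]) auto
    then have "Min (insert 1 D) \<le> \<bar>y - z\<bar>" using f by simp
    then show False using that(3) by (simp add: e_def)
  qed
  ultimately show ?thesis by blast
qed

text \<open>
  A smooth section of the universal bundle.  The second condition says that \<open>s v\<close> evaluates to \<open>[v]\<close>; its strength lies in
  the functions \<open>f\<close> that are not linear.
\<close>

locale plot_section = dvs V for V :: "'v::real_vector dspace" +
  fixes s :: "'v \<Rightarrow> 'v plot_vectors"
  assumes s_smooth: "smooth_map V (free_space V) s"
    and s_ev: "\<And>v (f :: 'v \<Rightarrow> real). v \<in> points V \<Longrightarrow> ev (f \<circ> plot_value) (s v) = f v"
begin

lemma ev_section_smooth:
  assumes f: "smooth_test V f" shows "smooth_real V (\<lambda>v. ev f (s v))"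
proof (intro allI impI)
  fix n U p assume p: "plot V n U p"
  note sp = smooth_map_plot[OF s_smooth p]
  show "smooth_fun_on n U (\<lambda>u. ev f (s (p u)))"
  proof (rule smooth_local[OF plot_domain[OF p]])
    fix u assume "u \<in> U"
    then obtain N k a j x where N: "u \<in> N" "N \<subseteq> U" "smooth_terms V n N k a j x" "\<And>v. v \<in> N \<Longrightarrow> s (p v) = formal_sum k a j x v"
      using free_space_plotD[OF sp] by metis
    have o: "eopen n N" using N(3) by (simp add: smooth_terms_def)
    have "smooth_fun_on n N (\<lambda>v. a i v * f (j i, x i v))" if i: "i < k" for i
    proof (rule smooth_mult)
      show "smooth_fun_on n N (a i)" using N(3) i by (simp add: smooth_terms_def)
      have x: "smooth_euclidean n N (idim (j i)) (idom (j i)) (x i)" and v: "valid V (j i)"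
        using N(3) i by (simp_all add: smooth_terms_def)
      have "smooth_fun_on (idim (j i)) (idom (j i)) (\<lambda>z. f (j i, z))" by (rule smooth_testD[OF f v])
      from smooth_euclidean_compose_fun[OF x this] show "smooth_fun_on n N (\<lambda>v. f (j i, x i v))" .
    qed
    then have "smooth_fun_on n N (\<lambda>v. \<Sum>i<k. a i v * f (j i, x i v))" by (intro smooth_sum[OF o]) auto
    then have "smooth_fun_on n N (\<lambda>u. ev f (s (p u)))"
      by (rule smooth_cong) (simp add: N(4) ev_formal_sum)
    then show "\<exists>N. eopen n N \<and> u \<in> N \<and> N \<subseteq> U \<and> smooth_fun_on n N (\<lambda>u. ev f (s (p u)))"
      using o N(1,2) by blast
  qed
qed

text \<open>
  The first-order behaviour of \<open>s\<close> at the zero vector in the directions \<open>p u\<close>.  Near \<open>r = 0\<close> the formal sum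
  \<open>s (r p(u))\<close> has terms \<open>a\<^sub>i(r, u) [j\<^sub>i, x\<^sub>i(r, u)]\<close>.  Differentiating in \<open>r\<close> gives monopoles with coefficients
  \<open>al\<^sub>i = \<partial>a\<^sub>i/\<partial>r\<close> and dipoles with coefficients \<open>b\<^sub>i\<^sup>c = a\<^sub>i \<partial>x\<^sub>i\<^sup>c/\<partial>r\<close>, both located at the points
  \<open>m\<^sub>i(u) = x\<^sub>i(0, u)\<close>.  The last clause recovers the values of smooth linear functionals from the dipoles.
  The coefficients \<open>b i c\<close> are zero for \<open>c\<close> beyond the dimension of plot \<open>j i\<close>, so that terms at a common
  point can be added up without a condition on \<open>c\<close>.
\<close>

definition jet_rep :: "nat \<Rightarrow> rvec set \<Rightarrow> (rvec \<Rightarrow> 'v) \<Rightarrow> nat \<Rightarrow> (nat \<Rightarrow> rvec \<Rightarrow> real) \<Rightarrow> (nat \<Rightarrow> 'v idx) \<Rightarrow>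
    (nat \<Rightarrow> rvec \<Rightarrow> rvec) \<Rightarrow> (nat \<Rightarrow> nat \<Rightarrow> rvec \<Rightarrow> real) \<Rightarrow> bool" where
  "jet_rep n N p k al j m b \<longleftrightarrow> eopen n N \<and>
     (\<forall>i<k. valid V (j i) \<and> smooth_fun_on n N (al i) \<and> smooth_euclidean n N (idim (j i)) (idom (j i)) (m i) \<and>
        (\<forall>c. smooth_fun_on n N (b i c)) \<and> (\<forall>c\<ge>idim (j i). \<forall>u\<in>N. b i c u = 0)) \<and>
     (\<forall>u\<in>N. \<forall>f. smooth_test V f \<longrightarrow> dirderiv (\<lambda>v. ev f (s v)) 0 (p u) =
        (\<Sum>i<k. al i u * f (j i, m i u) + (\<Sum>c<idim (j i). b i c u * pd c (\<lambda>z. f (j i, z)) (m i u)))) \<and>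
     (\<forall>u\<in>N. \<forall>l. lin_on V l \<longrightarrow> smooth_real V l \<longrightarrow>
        l (p u) = (\<Sum>i<k. \<Sum>c<idim (j i). b i c u * pd c (\<lambda>z. l (imap (j i) z)) (m i u)))"

text \<open>
  Only the last clause needs an idea.  Pairing \<open>s (r p(u))\<close> with \<open>l\<close> itself would give monopole terms.  Instead
  pair with \<open>\<theta> \<circ> l\<close>, where \<open>\<theta> y = y - y\<^sub>0\<close> for \<open>y\<close> close to a value \<open>y\<^sub>0\<close> of \<open>l\<close> at one of the finitely many points
  \<open>m\<^sub>i(u)\<close>, or close to \<open>y\<^sub>0 = 0\<close>.  As \<open>s v\<close> evaluates to \<open>[v]\<close>, the result is \<open>\<theta> (r l(p u)) = r l(p u)\<close> for small \<open>r\<close>.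
  On the other side each term is \<open>a\<^sub>i\<close> times an increment of \<open>l\<close>, whose derivative at \<open>r = 0\<close> contains only
  the dipoles.
\<close>

lemma jet_rep_exists:
  assumes p: "plot V n U p" and u0: "u0 \<in> U"
  shows "\<exists>N k al j m b. u0 \<in> N \<and> N \<subseteq> U \<and> jet_rep n N p k al j m b"
proof -
  have U: "eopen n U" by (rule plot_domain[OF p])
  have V0: "0 \<in> points V" by (rule subspace_0[OF points_subspace])
  \<comment> \<open>the family \<open>r p(u)\<close>, where the coordinate \<open>n\<close> of \<open>w\<close> is the parameter \<open>r\<close>\<close>
  define q where "q w = 0 + w n *\<^sub>R p (w(n := 0))" for w :: rvec
  have q: "plot V (Suc n) (cylinder n U) q" unfolding q_def by (rule plot_cylinder[OF p V0])
  have uC: "u0 \<in> cylinder n U" by (rule subsetD[OF cylinder_subset[OF U] u0])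
  obtain M k a j x where M: "u0 \<in> M" "M \<subseteq> cylinder n U" "smooth_terms V (Suc n) M k a j x"
      "\<And>v. v \<in> M \<Longrightarrow> s (q v) = formal_sum k a j x v"
    using free_space_plotD[OF smooth_map_plot[OF s_smooth q] uC] by metis
  have oM: "eopen (Suc n) M" using M(3) by (simp add: smooth_terms_def)
  define N where "N = {u\<in>M. u n = 0}"
  have N: "eopen n N" unfolding N_def by (rule slice_open[OF oM])
  have NU: "N \<subseteq> U"
  proof
    fix u assume u: "u \<in> N"
    then have "u(n := 0) = u" by (auto simp: N_def fun_eq_iff)
    then show "u \<in> U" using u M(2) by (auto simp: N_def cylinder_def)
  qed
  have u0N: "u0 \<in> N" using M(1) eopen_zero[OF U u0] by (simp add: N_def)
  have NM: "u \<in> N \<Longrightarrow> u \<in> M" for u by (simp add: N_def)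
  have Nn: "u \<in> N \<Longrightarrow> u n = 0" for u by (simp add: N_def)
  have jv: "valid V (j i)" and as: "smooth_fun_on (Suc n) M (a i)"
    and xs: "smooth_euclidean (Suc n) M (idim (j i)) (idom (j i)) (x i)" if "i < k" for i
    using M(3) that by (simp_all add: smooth_terms_def)
  have xz: "x i w c = 0" if "i < k" "w \<in> M" "c \<ge> idim (j i)" for i w c
  proof -
    have "x i w \<in> idom (j i)" "eopen (idim (j i)) (idom (j i))" using xs[OF that(1)] that(2) by (auto simp: smooth_euclidean_def)
    then show ?thesis using eopen_zero that(3) by blast
  qed
  have xc: "smooth_fun_on (Suc n) M (\<lambda>w. x i w c)" if i: "i < k" for i c
  proof (cases "c < idim (j i)")
    case True then show ?thesis using xs[OF i] by (simp add: smooth_euclidean_def)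
  next
    case False
    show ?thesis by (rule smooth_cong[OF smooth_const[OF oM, of 0]]) (use xz[OF i] False in auto)
  qed
  define b where "b i c u = a i u * pd n (\<lambda>w. x i w c) u" for i c u
  have chain: "pd n (\<lambda>w. g (x i w)) u = (\<Sum>c<idim (j i). pd c g (x i u) * pd n (\<lambda>w. x i w c) u)"
    if "i < k" "u \<in> N" "smooth_fun_on (idim (j i)) (idom (j i)) g" for i u g
    by (rule pd_compose[OF that(3) xs[OF that(1)] _ NM[OF that(2)]]) simp
  have "jet_rep n N p k (\<lambda>i. pd n (a i)) j x b"
    unfolding jet_rep_def
  proof (intro conjI allI impI ballI N)
    fix i assume i: "i < k"
    show "valid V (j i)" by (rule jv[OF i])
    show "smooth_fun_on n N (pd n (a i))" unfolding N_def by (rule smooth_slice[OF smooth_pd[OF as[OF i]]]) simp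
    show "smooth_euclidean n N (idim (j i)) (idom (j i)) (x i)" unfolding N_def
      by (rule smooth_euclidean_slice[OF xs[OF i]])
    show "smooth_fun_on n N (b i c)" for c unfolding N_def b_def
      by (rule smooth_slice[OF smooth_mult[OF as[OF i] smooth_pd[OF xc[OF i]]]]) simp
    show "b i c u = 0" if "c \<ge> idim (j i)" "u \<in> N" for c u
    proof -
      have "pd n (\<lambda>w. x i w c) u = pd n (\<lambda>w. 0) u"
        by (rule pd_cong[OF oM NM[OF that(2)]]) (use xz[OF i _ that(1)] in auto)
      then show ?thesis by (simp add: b_def pd_const)
    qed
  next
    fix u f assume u: "u \<in> N" and f: "smooth_test V f"
    have fs: "smooth_fun_on (idim (j i)) (idom (j i)) (\<lambda>z. f (j i, z))" if "i < k" for i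
      by (rule smooth_testD[OF f jv[OF that]])
    have fx: "smooth_fun_on (Suc n) M (\<lambda>w. f (j i, x i w))" if "i < k" for i
      using smooth_euclidean_compose_fun[OF xs[OF that] fs[OF that]] .
    have "dirderiv (\<lambda>v. ev f (s v)) 0 (p u) = pd n (\<lambda>w. ev f (s (q w))) u"
      unfolding q_def by (rule dirderiv_eq_pd[OF p]) (use u NU in blast)
    also have "\<dots> = pd n (\<lambda>w. \<Sum>i<k. a i w * f (j i, x i w)) u"
      by (rule pd_cong[OF oM NM[OF u]]) (simp_all add: M(4) ev_formal_sum)
    also have "\<dots> = (\<Sum>i<k. pd n (\<lambda>w. a i w * f (j i, x i w)) u)"
      by (rule pd_sum[OF smooth_mult[OF as fx] _ NM[OF u]]) auto
    also have "\<dots> = (\<Sum>i<k. pd n (a i) u * f (j i, x i u) + (\<Sum>c<idim (j i). b i c u * pd c (\<lambda>z. f (j i, z)) (x i u)))"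
    proof (rule sum.cong[OF refl])
      fix i assume "i \<in> {..<k}"
      then have i: "i < k" by simp
      have "pd n (\<lambda>w. a i w * f (j i, x i w)) u = pd n (a i) u * f (j i, x i u) + a i u * pd n (\<lambda>w. f (j i, x i w)) u"
        by (rule pd_mult[OF as[OF i] fx[OF i] _ NM[OF u]]) simp
      also have "pd n (\<lambda>w. f (j i, x i w)) u = (\<Sum>c<idim (j i). pd c (\<lambda>z. f (j i, z)) (x i u) * pd n (\<lambda>w. x i w c) u)"
        by (rule chain[OF i u fs[OF i]])
      finally show "pd n (\<lambda>w. a i w * f (j i, x i w)) u
        = pd n (a i) u * f (j i, x i u) + (\<Sum>c<idim (j i). b i c u * pd c (\<lambda>z. f (j i, z)) (x i u))"
        by (simp add: b_def sum_distrib_left mult_ac)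
    qed
    finally show "dirderiv (\<lambda>v. ev f (s v)) 0 (p u) = (\<Sum>i<k. pd n (a i) u * f (j i, x i u)
      + (\<Sum>c<idim (j i). b i c u * pd c (\<lambda>z. f (j i, z)) (x i u)))" .
  next
    fix u l assume u: "u \<in> N" and lin: "lin_on V l" and ls: "smooth_real V l"
    have un: "u n = 0" by (rule Nn[OF u])
    have pu: "p u \<in> points V" using plot_in[OF p] u NU by blast
    have gs: "smooth_fun_on (idim (j i)) (idom (j i)) (\<lambda>z. l (imap (j i) z))" if "i < k" for i
      using ls jv[OF that] by (simp add: valid_def)
    define H where "H i w = l (imap (j i) (x i w))" for i w
    have Hs: "smooth_fun_on (Suc n) M (H i)" if "i < k" for i
      unfolding H_def using smooth_euclidean_compose_fun[OF xs[OF that] gs[OF that]] .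
    define Y where "Y = insert 0 ((\<lambda>i. H i u) ` {..<k})"
    obtain e where e: "e > 0" "\<And>y z. y \<in> Y \<Longrightarrow> z \<in> Y \<Longrightarrow> \<bar>y - z\<bar> < 2 * e \<Longrightarrow> y = z"
    proof -
      have "finite Y" by (simp add: Y_def)
      then show ?thesis using finite_separation[of Y] that by blast
    qed
    \<comment> \<open>the offset from the nearby member of \<open>Y\<close>, which is unique by the choice of \<open>e\<close>; near \<open>0 \<in> Y\<close> this is the identity\<close>
    define \<theta> where "\<theta> y = (if \<exists>y0\<in>Y. \<bar>y - y0\<bar> < e then y - (SOME y0. y0 \<in> Y \<and> \<bar>y - y0\<bar> < e) else 0)" for y
    have \<theta>: "\<theta> y = y - y0" if "y0 \<in> Y" "\<bar>y - y0\<bar> < e" for y y0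
    proof -
      define z where "z = (SOME y0. y0 \<in> Y \<and> \<bar>y - y0\<bar> < e)"
      have "z \<in> Y \<and> \<bar>y - z\<bar> < e" unfolding z_def by (rule someI[of _ y0]) (use that in simp)
      then have "z = y0" using e(2)[of z y0] that by auto
      then show ?thesis using that unfolding \<theta>_def z_def by auto
    qed
    have upd: "\<forall>\<^sub>F r in nhds 0. u(n := r) \<in> M"
      using eventually_update_in[OF oM NM[OF u], of n] un by simp
    have cont: "\<forall>\<^sub>F r in nhds 0. \<forall>i\<in>{..<k}. \<bar>H i (u(n := r)) - H i u\<bar> < e"
    proof (rule eventually_ball_finite)
      show "\<forall>i\<in>{..<k}. \<forall>\<^sub>F r in nhds 0. \<bar>H i (u(n := r)) - H i u\<bar> < e"
      proof
        fix i assume i: "i \<in> {..<k}"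
        have "((\<lambda>r. H i (u(n := r))) has_real_derivative pd n (H i) u) (at 0)"
          using smooth_has_pd[OF Hs _ NM[OF u], of i n] i un by simp
        then have "isCont (\<lambda>r. H i (u(n := r))) 0" by (rule DERIV_isCont)
        then have "((\<lambda>r. H i (u(n := r))) \<longlongrightarrow> H i (u(n := 0))) (nhds 0)"
          unfolding isCont_def by (rule iffD1[OF tendsto_at_iff_tendsto_nhds])
        moreover have "u(n := 0) = u" using un by (auto simp: fun_eq_iff)
        ultimately show "\<forall>\<^sub>F r in nhds 0. \<bar>H i (u(n := r)) - H i u\<bar> < e"
          using e(1) by (simp add: tendsto_iff dist_real_def)
      qed
    qed simp
    have small: "\<forall>\<^sub>F r in nhds 0. \<bar>r * l (p u)\<bar> < e"
    proof -
      have "((\<lambda>r. r * l (p u)) \<longlongrightarrow> 0 * l (p u)) (nhds 0)" by (intro tendsto_mult tendsto_const filterlim_ident)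
      then show ?thesis using e(1) by (simp add: tendsto_iff dist_real_def)
    qed
    have ev_eq: "\<forall>\<^sub>F r in nhds 0. (\<Sum>i<k. a i (u(n := r)) * (H i (u(n := r)) - H i u)) = r * l (p u)"
      using upd cont small
    proof eventually_elim
      case (elim r)
      have "(u(n := r))(n := 0) = u" using un by (auto simp: fun_eq_iff)
      then have qr: "q (u(n := r)) = r *\<^sub>R p u" by (simp add: q_def)
      have "l (r *\<^sub>R p u) = r * l (p u)" using lin pu by (simp add: lin_on_def)
      then have "r * l (p u) = \<theta> (l (r *\<^sub>R p u))" using \<theta>[of 0 "r * l (p u)"] elim(3) by (simp add: Y_def)
      also have "\<dots> = ev ((\<theta> \<circ> l) \<circ> plot_value) (s (q (u(n := r))))"
        using s_ev[of "r *\<^sub>R p u" "\<theta> \<circ> l"] subspace_scale[OF points_subspace pu] qr by simp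
      also have "\<dots> = (\<Sum>i<k. a i (u(n := r)) * \<theta> (H i (u(n := r))))"
        using M(4)[OF elim(1)] by (simp add: ev_formal_sum H_def plot_value_def)
      also have "\<dots> = (\<Sum>i<k. a i (u(n := r)) * (H i (u(n := r)) - H i u))"
      proof (rule sum.cong[OF refl])
        fix i assume "i \<in> {..<k}"
        then have "\<theta> (H i (u(n := r))) = H i (u(n := r)) - H i u" using elim(2) by (intro \<theta>) (auto simp: Y_def)
        then show "a i (u(n := r)) * \<theta> (H i (u(n := r))) = a i (u(n := r)) * (H i (u(n := r)) - H i u)" by simp
      qed
      finally show ?case by simp
    qed
    define L where "L w = (\<Sum>i<k. a i w * (H i w - H i u))" for w
    have trm: "smooth_fun_on (Suc n) M (\<lambda>w. a i w * (H i w - H i u))" if "i < k" for i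
      by (rule smooth_mult[OF as[OF that] smooth_diff[OF Hs[OF that] smooth_const[OF oM]]])
    have Ls: "smooth_fun_on (Suc n) M L" unfolding L_def by (rule smooth_sum[OF oM trm]) simp
    have "((\<lambda>r. L (u(n := r))) has_real_derivative pd n L u) (at 0)"
      using smooth_has_pd[OF Ls _ NM[OF u], of n] un by simp
    moreover have "\<forall>\<^sub>F r in nhds 0. L (u(n := r)) = r * l (p u)" using ev_eq by (simp add: L_def)
    from DERIV_cong_ev[OF refl this refl]
    have "((\<lambda>r. L (u(n := r))) has_real_derivative pd n L u) (at 0)
      = ((\<lambda>r. r * l (p u)) has_real_derivative pd n L u) (at 0)" .
    ultimately have "((\<lambda>r. r * l (p u)) has_real_derivative pd n L u) (at 0)" by simp
    moreover have "((\<lambda>r. r * l (p u)) has_real_derivative l (p u)) (at 0)" by (auto intro!: derivative_eq_intros)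
    ultimately have "l (p u) = pd n L u" by (rule DERIV_unique[symmetric])
    also have "\<dots> = (\<Sum>i<k. pd n (\<lambda>w. a i w * (H i w - H i u)) u)"
      unfolding L_def by (rule pd_sum[OF trm _ NM[OF u]]) auto
    also have "\<dots> = (\<Sum>i<k. \<Sum>c<idim (j i). b i c u * pd c (\<lambda>z. l (imap (j i) z)) (x i u))"
    proof (rule sum.cong[OF refl])
      fix i assume "i \<in> {..<k}"
      then have i: "i < k" by simp
      have "pd n (\<lambda>w. a i w * (H i w - H i u)) u = pd n (a i) u * (H i u - H i u) + a i u * pd n (\<lambda>w. H i w - H i u) u"
        by (rule pd_mult[OF as[OF i] smooth_diff[OF Hs[OF i] smooth_const[OF oM]] _ NM[OF u]]) simp
      also have "pd n (\<lambda>w. H i w - H i u) u = pd n (H i) u"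
        using pd_diff[OF Hs[OF i] smooth_const[OF oM] _ NM[OF u], of n] by (simp add: pd_const)
      also have "pd n (H i) u = (\<Sum>c<idim (j i). pd c (\<lambda>z. l (imap (j i) z)) (x i u) * pd n (\<lambda>w. x i w c) u)"
        unfolding H_def by (rule chain[OF i u gs[OF i]])
      finally show "pd n (\<lambda>w. a i w * (H i w - H i u)) u = (\<Sum>c<idim (j i). b i c u * pd c (\<lambda>z. l (imap (j i) z)) (x i u))"
        by (simp add: b_def sum_distrib_left mult_ac)
    qed
    finally show "l (p u) = (\<Sum>i<k. \<Sum>c<idim (j i). b i c u * pd c (\<lambda>z. l (imap (j i) z)) (x i u))" .
  qed
  then show ?thesis using u0N NU by blast
qed

end

section \<open>Dipole coefficients\<close>

lemma pd_vanish:
  assumes W: "eopen n W" and f: "\<And>z. z \<in> W \<Longrightarrow> f z = 0" and z: "z \<in> W" and c: "c < n"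
  shows "pd c f z = 0"
  using pd_cong[OF W z c, of f "\<lambda>_. 0"] f by (simp add: pd_const)

lemma far_open:
  assumes U: "eopen n U" shows "eopen n {z\<in>U. e < \<bar>z i - y\<bar>}"
  unfolding eopen_iff
proof (intro conjI ballI)
  show "{z\<in>U. e < \<bar>z i - y\<bar>} \<subseteq> {x. \<forall>i\<ge>n. x i = 0}" using U unfolding eopen_iff by blast
  fix x assume x: "x \<in> {z\<in>U. e < \<bar>z i - y\<bar>}"
  then obtain d where d: "d > 0" "ebox n x d \<subseteq> U" using eopen_ebox[OF U] by blast
  define r where "r = min d (\<bar>x i - y\<bar> - e)"
  have r: "r > 0" "r \<le> d" "r \<le> \<bar>x i - y\<bar> - e" using d x by (auto simp: r_def)
  have "ebox n x r \<subseteq> {z\<in>U. e < \<bar>z i - y\<bar>}"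
  proof
    fix z assume z: "z \<in> ebox n x r"
    then have zU: "z \<in> U" using d(2) ebox_mono[OF r(2)] by blast
    have "\<bar>z i - x i\<bar> < r"
    proof (cases "i < n")
      case False
      then have "z i = 0" "x i = 0" using eopen_zero[OF U, of _ i] zU x by auto
      then show ?thesis using r by simp
    qed (use z in \<open>simp add: ebox_def\<close>)
    then show "z \<in> {z\<in>U. e < \<bar>z i - y\<bar>}" using zU r(3) by auto
  qed
  then show "\<exists>e'>0. ebox n x e' \<subseteq> {z\<in>U. e < \<bar>z i - y\<bar>}" using r(1) by blast
qed

lemma separating_radius:
  assumes "finite Z" and Z: "\<And>z i. z \<in> Z \<Longrightarrow> i \<ge> n \<Longrightarrow> z i = 0" and y: "\<And>i. i \<ge> n \<Longrightarrow> (y :: rvec) i = 0"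
  shows "\<exists>r>0. \<forall>z\<in>Z. z \<noteq> y \<longrightarrow> (\<exists>i<n. r < \<bar>z i - y i\<bar>)"
  using assms(1) Z
proof (induction Z rule: finite_induct)
  case empty then show ?case by (intro exI[of _ 1]) simp
next
  case (insert z Z)
  then obtain r where r: "r > 0" "\<forall>z\<in>Z. z \<noteq> y \<longrightarrow> (\<exists>i<n. r < \<bar>z i - y i\<bar>)" by auto
  show ?case
  proof (cases "z = y")
    case True then show ?thesis using r by auto
  next
    case False
    then obtain i where "z i \<noteq> y i" by (auto simp: fun_eq_iff)
    then have "\<not> n \<le> i" using insert.prems[of z i] y[of i] by auto
    then have i: "i < n" "\<bar>z i - y i\<bar> > 0" using \<open>z i \<noteq> y i\<close> by auto
    define r' where "r' = min r (\<bar>z i - y i\<bar> / 2)"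
    have r': "r' > 0" "r' \<le> r" "r' < \<bar>z i - y i\<bar>" unfolding r'_def using r(1) i(2) by (simp_all add: min_def)
    have "\<exists>i<n. r' < \<bar>w i - y i\<bar>" if "w \<in> insert z Z" "w \<noteq> y" for w
    proof (cases "w = z")
      case True then show ?thesis using i r' by blast
    next
      case False then show ?thesis using r(2) that r'(2) by (meson insertE le_less_trans)
    qed
    then show ?thesis using r'(1) by blast
  qed
qed

text \<open>
  A coordinate function around \<open>y\<close> on one plot, cut off by a bump.  Its value at \<open>y\<close> is \<open>0\<close> and its derivative
  at \<open>y\<close> is \<open>1\<close> in direction \<open>c\<close> and \<open>0\<close> in the others, so it detects the dipole in direction \<open>c\<close> at \<open>y\<close>.
\<close>

definition linear_test :: "'v idx \<Rightarrow> rvec \<Rightarrow> nat \<Rightarrow> real \<Rightarrow> 'v idx \<times> rvec \<Rightarrow> real" where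
  "linear_test j y c e k = (if fst k = j then (snd k c - y c) * bump (idim j) y e (snd k) else 0)"

definition bump_test :: "'v idx \<Rightarrow> rvec \<Rightarrow> real \<Rightarrow> 'v idx \<times> rvec \<Rightarrow> real" where
  "bump_test j y e k = (if fst k = j then bump (idim j) y e (snd k) else 0)"

lemma smooth_test_on_one_plot:
  assumes V: "diffeological_space V" and g: "valid V j \<Longrightarrow> smooth_fun_on (idim j) (idom j) g"
  shows "smooth_test V (\<lambda>k. if fst k = j then g (snd k) else 0)"
  unfolding smooth_test_def
proof (intro allI impI)
  fix i assume i: "valid V i"
  then have o: "eopen (idim i) (idom i)" using diffeological_space.plot_domain[OF V] unfolding valid_def by blast
  show "smooth_fun_on (idim i) (idom i) (\<lambda>z. if fst (i, z) = j then g (snd (i, z)) else 0)"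
  proof (cases "i = j")
    case True then show ?thesis using g i by simp
  next
    case False then show ?thesis using smooth_const[OF o] by simp
  qed
qed

lemma valid_open: "diffeological_space V \<Longrightarrow> valid V j \<Longrightarrow> eopen (idim j) (idom j)"
  using diffeological_space.plot_domain unfolding valid_def by blast

lemma linear_test_smooth: assumes V: "diffeological_space V" shows "smooth_test V (linear_test j y c e)"
proof -
  have "smooth_test V (\<lambda>k. if fst k = j then (snd k c - y c) * bump (idim j) y e (snd k) else 0)"
  proof (rule smooth_test_on_one_plot[OF V])
    assume "valid V j"
    note o = valid_open[OF V this]
    show "smooth_fun_on (idim j) (idom j) (\<lambda>z. (z c - y c) * bump (idim j) y e z)"
      by (rule smooth_mult[OF smooth_diff[OF smooth_coordinate[OF o] smooth_const[OF o]] bump_smooth[OF o]])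
  qed
  then show ?thesis unfolding linear_test_def[abs_def] .
qed

lemma bump_test_smooth: assumes V: "diffeological_space V" shows "smooth_test V (bump_test j y e)"
proof -
  have "smooth_test V (\<lambda>k. if fst k = j then bump (idim j) y e (snd k) else 0)"
    by (rule smooth_test_on_one_plot[OF V]) (rule bump_smooth[OF valid_open[OF V]])
  then show ?thesis unfolding bump_test_def[abs_def] .
qed

context plot_section
begin

lemma jet_repD:
  assumes "jet_rep n N p k al j m b"
  shows "eopen n N" "i < k \<Longrightarrow> valid V (j i)" "i < k \<Longrightarrow> smooth_fun_on n N (al i)"
    "i < k \<Longrightarrow> smooth_euclidean n N (idim (j i)) (idom (j i)) (m i)"
    "i < k \<Longrightarrow> smooth_fun_on n N (b i c)" "i < k \<Longrightarrow> c \<ge> idim (j i) \<Longrightarrow> u \<in> N \<Longrightarrow> b i c u = 0"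
    "i < k \<Longrightarrow> u \<in> N \<Longrightarrow> m i u \<in> idom (j i)" "i < k \<Longrightarrow> eopen (idim (j i)) (idom (j i))"
proof -
  have h: "i < k \<Longrightarrow> valid V (j i) \<and> smooth_fun_on n N (al i) \<and> smooth_euclidean n N (idim (j i)) (idom (j i)) (m i) \<and>
        (\<forall>c. smooth_fun_on n N (b i c)) \<and> (\<forall>c\<ge>idim (j i). \<forall>u\<in>N. b i c u = 0)"
    using assms unfolding jet_rep_def by blast
  show "eopen n N" using assms unfolding jet_rep_def by blast
  show "i < k \<Longrightarrow> valid V (j i)" "i < k \<Longrightarrow> smooth_fun_on n N (al i)"
    "i < k \<Longrightarrow> smooth_euclidean n N (idim (j i)) (idom (j i)) (m i)" "i < k \<Longrightarrow> smooth_fun_on n N (b i c)"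
    "i < k \<Longrightarrow> c \<ge> idim (j i) \<Longrightarrow> u \<in> N \<Longrightarrow> b i c u = 0" using h by blast+
  then show "i < k \<Longrightarrow> u \<in> N \<Longrightarrow> m i u \<in> idom (j i)" "i < k \<Longrightarrow> eopen (idim (j i)) (idom (j i))"
    unfolding smooth_euclidean_def by blast+
qed

lemma jet_rep_test:
  assumes "jet_rep n N p k al j m b" "u \<in> N" "smooth_test V f"
  shows "dirderiv (\<lambda>v. ev f (s v)) 0 (p u) =
        (\<Sum>i<k. al i u * f (j i, m i u) + (\<Sum>c<idim (j i). b i c u * pd c (\<lambda>z. f (j i, z)) (m i u)))"
  using assms unfolding jet_rep_def by blast

lemma jet_rep_linear:
  assumes "jet_rep n N p k al j m b" "u \<in> N" "lin_on V l" "smooth_real V l"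
  shows "l (p u) = (\<Sum>i<k. \<Sum>c<idim (j i). b i c u * pd c (\<lambda>z. l (imap (j i) z)) (m i u))"
  using assms unfolding jet_rep_def by blast

text \<open>
  The limit is one of an eventually constant sequence: only finitely many points occur in \<open>s\<close> near the zero
  vector in direction \<open>v\<close>, and the test functions shrink to a single point.  Defining the coefficient by test
  functions makes it independent of a choice of a local expression for \<open>s\<close>.
\<close>

definition dipole :: "'v \<Rightarrow> 'v idx \<times> rvec \<Rightarrow> nat \<Rightarrow> real" where
  "dipole v k c = (if valid V (fst k) \<and> snd k \<in> idom (fst k) \<and> c < idim (fst k)
     then lim (\<lambda>N. dirderiv (\<lambda>v. ev (linear_test (fst k) (snd k) c (inverse (real (Suc N)))) (s v)) 0 v) else 0)"

lemma dipole_zero: "\<not> (valid V (fst k) \<and> snd k \<in> idom (fst k) \<and> c < idim (fst k)) \<Longrightarrow> dipole v k c = 0"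
  unfolding dipole_def by (rule if_not_P)

text \<open>
  For small \<open>e\<close> the test function vanishes near all points of the jet that differ from \<open>(J, y)\<close>, and it kills the
  monopoles at \<open>(J, y)\<close> because its value there is \<open>0\<close>.
\<close>

lemma linear_test_value:
  assumes l: "jet_rep n N p k al j m b" and u: "u \<in> N" and v: "valid V J" and y: "y \<in> idom J" and c: "c < idim J"
  shows "\<exists>r>0. \<forall>e. 0 < e \<and> e \<le> r \<longrightarrow>
    dirderiv (\<lambda>v. ev (linear_test J y c e) (s v)) 0 (p u) = (\<Sum>i\<in>{i\<in>{..<k}. (j i, m i u) = (J, y)}. b i c u)"
proof -
  note o = valid_open[OF diffeological_space_axioms v]
  define Z where "Z = (\<lambda>i. m i u) ` {i\<in>{..<k}. j i = J}"
  have Z: "z \<in> idom J" if z: "z \<in> Z" for z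
  proof -
    obtain i where "i < k" "j i = J" "z = m i u" using z by (auto simp: Z_def)
    then show ?thesis using jet_repD(7)[OF l, of i u] u by simp
  qed
  have "finite Z" by (simp add: Z_def)
  then obtain r where r: "r > 0" "\<And>z. z \<in> Z \<Longrightarrow> z \<noteq> y \<Longrightarrow> \<exists>i<idim J. r < \<bar>z i - y i\<bar>"
    using separating_radius[of Z "idim J" y] eopen_zero[OF o] Z y by metis
  have "dirderiv (\<lambda>v. ev (linear_test J y c e) (s v)) 0 (p u) = (\<Sum>i\<in>{i\<in>{..<k}. (j i, m i u) = (J, y)}. b i c u)"
    if e: "0 < e" "e \<le> r" for e
  proof -
    let ?f = "linear_test J y c e"
    have "al i u * ?f (j i, m i u) + (\<Sum>c'<idim (j i). b i c' u * pd c' (\<lambda>z. ?f (j i, z)) (m i u))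
        = (if (j i, m i u) = (J, y) then b i c u else 0)" if i: "i < k" for i
    proof (cases "j i = J")
      case False
      then show ?thesis by (simp add: linear_test_def pd_const)
    next
      case True
      have fJ: "(\<lambda>z. ?f (j i, z)) = (\<lambda>z. (z c - y c) * bump (idim J) y e z)" by (simp add: linear_test_def True)
      show ?thesis
      proof (cases "m i u = y")
        case my: True
        have "pd c' (\<lambda>z. ?f (j i, z)) y = (if c' = c then 1 else 0)" if "c' < idim J" for c'
        proof -
          note sm = smooth_diff[OF smooth_coordinate[OF o] smooth_const[OF o]]
          have "pd c' (\<lambda>z. (z c - y c) * bump (idim J) y e z) y
              = pd c' (\<lambda>z. z c - y c) y * bump (idim J) y e y + (y c - y c) * pd c' (bump (idim J) y e) y"
            by (rule pd_mult[OF sm bump_smooth[OF o] that y])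
          also have "pd c' (\<lambda>z. z c - y c) y = pd c' (\<lambda>z. z c) y - pd c' (\<lambda>z. y c) y"
            by (rule pd_diff[OF smooth_coordinate[OF o] smooth_const[OF o] that y])
          finally show ?thesis unfolding fJ by (simp add: bump_center pd_coordinate pd_const)
        qed
        then have "(\<Sum>c'<idim (j i). b i c' u * pd c' (\<lambda>z. ?f (j i, z)) (m i u)) = (\<Sum>c'<idim J. if c' = c then b i c' u else 0)"
          unfolding True my by (intro sum.cong) auto
        also have "\<dots> = b i c u" using c by simp
        finally show ?thesis using True my by (simp add: linear_test_def)
      next
        case my: False
        have mZ: "m i u \<in> Z" using i True by (auto simp: Z_def)
        then obtain i' where i': "i' < idim J" "r < \<bar>m i u i' - y i'\<bar>" using r(2) my by blast
        let ?W = "{z\<in>idom J. e < \<bar>z i' - y i'\<bar>}"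
        have W: "m i u \<in> ?W" using Z[OF mZ] i' e by auto
        have f0: "?f (j i, z) = 0" if "z \<in> ?W" for z
          using bump_zero[OF i'(1), of e z y] that e by (simp add: linear_test_def)
        have "pd c' (\<lambda>z. ?f (j i, z)) (m i u) = 0" if "c' < idim J" for c'
          by (rule pd_vanish[OF far_open[OF o] f0 W that])
        then show ?thesis using f0[OF W] True my by simp
      qed
    qed
    then have "dirderiv (\<lambda>v. ev ?f (s v)) 0 (p u) = (\<Sum>i<k. if (j i, m i u) = (J, y) then b i c u else 0)"
      unfolding jet_rep_test[OF l u linear_test_smooth[OF diffeological_space_axioms]] by (intro sum.cong) auto
    also have "\<dots> = (\<Sum>i\<in>{i\<in>{..<k}. (j i, m i u) = (J, y)}. b i c u)" by (rule sum.inter_filter[symmetric]) simp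
    finally show ?thesis .
  qed
  then show ?thesis using r(1) by blast
qed

lemma linear_test_eventually:
  assumes l: "jet_rep n N p k al j m b" and u: "u \<in> N" and v: "valid V J" and y: "y \<in> idom J" and c: "c < idim J"
  shows "\<forall>\<^sub>F N in sequentially. dirderiv (\<lambda>v. ev (linear_test J y c (inverse (real (Suc N)))) (s v)) 0 (p u)
     = (\<Sum>i\<in>{i\<in>{..<k}. (j i, m i u) = (J, y)}. b i c u)"
proof -
  obtain r where r: "r > 0" "\<And>e. 0 < e \<and> e \<le> r \<Longrightarrow>
    dirderiv (\<lambda>v. ev (linear_test J y c e) (s v)) 0 (p u) = (\<Sum>i\<in>{i\<in>{..<k}. (j i, m i u) = (J, y)}. b i c u)"
    using linear_test_value[OF assms] by blast
  have "\<forall>\<^sub>F N in sequentially. inverse (real (Suc N)) < r"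
    using LIMSEQ_inverse_real_of_nat r(1) by (rule order_tendstoD(2))
  then show ?thesis by eventually_elim (rule r(2), simp)
qed

text \<open>
  Several terms of the jet may sit at the same point; their dipoles add up.
\<close>

lemma dipole_jet_rep:
  assumes l: "jet_rep n N p k al j m b" and u: "u \<in> N"
  shows "dipole (p u) \<kappa> c = (\<Sum>i\<in>{i\<in>{..<k}. (j i, m i u) = \<kappa>}. b i c u)"
proof (cases "valid V (fst \<kappa>) \<and> snd \<kappa> \<in> idom (fst \<kappa>) \<and> c < idim (fst \<kappa>)")
  case True
  then have "\<forall>\<^sub>F N in sequentially. dirderiv (\<lambda>v. ev (linear_test (fst \<kappa>) (snd \<kappa>) c (inverse (real (Suc N)))) (s v)) 0 (p u)
     = (\<Sum>i\<in>{i\<in>{..<k}. (j i, m i u) = \<kappa>}. b i c u)"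
    using linear_test_eventually[OF l u, of "fst \<kappa>" "snd \<kappa>" c] by simp
  from limI[OF tendsto_eventually[OF this]] show ?thesis using True by (simp add: dipole_def)
next
  case False
  have "b i c u = 0" if "i < k" "(j i, m i u) = \<kappa>" for i
    using False that jet_repD(2)[OF l that(1)] jet_repD(6)[OF l that(1) _ u] jet_repD(7)[OF l that(1) u] by (auto simp: not_less)
  then have "(\<Sum>i\<in>{i\<in>{..<k}. (j i, m i u) = \<kappa>}. b i c u) = 0" by (intro sum.neutral) auto
  then show ?thesis using dipole_zero[OF False] by simp
qed

lemma vector_jet_rep:
  assumes "v \<in> points V"
  obtains N k al j m b where "(\<lambda>_. 0) \<in> N" "jet_rep 0 N (\<lambda>_. v) k al j m b"
  using jet_rep_exists[OF plot_const[OF eopen_UNIV[of 0] assms], of "\<lambda>_. 0"] by auto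

lemma dipole_eventually:
  assumes v: "v \<in> points V" and k: "valid V (fst \<kappa>)" "snd \<kappa> \<in> idom (fst \<kappa>)" "c < idim (fst \<kappa>)"
  shows "\<forall>\<^sub>F N in sequentially. dirderiv (\<lambda>v. ev (linear_test (fst \<kappa>) (snd \<kappa>) c (inverse (real (Suc N)))) (s v)) 0 v = dipole v \<kappa> c"
proof -
  obtain N k al j m b where l: "(\<lambda>_. 0) \<in> N" "jet_rep 0 N (\<lambda>_. v) k al j m b" using vector_jet_rep[OF v] .
  show ?thesis using linear_test_eventually[OF l(2,1) k] dipole_jet_rep[OF l(2,1), of \<kappa> c] by simp
qed

lemma dirderiv_ev_section_linear: "smooth_test V f \<Longrightarrow> lin_on V (dirderiv (\<lambda>v. ev f (s v)) 0)"
  using dirderiv_linear[OF ev_section_smooth] subspace_0[OF points_subspace] by blast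

text \<open>
  Both sides are eventually given by one and the same directional derivative at \<open>0\<close>, which is linear.
\<close>

lemma dipole_add: assumes v: "v \<in> points V" and w: "w \<in> points V" shows "dipole (v + w) \<kappa> c = dipole v \<kappa> c + dipole w \<kappa> c"
proof (cases "valid V (fst \<kappa>) \<and> snd \<kappa> \<in> idom (fst \<kappa>) \<and> c < idim (fst \<kappa>)")
  case True
  then have k: "valid V (fst \<kappa>)" "snd \<kappa> \<in> idom (fst \<kappa>)" "c < idim (fst \<kappa>)" by auto
  have vw: "v + w \<in> points V" using subspace_add[OF points_subspace v w] .
  have "\<forall>\<^sub>F N in sequentially. dipole (v + w) \<kappa> c = dipole v \<kappa> c + dipole w \<kappa> c"
    using dipole_eventually[OF v k] dipole_eventually[OF w k] dipole_eventually[OF vw k]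
  proof eventually_elim
    case (elim N)
    have "lin_on V (dirderiv (\<lambda>v. ev (linear_test (fst \<kappa>) (snd \<kappa>) c (inverse (real (Suc N)))) (s v)) 0)"
      by (rule dirderiv_ev_section_linear[OF linear_test_smooth[OF diffeological_space_axioms]])
    then show ?case using elim v w unfolding lin_on_def by metis
  qed
  then show ?thesis by simp
next
  case False
  show ?thesis unfolding dipole_zero[OF False] by simp
qed

lemma dipole_scale: assumes v: "v \<in> points V" shows "dipole (r *\<^sub>R v) \<kappa> c = r * dipole v \<kappa> c"
proof (cases "valid V (fst \<kappa>) \<and> snd \<kappa> \<in> idom (fst \<kappa>) \<and> c < idim (fst \<kappa>)")
  case True
  then have k: "valid V (fst \<kappa>)" "snd \<kappa> \<in> idom (fst \<kappa>)" "c < idim (fst \<kappa>)" by auto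
  have rv: "r *\<^sub>R v \<in> points V" using subspace_scale[OF points_subspace v] .
  have "\<forall>\<^sub>F N in sequentially. dipole (r *\<^sub>R v) \<kappa> c = r * dipole v \<kappa> c"
    using dipole_eventually[OF v k] dipole_eventually[OF rv k]
  proof eventually_elim
    case (elim N)
    have "lin_on V (dirderiv (\<lambda>v. ev (linear_test (fst \<kappa>) (snd \<kappa>) c (inverse (real (Suc N)))) (s v)) 0)"
      by (rule dirderiv_ev_section_linear[OF linear_test_smooth[OF diffeological_space_axioms]])
    then show ?case using elim v unfolding lin_on_def by metis
  qed
  then show ?thesis by simp
next
  case False
  show ?thesis unfolding dipole_zero[OF False] by simp
qed

definition dipole_support :: "'v \<Rightarrow> ('v idx \<times> rvec) set" where
  "dipole_support v = {\<kappa>. \<exists>c. dipole v \<kappa> c \<noteq> 0}"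

lemma dipole_support_jet_rep:
  assumes l: "jet_rep n N p k al j m b" and u: "u \<in> N"
  shows "dipole_support (p u) \<subseteq> (\<lambda>i. (j i, m i u)) ` {..<k}"
proof
  fix \<kappa> assume "\<kappa> \<in> dipole_support (p u)"
  then obtain c where "(\<Sum>i\<in>{i\<in>{..<k}. (j i, m i u) = \<kappa>}. b i c u) \<noteq> 0"
    unfolding dipole_support_def dipole_jet_rep[OF l u] by blast
  then have "{i\<in>{..<k}. (j i, m i u) = \<kappa>} \<noteq> {}" by (metis sum.empty)
  then show "\<kappa> \<in> (\<lambda>i. (j i, m i u)) ` {..<k}" by auto
qed

lemma dipole_support_finite: assumes v: "v \<in> points V" shows "finite (dipole_support v)"
proof -
  obtain N k al j m b where l: "(\<lambda>_. 0) \<in> N" "jet_rep 0 N (\<lambda>_. v) k al j m b" using vector_jet_rep[OF v] .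
  show ?thesis by (rule finite_subset[OF dipole_support_jet_rep[OF l(2,1)]]) simp
qed

text \<open>
  For smooth \<open>\<xi>\<close> this is a smooth linear functional on \<open>V\<close>.  Bump functions \<open>\<xi>\<close> single out individual dipole
  coefficients, which need not be smooth by themselves.
\<close>

definition dipole_sum :: "('v idx \<times> rvec \<Rightarrow> real) \<Rightarrow> nat \<Rightarrow> 'v \<Rightarrow> real" where
  "dipole_sum \<xi> c v = (\<Sum>\<kappa>\<in>dipole_support v. dipole v \<kappa> c * \<xi> \<kappa>)"

lemma dipole_sum_superset: "finite P \<Longrightarrow> dipole_support v \<subseteq> P \<Longrightarrow> dipole_sum \<xi> c v = (\<Sum>\<kappa>\<in>P. dipole v \<kappa> c * \<xi> \<kappa>)"
  unfolding dipole_sum_def by (rule sum.mono_neutral_left) (auto simp: dipole_support_def)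

lemma dipole_sum_jet_rep:
  assumes l: "jet_rep n N p k al j m b" and u: "u \<in> N"
  shows "dipole_sum \<xi> c (p u) = (\<Sum>i<k. b i c u * \<xi> (j i, m i u))"
proof -
  let ?h = "\<lambda>i. (j i, m i u)"
  have "dipole_sum \<xi> c (p u) = (\<Sum>\<kappa>\<in>?h ` {..<k}. dipole (p u) \<kappa> c * \<xi> \<kappa>)"
    by (rule dipole_sum_superset[OF _ dipole_support_jet_rep[OF l u]]) simp
  also have "\<dots> = (\<Sum>\<kappa>\<in>?h ` {..<k}. \<Sum>i\<in>{i\<in>{..<k}. ?h i = \<kappa>}. b i c u * \<xi> (?h i))"
    unfolding dipole_jet_rep[OF l u] sum_distrib_right by (intro sum.cong) auto
  also have "\<dots> = (\<Sum>i<k. b i c u * \<xi> (?h i))" by (rule sum.image_gen[symmetric]) simp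
  finally show ?thesis .
qed

lemma dipole_sum_linear: "lin_on V (dipole_sum \<xi> c)"
  unfolding lin_on_def
proof (intro conjI ballI allI)
  fix v w assume v: "v \<in> points V" and w: "w \<in> points V"
  let ?P = "dipole_support v \<union> dipole_support w"
  have P: "finite ?P" using dipole_support_finite v w by simp
  have "dipole_support (v + w) \<subseteq> ?P" using dipole_add[OF v w] by (fastforce simp: dipole_support_def)
  from dipole_sum_superset[OF P this] dipole_sum_superset[OF P, of v] dipole_sum_superset[OF P, of w]
  show "dipole_sum \<xi> c (v + w) = dipole_sum \<xi> c v + dipole_sum \<xi> c w"
    using dipole_add[OF v w] by (simp add: distrib_right sum.distrib)
next
  fix r v assume v: "v \<in> points V"
  have "dipole_support (r *\<^sub>R v) \<subseteq> dipole_support v" using dipole_scale[OF v] by (fastforce simp: dipole_support_def)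
  from dipole_sum_superset[OF dipole_support_finite[OF v] this]
  show "dipole_sum \<xi> c (r *\<^sub>R v) = r * dipole_sum \<xi> c v"
    using dipole_scale[OF v] by (simp add: dipole_sum_def sum_distrib_left mult.assoc)
qed

lemma dipole_sum_smooth: assumes \<xi>: "smooth_test V \<xi>" shows "smooth_real V (dipole_sum \<xi> c)"
proof (intro allI impI)
  fix n U p assume p: "plot V n U p"
  show "smooth_fun_on n U (\<lambda>u. dipole_sum \<xi> c (p u))"
  proof (rule smooth_local[OF plot_domain[OF p]])
    fix u assume u: "u \<in> U"
    from jet_rep_exists[OF p u] obtain N k al j m b where N: "u \<in> N" "N \<subseteq> U" and l: "jet_rep n N p k al j m b"
      by (elim exE conjE)
    have "smooth_fun_on n N (\<lambda>u. b i c u * \<xi> (j i, m i u))" if i: "i < k" for i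
      by (rule smooth_mult[OF jet_repD(5)[OF l i]
            smooth_euclidean_compose_fun[OF jet_repD(4)[OF l i] smooth_testD[OF \<xi> jet_repD(2)[OF l i]]]])
    then have "smooth_fun_on n N (\<lambda>u. \<Sum>i<k. b i c u * \<xi> (j i, m i u))"
      by (intro smooth_sum[OF jet_repD(1)[OF l]]) auto
    then have "smooth_fun_on n N (\<lambda>u. dipole_sum \<xi> c (p u))"
      by (rule smooth_cong) (rule dipole_sum_jet_rep[OF l, symmetric])
    then show "\<exists>N. eopen n N \<and> u \<in> N \<and> N \<subseteq> U \<and> smooth_fun_on n N (\<lambda>u. dipole_sum \<xi> c (p u))"
      using N jet_repD(1)[OF l] by (intro exI[of _ N] conjI)
  qed
qed

text \<open>
  The last clause of the jet of the constant plot \<open>v\<close>, with the terms grouped by their points.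
\<close>

lemma linear_by_dipoles:
  assumes v: "v \<in> points V" and l: "lin_on V l" "smooth_real V l" and P: "finite P" "dipole_support v \<subseteq> P"
  shows "l v = (\<Sum>\<kappa>\<in>P. \<Sum>c<idim (fst \<kappa>). dipole v \<kappa> c * pd c (\<lambda>z. l (imap (fst \<kappa>) z)) (snd \<kappa>))"
proof -
  obtain N k al j m b where L: "(\<lambda>_. 0) \<in> N" "jet_rep 0 N (\<lambda>_. v) k al j m b" using vector_jet_rep[OF v] .
  let ?u = "(\<lambda>_. 0) :: rvec"
  let ?h = "\<lambda>i. (j i, m i ?u)"
  let ?g = "\<lambda>\<kappa> c. pd c (\<lambda>z. l (imap (fst \<kappa>) z)) (snd \<kappa>)"
  let ?T = "\<lambda>\<kappa>. \<Sum>c<idim (fst \<kappa>). dipole v \<kappa> c * ?g \<kappa> c"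
  have zero: "?T \<kappa> = 0" if "\<kappa> \<notin> dipole_support v" for \<kappa> using that by (simp add: dipole_support_def)
  have "l v = (\<Sum>i<k. \<Sum>c<idim (j i). b i c ?u * ?g (?h i) c)"
    using jet_rep_linear[OF L(2,1) l] by simp
  also have "\<dots> = (\<Sum>\<kappa>\<in>?h ` {..<k}. \<Sum>i\<in>{i\<in>{..<k}. ?h i = \<kappa>}. \<Sum>c<idim (j i). b i c ?u * ?g (?h i) c)"
    by (rule sum.image_gen) simp
  also have "\<dots> = (\<Sum>\<kappa>\<in>?h ` {..<k}. ?T \<kappa>)"
  proof (rule sum.cong[OF refl])
    fix \<kappa> assume "\<kappa> \<in> ?h ` {..<k}"
    have "(\<Sum>i\<in>{i\<in>{..<k}. ?h i = \<kappa>}. \<Sum>c<idim (j i). b i c ?u * ?g (?h i) c)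
        = (\<Sum>i\<in>{i\<in>{..<k}. ?h i = \<kappa>}. \<Sum>c<idim (fst \<kappa>). b i c ?u * ?g \<kappa> c)"
      by (intro sum.cong) auto
    also have "\<dots> = (\<Sum>c<idim (fst \<kappa>). \<Sum>i\<in>{i\<in>{..<k}. ?h i = \<kappa>}. b i c ?u * ?g \<kappa> c)" by (rule sum.swap)
    also have "\<dots> = ?T \<kappa>" using dipole_jet_rep[OF L(2,1), of \<kappa>] by (simp add: sum_distrib_right)
    finally show "(\<Sum>i\<in>{i\<in>{..<k}. ?h i = \<kappa>}. \<Sum>c<idim (j i). b i c ?u * ?g (?h i) c) = ?T \<kappa>" .
  qed
  also have "\<dots> = (\<Sum>\<kappa>\<in>dipole_support v. ?T \<kappa>)"
    by (rule sum.mono_neutral_right) (use dipole_support_jet_rep[OF L(2,1)] zero in auto)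
  also have "\<dots> = (\<Sum>\<kappa>\<in>P. ?T \<kappa>)" by (rule sum.mono_neutral_left) (use P zero in auto)
  finally show ?thesis .
qed

text \<open>
  If \<open>v \<noteq> 0\<close> then \<open>s v \<noteq> s 0\<close>, since the two evaluate to different points, and some bump function \<open>f\<close> at one
  point of their difference separates them.  By the mean value theorem the directional derivative of
  \<open>ev f \<circ> s\<close> at some multiple of \<open>v\<close> is non-zero on \<open>v\<close>.  But it is a smooth linear functional, which vanishes on
  vectors without dipoles.
\<close>

lemma dipole_injective:
  assumes v: "v \<in> points V" and z: "dipole_support v = {}"
  shows "v = 0"
proof (rule ccontr)
  assume v0: "v \<noteq> 0"
  have V0: "0 \<in> points V" by (rule subspace_0[OF points_subspace])
  \<comment> \<open>\<open>s 0\<close> evaluates to \<open>[0]\<close>; it need not be the zero formal sum\<close>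
  define w where "w = s v - s 0"
  have "ev ((\<lambda>x. if x = v then 1 else 0) \<circ> plot_value) w = 1"
    using s_ev[OF v, of "\<lambda>x. if x = v then 1 else 0"] s_ev[OF V0, of "\<lambda>x. if x = v then 1 else 0"] v0
    by (simp add: w_def ev_diff)
  then have "w \<noteq> 0" by (metis ev_zero zero_neq_one)
  then obtain \<kappa> where \<kappa>: "Poly_Mapping.lookup w \<kappa> \<noteq> 0" by (metis lookup_zero poly_mapping_eqI)
  have wF: "w \<in> points (free_space V)" unfolding w_def
    by (rule subspace_diff[OF free_space_subspace smooth_map_point[OF s_smooth v] smooth_map_point[OF s_smooth V0]])
  obtain J y where Jy: "\<kappa> = (J, y)" by (cases \<kappa>)
  have kk: "valid V (fst k)" "snd k \<in> idom (fst k)" if "k \<in> Poly_Mapping.keys w" for k using wF that by (auto simp: free_space_def)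
  have J: "valid V J" "y \<in> idom J" using kk[of \<kappa>] \<kappa> by (auto simp: Jy in_keys_iff)
  note o = valid_open[OF diffeological_space_axioms J(1)]
  define Z where "Z = snd ` {k\<in>Poly_Mapping.keys w. fst k = J}"
  have Z: "z \<in> idom J" if "z \<in> Z" for z using kk that by (auto simp: Z_def)
  have "finite Z" by (simp add: Z_def)
  then obtain r where r: "r > 0" "\<And>z. z \<in> Z \<Longrightarrow> z \<noteq> y \<Longrightarrow> \<exists>i<idim J. r < \<bar>z i - y i\<bar>"
    using separating_radius[of Z "idim J" y] eopen_zero[OF o] Z J(2) by metis
  let ?f = "bump_test J y r"
  have f: "smooth_test V ?f" by (rule bump_test_smooth[OF diffeological_space_axioms])
  have f0: "?f k = (if k = \<kappa> then 1 else 0)" if "k \<in> Poly_Mapping.keys w" for k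
  proof (cases "fst k = J \<and> snd k \<noteq> y")
    case True
    then have "snd k \<in> Z" unfolding Z_def using that by blast
    then obtain i where "i < idim J" "r < \<bar>snd k i - y i\<bar>" using r(2)[of "snd k"] True by blast
    then have "bump (idim J) y r (snd k) = 0" using bump_zero[of i "idim J" r "snd k" y] r(1) by simp
    then show ?thesis using True by (cases k) (simp add: bump_test_def Jy)
  next
    case False then show ?thesis by (cases k) (auto simp: bump_test_def Jy bump_center)
  qed
  have "ev ?f w = (\<Sum>k\<in>Poly_Mapping.keys w. if k = \<kappa> then Poly_Mapping.lookup w k else 0)"
    unfolding ev_def by (intro sum.cong) (auto simp: f0)
  also have "\<dots> = Poly_Mapping.lookup w \<kappa>" using \<kappa> by (simp add: in_keys_iff)
  finally have ne: "ev ?f (s v) - ev ?f (s 0) \<noteq> 0" using \<kappa> by (simp add: w_def ev_diff)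
  let ?\<phi> = "\<lambda>v. ev ?f (s v)"
  note \<phi> = ev_section_smooth[OF f]
  obtain t where t: "?\<phi> (0 + 1 *\<^sub>R v) - ?\<phi> (0 + 0 *\<^sub>R v) = (1 - 0) * dirderiv ?\<phi> (0 + t *\<^sub>R v) v"
    using MVT2[of 0 1 "\<lambda>r. ?\<phi> (0 + r *\<^sub>R v)" "\<lambda>t. dirderiv ?\<phi> (0 + t *\<^sub>R v) v"] dirderiv_deriv[OF \<phi> V0 v] by auto
  have tv: "0 + t *\<^sub>R v \<in> points V" using subspace_scale[OF points_subspace v] by simp
  have "dirderiv ?\<phi> (0 + t *\<^sub>R v) v = 0"
    using linear_by_dipoles[OF v dirderiv_linear[OF \<phi> tv] dirderiv_smooth[OF \<phi> tv], of "{}"] z by simp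
  then show False using t ne by simp
qed

end

section \<open>Dipoles do not move along plots\<close>

text \<open>
  Finitely many properties, each of which can be achieved by shrinking any open set and persists under further
  shrinking, hold together on some non-empty open set.
\<close>

lemma shrink_finitely_often:
  assumes fin: "finite I"
    and step: "\<And>i W. i \<in> I \<Longrightarrow> eopen n W \<Longrightarrow> W \<noteq> {} \<Longrightarrow> W \<subseteq> N \<Longrightarrow>
      \<exists>W'. eopen n W' \<and> W' \<noteq> {} \<and> W' \<subseteq> W \<and> Q i W'"
    and mono: "\<And>i W W'. i \<in> I \<Longrightarrow> Q i W \<Longrightarrow> W' \<subseteq> W \<Longrightarrow> Q i W'"
    and W: "eopen n W" "W \<noteq> {}" "W \<subseteq> N"
  shows "\<exists>W'. eopen n W' \<and> W' \<noteq> {} \<and> W' \<subseteq> W \<and> (\<forall>i\<in>I. Q i W')"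
  using fin step mono
proof (induction I rule: finite_induct)
  case empty then show ?case using W by blast
next
  case (insert i I)
  have "\<exists>W'. eopen n W' \<and> W' \<noteq> {} \<and> W' \<subseteq> W \<and> (\<forall>i\<in>I. Q i W')"
    by (rule insert.IH) (use insert.prems in auto)
  then obtain W1 where W1: "eopen n W1" "W1 \<noteq> {}" "W1 \<subseteq> W" "\<forall>i\<in>I. Q i W1" by blast
  have "W1 \<subseteq> N" using W1(3) W(3) by blast
  then obtain W2 where W2: "eopen n W2" "W2 \<noteq> {}" "W2 \<subseteq> W1" "Q i W2"
    using insert.prems(1)[of i W1] W1 by blast
  have "Q i' W2" if "i' \<in> I" for i' using insert.prems(2)[of i' W1 W2] W1(4) W2(3) that by blast
  then show ?case using W2 W1(3) by (intro exI[of _ W2]) auto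
qed

lemma nonzero_open:
  assumes W: "eopen n W" and g: "continuous_on W (g :: rvec \<Rightarrow> real)" and u: "u \<in> W" "g u \<noteq> 0"
  shows "\<exists>W'. eopen n W' \<and> u \<in> W' \<and> W' \<subseteq> W \<and> (\<forall>u\<in>W'. g u \<noteq> 0)"
proof -
  obtain d where d: "d > 0" "ebox n u d \<subseteq> W" "\<forall>y\<in>ebox n u d. \<bar>g y - g u\<bar> < \<bar>g u\<bar>"
    using continuous_ebox[OF W g u(1), of "\<bar>g u\<bar>"] u(2) by auto
  have "g y \<noteq> 0" if "y \<in> ebox n u d" for y using d(3) that by force
  then show ?thesis using d(2) eopen_ebox_self[of n u d] ebox_center[OF W u(1) d(1)]
    by (intro exI[of _ "ebox n u d"] conjI ballI)
qed

text \<open>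
  The symmetric product of two vectors is zero only if one of them is zero.
\<close>

lemma symmetric_product_zero:
  fixes B M :: "nat \<Rightarrow> real"
  assumes "\<And>c1 c2. c1 < d \<Longrightarrow> c2 < d \<Longrightarrow> B c1 * M c2 + B c2 * M c1 = 0" and "c1 < d" "c2 < d"
  shows "B c1 * M c2 = 0"
proof (rule ccontr)
  assume ne: "B c1 * M c2 \<noteq> 0"
  have "B c1 * M c1 = 0" "B c2 * M c2 = 0" using assms(1)[of c1 c1] assms(1)[of c2 c2] assms(2,3) by auto
  then have "M c1 = 0" using ne by auto
  then show False using assms(1)[OF assms(2,3)] ne by simp
qed

lemma sum_zero_by_classes:
  fixes w T :: "nat \<Rightarrow> real"
  assumes "finite S" and eq: "\<And>i i'. i \<in> S \<Longrightarrow> i' \<in> S \<Longrightarrow> h i = h i' \<Longrightarrow> T i = T i'"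
    and z: "\<And>i. i \<in> S \<Longrightarrow> (\<Sum>i'\<in>{x\<in>S. h x = h i}. w i') * T i = 0"
  shows "(\<Sum>i\<in>S. w i * T i) = 0"
proof -
  have "(\<Sum>i\<in>S. w i * T i) = (\<Sum>y\<in>h ` S. \<Sum>i\<in>{x\<in>S. h x = y}. w i * T i)"
    by (rule sum.image_gen[OF assms(1)])
  also have "\<dots> = 0"
  proof (rule sum.neutral, intro ballI)
    fix y assume "y \<in> h ` S"
    then obtain i where i: "i \<in> S" "y = h i" by blast
    have "(\<Sum>i'\<in>{x\<in>S. h x = y}. w i' * T i') = (\<Sum>i'\<in>{x\<in>S. h x = y}. w i' * T i)"
    proof (rule sum.cong[OF refl])
      fix i' assume "i' \<in> {x\<in>S. h x = y}"
      then have "T i' = T i" using eq[of i' i] i by simp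
      then show "w i' * T i' = w i' * T i" by simp
    qed
    also have "\<dots> = 0" using z[OF i(1)] i(2) by (simp add: sum_distrib_right)
    finally show "(\<Sum>i'\<in>{x\<in>S. h x = y}. w i' * T i') = 0" .
  qed
  finally show ?thesis .
qed

text \<open>
  Product of two coordinates around \<open>y\<close>, cut off by a bump: the first jet at \<open>y\<close> is zero and the Hessian is the
  symmetric product of the directions \<open>c1\<close> and \<open>c2\<close>.
\<close>

definition quadratic_test :: "'v idx \<Rightarrow> rvec \<Rightarrow> nat \<Rightarrow> nat \<Rightarrow> real \<Rightarrow> 'v idx \<times> rvec \<Rightarrow> real" where
  "quadratic_test j y c1 c2 e k = (if fst k = j then (snd k c1 - y c1) * ((snd k c2 - y c2) * bump (idim j) y e (snd k)) else 0)"

lemma quadratic_test_smooth: assumes V: "diffeological_space V" shows "smooth_test V (quadratic_test j y c1 c2 e)"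
proof -
  have "smooth_test V (\<lambda>k. if fst k = j then (snd k c1 - y c1) * ((snd k c2 - y c2) * bump (idim j) y e (snd k)) else 0)"
  proof (rule smooth_test_on_one_plot[OF V])
    assume "valid V j"
    note o = valid_open[OF V this]
    show "smooth_fun_on (idim j) (idom j) (\<lambda>z. (z c1 - y c1) * ((z c2 - y c2) * bump (idim j) y e z))"
      by (rule smooth_mult[OF smooth_diff[OF smooth_coordinate[OF o] smooth_const[OF o]]
            smooth_mult[OF smooth_diff[OF smooth_coordinate[OF o] smooth_const[OF o]] bump_smooth[OF o]]])
  qed
  then show ?thesis unfolding quadratic_test_def[abs_def] .
qed

lemma quadratic_test_jet:
  assumes o: "eopen (idim j) (idom j)" and y: "y \<in> idom j" and c1: "c1 < idim j" and c2: "c2 < idim j"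
    and c: "c < idim j" and c': "c' < idim j"
  shows "quadratic_test j y c1 c2 e (j, y) = 0" "pd c (\<lambda>z. quadratic_test j y c1 c2 e (j, z)) y = 0"
    "pd c' (pd c (\<lambda>z. quadratic_test j y c1 c2 e (j, z))) y =
       (if c = c1 then 1 else 0) * (if c' = c2 then 1 else 0) + (if c' = c1 then 1 else 0) * (if c = c2 then 1 else 0)"
proof -
  let ?A = "\<lambda>z. z c1 - y c1" and ?B = "\<lambda>z. (z c2 - y c2) * bump (idim j) y e z"
  note sA = smooth_diff[OF smooth_coordinate[OF o] smooth_const[OF o]]
  note sB = smooth_mult[OF sA bump_smooth[OF o]]
  have q: "(\<lambda>z. quadratic_test j y c1 c2 e (j, z)) = (\<lambda>z. ?A z * ?B z)" by (simp add: quadratic_test_def)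
  show "quadratic_test j y c1 c2 e (j, y) = 0" by (simp add: quadratic_test_def)
  have pA: "pd a (\<lambda>z. z d - y d) z = (if a = d then 1 else 0)" if "a < idim j" "z \<in> idom j" for a d z
    using pd_diff[OF smooth_coordinate[OF o] smooth_const[OF o] that, of d "y d"] by (simp add: pd_coordinate pd_const)
  have pB: "pd a ?B y = (if a = c2 then 1 else 0)" if "a < idim j" for a
    using pd_mult[OF sA bump_smooth[OF o] that y, of c2 "y c2"] pA[OF that y, of c2] by (simp add: bump_center)
  have pf: "pd a (\<lambda>z. quadratic_test j y c1 c2 e (j, z)) z = (if a = c1 then 1 else 0) * ?B z + ?A z * pd a ?B z"
    if "a < idim j" "z \<in> idom j" for a z
    unfolding q using pd_mult[OF sA sB that, of c1 "y c1"] pA[OF that, of c1] by simp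
  show "pd c (\<lambda>z. quadratic_test j y c1 c2 e (j, z)) y = 0" using pf[OF c y] by simp
  have "pd c' (pd c (\<lambda>z. quadratic_test j y c1 c2 e (j, z))) y = pd c' (\<lambda>z. (if c = c1 then 1 else 0) * ?B z + ?A z * pd c ?B z) y"
    by (rule pd_cong[OF o y c' pf[OF c]])
  also have "\<dots> = pd c' (\<lambda>z. (if c = c1 then 1 else 0) * ?B z) y + pd c' (\<lambda>z. ?A z * pd c ?B z) y"
    by (rule pd_add[OF smooth_mult[OF smooth_const[OF o] sB] smooth_mult[OF sA smooth_pd[OF sB c]] c' y])
  also have "pd c' (\<lambda>z. (if c = c1 then 1 else 0) * ?B z) y
      = pd c' (\<lambda>z. (if c = c1 then 1 else 0)) y * ?B y + (if c = c1 then 1 else 0) * pd c' ?B y"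
    by (rule pd_mult[OF smooth_const[OF o] sB c' y])
  also have "pd c' (\<lambda>z. ?A z * pd c ?B z) y = pd c' ?A y * pd c ?B y + ?A y * pd c' (pd c ?B) y"
    by (rule pd_mult[OF sA smooth_pd[OF sB c] c' y])
  finally show "pd c' (pd c (\<lambda>z. quadratic_test j y c1 c2 e (j, z))) y =
       (if c = c1 then 1 else 0) * (if c' = c2 then 1 else 0) + (if c' = c1 then 1 else 0) * (if c = c2 then 1 else 0)"
    using pB[OF c] pB[OF c'] pA[OF c' y, of c1] by (simp add: pd_const)
qed

lemma quadratic_test_far:
  assumes o: "eopen (idim j) (idom j)" and z: "z \<in> idom j" and i: "i < idim j" "e < \<bar>z i - y i\<bar>" and e: "e > 0"
    and c: "c < idim j" and c': "c' < idim j"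
  shows "quadratic_test j y c1 c2 e (j, z) = 0" "pd c (\<lambda>z. quadratic_test j y c1 c2 e (j, z)) z = 0"
    "pd c' (pd c (\<lambda>z. quadratic_test j y c1 c2 e (j, z))) z = 0"
proof -
  let ?W = "{z\<in>idom j. e < \<bar>z i - y i\<bar>}"
  have W: "z \<in> ?W" using z i by simp
  have f0: "quadratic_test j y c1 c2 e (j, z) = 0" if "z \<in> ?W" for z
    using bump_zero[OF i(1), of e z y] that e by (simp add: quadratic_test_def)
  show "quadratic_test j y c1 c2 e (j, z) = 0" by (rule f0[OF W])
  have f1: "pd c (\<lambda>z. quadratic_test j y c1 c2 e (j, z)) z = 0" if "z \<in> ?W" for z
    by (rule pd_vanish[OF far_open[OF o] f0 that c])
  show "pd c (\<lambda>z. quadratic_test j y c1 c2 e (j, z)) z = 0" by (rule f1[OF W])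
  show "pd c' (pd c (\<lambda>z. quadratic_test j y c1 c2 e (j, z))) z = 0" by (rule pd_vanish[OF far_open[OF o] f1 W c'])
qed

context plot_section
begin

text \<open>
  Let \<open>B\<close> be the total dipole at the point \<open>m\<^sub>i(u)\<close> and \<open>M\<close> the velocity of this point in direction \<open>d\<close>.  Take a
  quadratic test function at the point and the resulting smooth function \<open>\<phi>\<close> on \<open>V\<close>.  The curve
  \<open>p w - p u\<close> passes through \<open>0\<close> at \<open>w = u\<close>.  Along it \<open>\<phi>\<close> has derivative \<open>0\<close>, because the test function vanishes
  to first order at every point involved, while the directional derivative of \<open>\<phi>\<close> at \<open>0\<close> has the derivative
  \<open>B\<^sup>c\<^sup>1 M\<^sup>c\<^sup>2 + B\<^sup>c\<^sup>2 M\<^sup>c\<^sup>1\<close>, produced by the Hessian.  By \<open>differential_at_zero\<close> the two are equal.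
  On \<open>W\<close> two points of the jet coincide either everywhere or nowhere, so the points that make up \<open>B\<close> have a
  common velocity.
\<close>

lemma dipole_velocity_symmetric:
  assumes p: "plot V n U p" and NU: "N \<subseteq> U" and l: "jet_rep n N p k al j m b"
    and W: "eopen n W" "W \<subseteq> N"
    and pat: "\<And>i i'. i < k \<Longrightarrow> i' < k \<Longrightarrow> (\<forall>u\<in>W. (j i, m i u) = (j i', m i' u)) \<or> (\<forall>u\<in>W. (j i, m i u) \<noteq> (j i', m i' u))"
    and u: "u \<in> W" and i: "i < k" and d: "d < n" and c1: "c1 < idim (j i)" and c2: "c2 < idim (j i)"
  shows "(\<Sum>i'\<in>{i'\<in>{..<k}. (j i', m i' u) = (j i, m i u)}. b i' c1 u) * pd d (\<lambda>u. m i u c2) u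
    + (\<Sum>i'\<in>{i'\<in>{..<k}. (j i', m i' u) = (j i, m i u)}. b i' c2 u) * pd d (\<lambda>u. m i u c1) u = 0"
proof -
  have uN: "u \<in> N" using u W by blast
  have uU: "u \<in> U" using uN NU by blast
  have U: "eopen n U" by (rule plot_domain[OF p])
  have N: "eopen n N" by (rule jet_repD(1)[OF l])
  have pu: "p u \<in> points V" by (rule plot_in[OF p uU])
  define J where "J = j i"
  define y where "y = m i u"
  have y: "y \<in> idom J" unfolding y_def J_def by (rule jet_repD(7)[OF l i uN])
  have vJ: "valid V J" unfolding J_def by (rule jet_repD(2)[OF l i])
  note o = valid_open[OF diffeological_space_axioms vJ]
  have p1: "plot V n U (\<lambda>w. p w - p u)" by (rule plot_diff[OF p plot_const[OF U pu]])
  obtain M k1 a1 j1 x1 where M: "u \<in> M" "M \<subseteq> U" "smooth_terms V n M k1 a1 j1 x1"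
    "\<And>v. v \<in> M \<Longrightarrow> s (p v - p u) = formal_sum k1 a1 j1 x1 v"
    using free_space_plotD[OF smooth_map_plot[OF s_smooth p1] uU] by metis
  have oM: "eopen n M" using M(3) by (simp add: smooth_terms_def)
  have x1J: "x1 i' u \<in> idom (j1 i')" if "i' < k1" for i'
  proof -
    have "x1 i' ` M \<subseteq> idom (j1 i')" using M(3) that by (simp add: smooth_terms_def smooth_euclidean_def)
    then show ?thesis using M(1) by blast
  qed
  \<comment> \<open>all points of plot \<open>J\<close> that occur in the jet at \<open>u\<close> or in the local expression of \<open>s\<close> around \<open>p u - p u = 0\<close>\<close>
  define Z where "Z = (\<lambda>i'. m i' u) ` {i'\<in>{..<k}. j i' = J} \<union> (\<lambda>i'. x1 i' u) ` {i'\<in>{..<k1}. j1 i' = J}"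
  have Z: "z \<in> idom J" if "z \<in> Z" for z
    using that jet_repD(7)[OF l _ uN] x1J unfolding Z_def by blast
  have "finite Z" by (simp add: Z_def)
  then obtain e where e: "e > 0" "\<And>z. z \<in> Z \<Longrightarrow> z \<noteq> y \<Longrightarrow> \<exists>i<idim J. e < \<bar>z i - y i\<bar>"
    using separating_radius[of Z "idim J" y] eopen_zero[OF o] Z y by metis
  define f where "f = quadratic_test J y c1 c2 e"
  have f: "smooth_test V f" unfolding f_def by (rule quadratic_test_smooth[OF diffeological_space_axioms])
  have c12: "c1 < idim J" "c2 < idim J" using c1 c2 by (simp_all add: J_def)
  let ?\<phi> = "\<lambda>v. ev f (s v)"
  note \<phi> = ev_section_smooth[OF f]
  have fs: "smooth_fun_on (idim j') (idom j') (\<lambda>z. f (j', z))" if "valid V j'" for j' by (rule smooth_testD[OF f that])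
  \<comment> \<open>the first jet of f vanishes at all points of the support of s at the zero vector\<close>
  have jet0: "f (j', z) = 0" "c < idim j' \<Longrightarrow> pd c (\<lambda>z. f (j', z)) z = 0"
    if "j' = J \<Longrightarrow> z \<in> Z" for j' z c
  proof -
    have "f (j', z) = 0 \<and> (c < idim j' \<longrightarrow> pd c (\<lambda>z. f (j', z)) z = 0)"
    proof (cases "j' = J")
      case False then show ?thesis by (simp add: f_def quadratic_test_def pd_const)
    next
      case True
      show ?thesis
      proof (cases "z = y")
        case zy: True
        show ?thesis unfolding True zy f_def using quadratic_test_jet(1,2)[OF o y c12] c12 by blast
      next
        case False
        from e(2)[OF that[OF True] False] obtain t where t: "t < idim J" "e < \<bar>z t - y t\<bar>" by blast
        from quadratic_test_far(1,2)[where i = t and y = y and e = e, OF o Z[OF that[OF True]] t e(1)] c12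
        show ?thesis unfolding True f_def by blast
      qed
    qed
    then show "f (j', z) = 0" "c < idim j' \<Longrightarrow> pd c (\<lambda>z. f (j', z)) z = 0" by auto
  qed
  have left: "pd d (\<lambda>w. ?\<phi> (p w - p u)) u = 0"
  proof -
    have a1: "smooth_fun_on n M (a1 i')" and x1: "smooth_euclidean n M (idim (j1 i')) (idom (j1 i')) (x1 i')"
      and v1: "valid V (j1 i')" if "i' < k1" for i' using M(3) that by (simp_all add: smooth_terms_def)
    note fx = smooth_euclidean_compose_fun[OF x1 fs[OF v1]]
    have "pd d (\<lambda>w. ?\<phi> (p w - p u)) u = pd d (\<lambda>w. \<Sum>i'<k1. a1 i' w * f (j1 i', x1 i' w)) u"
      by (rule pd_cong[OF oM M(1) d]) (simp add: M(4) ev_formal_sum)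
    also have "\<dots> = (\<Sum>i'<k1. pd d (\<lambda>w. a1 i' w * f (j1 i', x1 i' w)) u)"
      by (rule pd_sum[OF smooth_mult[OF a1 fx] d M(1)]) auto
    also have "\<dots> = 0"
    proof (rule sum.neutral, intro ballI)
      fix i' assume "i' \<in> {..<k1}"
      then have i': "i' < k1" by simp
      have zZ: "j1 i' = J \<Longrightarrow> x1 i' u \<in> Z" using i' by (auto simp: Z_def)
      have "pd d (\<lambda>w. a1 i' w * f (j1 i', x1 i' w)) u = pd d (a1 i') u * f (j1 i', x1 i' u) + a1 i' u * pd d (\<lambda>w. f (j1 i', x1 i' w)) u"
        by (rule pd_mult[OF a1[OF i'] fx[OF i' i'] d M(1)])
      also have "pd d (\<lambda>w. f (j1 i', x1 i' w)) u
          = (\<Sum>c<idim (j1 i'). pd c (\<lambda>z. f (j1 i', z)) (x1 i' u) * pd d (\<lambda>w. x1 i' w c) u)"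
        by (rule pd_compose[OF fs[OF v1[OF i']] x1[OF i'] d M(1)])
      finally show "pd d (\<lambda>w. a1 i' w * f (j1 i', x1 i' w)) u = 0" using jet0[OF zZ] by simp
    qed
    finally show ?thesis .
  qed
  define cl where "cl = {i'\<in>{..<k}. (j i', m i' u) = (J, y)}"
  have right: "pd d (\<lambda>w. dirderiv ?\<phi> 0 (p w)) u
     = (\<Sum>i'\<in>cl. b i' c1 u * pd d (\<lambda>u. m i u c2) u + b i' c2 u * pd d (\<lambda>u. m i u c1) u)"
  proof -
    let ?f1 = "\<lambda>i' c. pd c (\<lambda>z. f (j i', z))"
    let ?t = "\<lambda>i' w. al i' w * f (j i', m i' w) + (\<Sum>c<idim (j i'). b i' c w * ?f1 i' c (m i' w))"
    note al = jet_repD(3)[OF l] and ms = jet_repD(4)[OF l] and bs = jet_repD(5)[OF l] and jv = jet_repD(2)[OF l]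
    have fm: "smooth_fun_on n N (\<lambda>w. f (j i', m i' w))" if "i' < k" for i'
      by (rule smooth_euclidean_compose_fun[OF ms[OF that] fs[OF jv[OF that]]])
    have f1m: "smooth_fun_on n N (\<lambda>w. ?f1 i' c (m i' w))" if "i' < k" "c < idim (j i')" for i' c
      by (rule smooth_euclidean_compose_fun[OF ms[OF that(1)] smooth_pd[OF fs[OF jv[OF that(1)]] that(2)]])
    have s1: "smooth_fun_on n N (\<lambda>w. b i' c w * ?f1 i' c (m i' w))" if "i' < k" "c < idim (j i')" for i' c
      by (rule smooth_mult[OF bs[OF that(1)] f1m[OF that]])
    have s2: "smooth_fun_on n N (\<lambda>w. \<Sum>c<idim (j i'). b i' c w * ?f1 i' c (m i' w))" if "i' < k" for i'
      by (rule smooth_sum[OF N]) (use s1[OF that] in simp)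
    have s3: "smooth_fun_on n N (\<lambda>w. al i' w * f (j i', m i' w))" if "i' < k" for i'
      by (rule smooth_mult[OF al[OF that] fm[OF that]])
    have "pd d (\<lambda>w. dirderiv ?\<phi> 0 (p w)) u = pd d (\<lambda>w. \<Sum>i'<k. ?t i' w) u"
      by (rule pd_cong[OF N uN d]) (rule jet_rep_test[OF l _ f])
    also have "\<dots> = (\<Sum>i'<k. pd d (?t i') u)"
      by (rule pd_sum[OF smooth_add[OF s3 s2] d uN]) auto
    also have "\<dots> = (\<Sum>i'<k. if (j i', m i' u) = (J, y)
        then b i' c1 u * pd d (\<lambda>u. m i u c2) u + b i' c2 u * pd d (\<lambda>u. m i u c1) u else 0)"
    proof (rule sum.cong[OF refl])
      fix i' assume "i' \<in> {..<k}"
      then have i': "i' < k" by simp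
      have zZ: "j i' = J \<Longrightarrow> m i' u \<in> Z" using i' by (auto simp: Z_def)
      have "pd d (?t i') u = pd d (\<lambda>w. al i' w * f (j i', m i' w)) u + pd d (\<lambda>w. \<Sum>c<idim (j i'). b i' c w * ?f1 i' c (m i' w)) u"
        by (rule pd_add[OF s3[OF i'] s2[OF i'] d uN])
      also have "pd d (\<lambda>w. al i' w * f (j i', m i' w)) u = pd d (al i') u * f (j i', m i' u) + al i' u * pd d (\<lambda>w. f (j i', m i' w)) u"
        by (rule pd_mult[OF al[OF i'] fm[OF i'] d uN])
      also have "pd d (\<lambda>w. f (j i', m i' w)) u = (\<Sum>c<idim (j i'). ?f1 i' c (m i' u) * pd d (\<lambda>w. m i' w c) u)"
        by (rule pd_compose[OF fs[OF jv[OF i']] ms[OF i'] d uN])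
      also have "\<dots> = 0" using jet0(2)[OF zZ] by simp
      also have "pd d (\<lambda>w. \<Sum>c<idim (j i'). b i' c w * ?f1 i' c (m i' w)) u = (\<Sum>c<idim (j i'). pd d (\<lambda>w. b i' c w * ?f1 i' c (m i' w)) u)"
        by (rule pd_sum[OF s1[OF i'] d uN]) simp
      also have "\<dots> = (\<Sum>c<idim (j i'). b i' c u * (\<Sum>c'<idim (j i'). pd c' (?f1 i' c) (m i' u) * pd d (\<lambda>w. m i' w c') u))"
      proof (rule sum.cong[OF refl])
        fix c assume "c \<in> {..<idim (j i')}"
        then have c: "c < idim (j i')" by simp
        have "pd d (\<lambda>w. b i' c w * ?f1 i' c (m i' w)) u = pd d (b i' c) u * ?f1 i' c (m i' u) + b i' c u * pd d (\<lambda>w. ?f1 i' c (m i' w)) u"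
          by (rule pd_mult[OF bs[OF i'] f1m[OF i' c] d uN])
        also have "pd d (\<lambda>w. ?f1 i' c (m i' w)) u = (\<Sum>c'<idim (j i'). pd c' (?f1 i' c) (m i' u) * pd d (\<lambda>w. m i' w c') u)"
          by (rule pd_compose[OF smooth_pd[OF fs[OF jv[OF i']] c] ms[OF i'] d uN])
        finally show "pd d (\<lambda>w. b i' c w * ?f1 i' c (m i' w)) u
          = b i' c u * (\<Sum>c'<idim (j i'). pd c' (?f1 i' c) (m i' u) * pd d (\<lambda>w. m i' w c') u)"
          using jet0(2)[OF zZ c] by simp
      qed
      finally have t: "pd d (?t i') u = (\<Sum>c<idim (j i'). b i' c u * (\<Sum>c'<idim (j i'). pd c' (?f1 i' c) (m i' u) * pd d (\<lambda>w. m i' w c') u))"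
        using jet0(1)[OF zZ] by simp
      show "pd d (?t i') u = (if (j i', m i' u) = (J, y)
        then b i' c1 u * pd d (\<lambda>u. m i u c2) u + b i' c2 u * pd d (\<lambda>u. m i u c1) u else 0)"
      proof (cases "(j i', m i' u) = (J, y)")
        case True
        then have jJ: "j i' = J" and my: "m i' u = y" by auto
        have "\<forall>w\<in>W. (j i', m i' w) = (j i, m i w)" using pat[OF i' i] True u by (auto simp: J_def y_def)
        then have meq: "pd d (\<lambda>w. m i' w c') u = pd d (\<lambda>w. m i w c') u" for c'
          by (intro pd_cong[OF W(1) u d]) simp
        let ?M = "\<lambda>c. pd d (\<lambda>w. m i w c) u"
        have H: "pd c' (?f1 i' c) y = (if c = c1 then 1 else 0) * (if c' = c2 then 1 else 0) + (if c' = c1 then 1 else 0) * (if c = c2 then 1 else 0)"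
          if "c < idim J" "c' < idim J" for c c'
          using quadratic_test_jet(3)[OF o y c12 that] by (simp only: jJ f_def)
        have inner: "(\<Sum>c'<idim J. pd c' (?f1 i' c) y * ?M c') = (if c = c1 then ?M c2 else 0) + (if c = c2 then ?M c1 else 0)"
          if c: "c < idim J" for c
        proof -
          have "(\<Sum>c'<idim J. pd c' (?f1 i' c) y * ?M c')
            = (\<Sum>c'<idim J. (if c' = c2 then (if c = c1 then ?M c' else 0) else 0) + (if c' = c1 then (if c = c2 then ?M c' else 0) else 0))"
            by (rule sum.cong[OF refl]) (use H[OF c] in simp)
          also have "\<dots> = (if c = c1 then ?M c2 else 0) + (if c = c2 then ?M c1 else 0)"
            using c12 by (simp add: sum.distrib)
          finally show ?thesis .
        qed
        have "(\<Sum>c<idim (j i'). b i' c u * (\<Sum>c'<idim (j i'). pd c' (?f1 i' c) (m i' u) * pd d (\<lambda>w. m i' w c') u))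
            = (\<Sum>c<idim J. b i' c u * (\<Sum>c'<idim J. pd c' (?f1 i' c) y * ?M c'))"
          unfolding my meq by (simp only: jJ)
        also have "\<dots> = (\<Sum>c<idim J. b i' c u * ((if c = c1 then ?M c2 else 0) + (if c = c2 then ?M c1 else 0)))"
          by (rule sum.cong[OF refl]) (simp only: inner lessThan_iff)
        also have "\<dots> = (\<Sum>c<idim J. (if c = c1 then b i' c u * ?M c2 else 0) + (if c = c2 then b i' c u * ?M c1 else 0))"
          by (rule sum.cong[OF refl]) (simp add: distrib_left)
        also have "\<dots> = b i' c1 u * ?M c2 + b i' c2 u * ?M c1" using c12 by (simp add: sum.distrib)
        finally show ?thesis using True t by simp
      next
        case False
        have "pd c' (?f1 i' c) (m i' u) = 0" if "c < idim (j i')" "c' < idim (j i')" for c c'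
        proof (cases "j i' = J")
          case True
          then have "m i' u \<noteq> y" using False by simp
          then obtain t where t: "t < idim J" "e < \<bar>m i' u t - y t\<bar>" using e(2)[OF zZ[OF True]] by blast
          from quadratic_test_far(3)[where i = t and y = y and e = e, OF o Z[OF zZ[OF True]] t e(1)] that
          show ?thesis unfolding True f_def by blast
        next
          case False
          then have "?f1 i' c = (\<lambda>z. 0)" by (simp add: f_def quadratic_test_def pd_const fun_eq_iff)
          then show ?thesis by (simp add: pd_const)
        qed
        then have "pd d (?t i') u = 0" unfolding t by simp
        then show ?thesis unfolding if_not_P[OF False] .
      qed
    qed
    also have "\<dots> = (\<Sum>i'\<in>cl. b i' c1 u * pd d (\<lambda>u. m i u c2) u + b i' c2 u * pd d (\<lambda>u. m i u c1) u)"
      unfolding cl_def by (rule sum.inter_filter[symmetric]) simp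
    finally show ?thesis .
  qed
  have "pd d (\<lambda>w. dirderiv ?\<phi> 0 (p w - p u)) u = pd d (\<lambda>w. dirderiv ?\<phi> 0 (p w)) u"
  proof -
    have V0: "0 \<in> points V" by (rule subspace_0[OF points_subspace])
    note ds = dirderiv_smooth[OF \<phi> V0, rule_format, OF p]
    have "pd d (\<lambda>w. dirderiv ?\<phi> 0 (p w - p u)) u = pd d (\<lambda>w. dirderiv ?\<phi> 0 (p w) - dirderiv ?\<phi> 0 (p u)) u"
      by (rule pd_cong[OF U uU d]) (rule lin_on_diff[OF dirderiv_linear[OF \<phi> V0] plot_in[OF p] pu])
    also have "\<dots> = pd d (\<lambda>w. dirderiv ?\<phi> 0 (p w)) u - pd d (\<lambda>w. dirderiv ?\<phi> 0 (p u)) u"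
      by (rule pd_diff[OF ds smooth_const[OF U] d uU])
    finally show ?thesis by (simp add: pd_const)
  qed
  moreover have "pd d (\<lambda>w. ?\<phi> (p w - p u)) u = pd d (\<lambda>w. dirderiv ?\<phi> 0 (p w - p u)) u"
    by (rule differential_at_zero[OF \<phi> p1 uU _ d]) simp
  ultimately have "(\<Sum>i'\<in>cl. b i' c1 u * pd d (\<lambda>u. m i u c2) u + b i' c2 u * pd d (\<lambda>u. m i u c1) u) = 0"
    using left right by simp
  then show ?thesis unfolding cl_def J_def y_def by (simp add: sum.distrib sum_distrib_right)
qed

text \<open>
  On a small open set the pattern of coincidences among the points \<open>m\<^sub>i\<close> is constant, and the total dipole of
  each class of coinciding points is either identically zero or nowhere zero.  In the first case the weights
  \<open>w\<close> of the class add up to zero.  In the second case the velocity of the class is zero by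
  \<open>dipole_velocity_symmetric\<close>.  Such open sets exist inside every non-empty open set, so the continuous
  function on the left vanishes.  The weights are the dipole coefficients or derivatives of them.
\<close>

lemma velocity_terms_cancel:
  assumes p: "plot V n U p" and NU: "N \<subseteq> U" and l: "jet_rep n N p k al j m b" and \<xi>: "smooth_test V \<xi>" and d: "d < n"
    and w: "\<And>i. i < k \<Longrightarrow> continuous_on N (w i)"
    and wb: "\<And>W u I. eopen n W \<Longrightarrow> W \<subseteq> N \<Longrightarrow> u \<in> W \<Longrightarrow> I \<subseteq> {..<k} \<Longrightarrow>
        (\<And>v. v \<in> W \<Longrightarrow> (\<Sum>i\<in>I. b i c v) = 0) \<Longrightarrow> (\<Sum>i\<in>I. w i u) = 0"
    and u: "u \<in> N"
  shows "(\<Sum>i<k. w i u * pd d (\<lambda>u. \<xi> (j i, m i u)) u) = 0"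
proof (rule ccontr)
  let ?T = "\<lambda>i. pd d (\<lambda>u. \<xi> (j i, m i u))"
  assume ne: "(\<Sum>i<k. w i u * ?T i u) \<noteq> 0"
  have N: "eopen n N" by (rule jet_repD(1)[OF l])
  have xs: "smooth_fun_on (idim (j i)) (idom (j i)) (\<lambda>z. \<xi> (j i, z))" if "i < k" for i
    by (rule smooth_testD[OF \<xi> jet_repD(2)[OF l that]])
  have xm: "smooth_fun_on n N (\<lambda>u. \<xi> (j i, m i u))" if "i < k" for i
    by (rule smooth_euclidean_compose_fun[OF jet_repD(4)[OF l that] xs[OF that]])
  have Tc: "continuous_on N (?T i)" if "i < k" for i by (rule smooth_continuous[OF smooth_pd[OF xm[OF that] d]])
  have "continuous_on N (\<lambda>u. \<Sum>i<k. w i u * ?T i u)"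
    by (intro continuous_on_sum continuous_on_mult) (use w Tc in auto)
  from nonzero_open[OF N this u ne] obtain W0 where W0: "eopen n W0" "u \<in> W0" "W0 \<subseteq> N"
    "\<forall>u\<in>W0. (\<Sum>i<k. w i u * ?T i u) \<noteq> 0" by (elim exE conjE)
  let ?h = "\<lambda>u i. (j i, m i u)"
  let ?Q = "\<lambda>(i, i') W. (\<forall>u\<in>W. ?h u i = ?h u i') \<or> (\<forall>u\<in>W. ?h u i \<noteq> ?h u i')"
  have "\<exists>W'. eopen n W' \<and> W' \<noteq> {} \<and> W' \<subseteq> W0 \<and> (\<forall>x\<in>{..<k}\<times>{..<k}. ?Q x W')"
  proof (rule shrink_finitely_often[where N = N])
    fix x W assume x: "x \<in> {..<k}\<times>{..<k}" and W: "eopen n W" "W \<noteq> {}" "W \<subseteq> N"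
    obtain i i' where ii: "x = (i, i')" "i < k" "i' < k" using x by auto
    show "\<exists>W'. eopen n W' \<and> W' \<noteq> {} \<and> W' \<subseteq> W \<and> ?Q x W'"
    proof (cases "\<forall>u\<in>W. ?h u i = ?h u i'")
      case True
      then show ?thesis using W unfolding ii by (intro exI[of _ W]) simp
    next
      case False
      then obtain v where v: "v \<in> W" "?h v i \<noteq> ?h v i'" by blast
      show ?thesis
      proof (cases "j i = j i'")
        case False
        then show ?thesis using W unfolding ii by (intro exI[of _ W]) simp
      next
        case True
        then obtain c where c: "m i v c \<noteq> m i' v c" using v(2) by (auto simp: fun_eq_iff)
        have vN: "v \<in> N" using v W by blast
        have o: "eopen (idim (j i)) (idom (j i))" by (rule jet_repD(8)[OF l ii(2)])
        have cc: "c < idim (j i)"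
        proof (rule ccontr)
          assume "\<not> c < idim (j i)"
          then have "m i v c = 0" "m i' v c = 0"
            using eopen_zero[OF o jet_repD(7)[OF l ii(2) vN], of c] eopen_zero[OF o, of "m i' v" c] jet_repD(7)[OF l ii(3) vN] True by auto
          then show False using c by simp
        qed
        have mc: "continuous_on W (\<lambda>u. m i u c)" "continuous_on W (\<lambda>u. m i' u c)"
        proof -
          have "smooth_fun_on n N (\<lambda>u. m i u c)" "smooth_fun_on n N (\<lambda>u. m i' u c)"
            using jet_repD(4)[OF l ii(2)] jet_repD(4)[OF l ii(3)] cc True unfolding smooth_euclidean_def by simp_all
          then show "continuous_on W (\<lambda>u. m i u c)" "continuous_on W (\<lambda>u. m i' u c)"
            using continuous_on_subset[OF smooth_continuous W(3)] by blast+
        qed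
        have "continuous_on W (\<lambda>u. m i u c - m i' u c)" by (intro continuous_on_diff mc)
        from nonzero_open[OF W(1) this v(1)] c obtain W' where W': "eopen n W'" "v \<in> W'" "W' \<subseteq> W" "\<forall>u\<in>W'. m i u c - m i' u c \<noteq> 0"
          by auto
        have "?h u i \<noteq> ?h u i'" if "u \<in> W'" for u using W'(4) that by auto
        then show ?thesis using W' unfolding ii by (intro exI[of _ W']) auto
      qed
    qed
  next
    fix x W W' assume "x \<in> {..<k}\<times>{..<k}" "?Q x W" "W' \<subseteq> W"
    then show "?Q x W'" by (cases x) (simp, blast)
  qed (use W0 in auto)
  then obtain W1 where W1: "eopen n W1" "W1 \<noteq> {}" "W1 \<subseteq> W0" and Q: "\<forall>x\<in>{..<k}\<times>{..<k}. ?Q x W1"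
    by (elim exE conjE)
  have pat: "(\<forall>u\<in>W1. ?h u i = ?h u i') \<or> (\<forall>u\<in>W1. ?h u i \<noteq> ?h u i')" if "i < k" "i' < k" for i i'
    using bspec[OF Q, of "(i, i')"] that by simp
  have W1N: "W1 \<subseteq> N" using W1(3) W0(3) by blast
  define C where "C i = {i'\<in>{..<k}. \<forall>v\<in>W1. ?h v i' = ?h v i}" for i
  have Cu: "C i = {i'\<in>{..<k}. ?h v i' = ?h v i}" if "i < k" "v \<in> W1" for i v
    using pat[OF _ that(1)] that(2) unfolding C_def by blast
  let ?R = "\<lambda>i W. (\<forall>u\<in>W. (\<Sum>i'\<in>C i. b i' c u) = 0) \<or> (\<forall>u\<in>W. (\<Sum>i'\<in>C i. b i' c u) \<noteq> 0)"
  have "\<exists>W'. eopen n W' \<and> W' \<noteq> {} \<and> W' \<subseteq> W1 \<and> (\<forall>i\<in>{..<k}. ?R i W')"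
  proof (rule shrink_finitely_often[where N = N])
    fix i W assume i: "i \<in> {..<k}" and W: "eopen n W" "W \<noteq> {}" "W \<subseteq> N"
    show "\<exists>W'. eopen n W' \<and> W' \<noteq> {} \<and> W' \<subseteq> W \<and> ?R i W'"
    proof (cases "\<forall>u\<in>W. (\<Sum>i'\<in>C i. b i' c u) = 0")
      case True
      then show ?thesis using W by (intro exI[of _ W]) simp
    next
      case False
      then obtain v where v: "v \<in> W" "(\<Sum>i'\<in>C i. b i' c v) \<noteq> 0" by blast
      have "continuous_on W (\<lambda>u. \<Sum>i'\<in>C i. b i' c u)"
      proof (intro continuous_on_sum)
        fix i' assume "i' \<in> C i"
        then have "i' < k" by (simp add: C_def)
        from smooth_continuous[OF jet_repD(5)[OF l this]] show "continuous_on W (b i' c)" by (rule continuous_on_subset[OF _ W(3)])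
      qed
      from nonzero_open[OF W(1) this v] obtain W' where "eopen n W'" "v \<in> W'" "W' \<subseteq> W" "\<forall>u\<in>W'. (\<Sum>i'\<in>C i. b i' c u) \<noteq> 0"
        by (elim exE conjE)
      then show ?thesis by (intro exI[of _ W'] conjI) auto
    qed
  next
    fix i W W' assume "?R i W" "W' \<subseteq> W"
    then show "?R i W'" by (meson subsetD)
  qed (use W1 W1N in auto)
  then obtain W2 where W2: "eopen n W2" "W2 \<noteq> {}" "W2 \<subseteq> W1" and R: "\<And>i. i < k \<Longrightarrow> ?R i W2" by auto
  then obtain v where v: "v \<in> W2" by blast
  have v1: "v \<in> W1" and vN: "v \<in> N" using v W2(3) W1N by auto
  have "(\<Sum>i\<in>{..<k}. w i v * ?T i v) = 0"
  proof (rule sum_zero_by_classes[where h = "?h v"])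
    fix i i' assume ii: "i \<in> {..<k}" "i' \<in> {..<k}" "?h v i = ?h v i'"
    then have "\<forall>u\<in>W1. ?h u i = ?h u i'" using pat[of i i'] v1 by blast
    then show "?T i v = ?T i' v" by (intro pd_cong[OF W1(1) v1 d]) simp
  next
    fix i assume "i \<in> {..<k}"
    then have i: "i < k" by simp
    have cls: "{x\<in>{..<k}. ?h v x = ?h v i} = C i" using Cu[OF i v1] by simp
    show "(\<Sum>i'\<in>{x\<in>{..<k}. ?h v x = ?h v i}. w i' v) * ?T i v = 0"
    proof (cases "\<forall>u\<in>W2. (\<Sum>i'\<in>C i. b i' c u) = 0")
      case True
      have "W2 \<subseteq> N" using W2(3) W1N by blast
      have "(\<Sum>i'\<in>C i. w i' v) = 0"
        by (rule wb[OF W2(1) \<open>W2 \<subseteq> N\<close> v]) (use True in \<open>auto simp: C_def\<close>)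
      then show ?thesis unfolding cls by simp
    next
      case False
      then have ne: "(\<Sum>i'\<in>C i. b i' c v) \<noteq> 0" using R[OF i] v by blast
      have ci: "c < idim (j i)"
      proof (rule ccontr)
        assume nc: "\<not> c < idim (j i)"
        have "b i' c v = 0" if i': "i' \<in> C i" for i'
        proof -
          have "i' < k" "j i' = j i" using i' v1 by (auto simp: C_def)
          then show ?thesis using jet_repD(6)[OF l _ _ vN, of i' c] nc by simp
        qed
        then show False using ne by simp
      qed
      have "pd d (\<lambda>u. m i u c') v = 0" if c': "c' < idim (j i)" for c'
      proof -
        have "(\<Sum>i'\<in>C i. b i' c v) * pd d (\<lambda>u. m i u c') v = 0"
        proof (rule symmetric_product_zero[of "idim (j i)" "\<lambda>c. \<Sum>i'\<in>C i. b i' c v" "\<lambda>c'. pd d (\<lambda>u. m i u c') v"])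
          fix c1 c2 assume "c1 < idim (j i)" "c2 < idim (j i)"
          from dipole_velocity_symmetric[OF p NU l W1(1) W1N pat v1 i d this]
          show "(\<Sum>i'\<in>C i. b i' c1 v) * pd d (\<lambda>u. m i u c2) v + (\<Sum>i'\<in>C i. b i' c2 v) * pd d (\<lambda>u. m i u c1) v = 0"
            unfolding cls by simp
        qed (use ci c' in auto)
        then show ?thesis using ne by simp
      qed
      moreover have "?T i v = (\<Sum>c<idim (j i). pd c (\<lambda>z. \<xi> (j i, z)) (m i v) * pd d (\<lambda>u. m i u c) v)"
        by (rule pd_compose[OF xs[OF i] jet_repD(4)[OF l i] d vN])
      ultimately show ?thesis by simp
    qed
  qed simp
  then show False using W0(4) v1 W1(3) by auto
qed

text \<open>
  The product rule gives two kinds of terms, and those in which \<open>\<xi>\<close> is differentiated cancel, since dipoles do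
  not move.
\<close>

lemma dipole_sum_pd:
  assumes p: "plot V n U p" and NU: "N \<subseteq> U" and l: "jet_rep n N p k al j m b" and \<xi>: "smooth_test V \<xi>" and d: "d < n" and u: "u \<in> N"
  shows "pd d (\<lambda>u. dipole_sum \<xi> c (p u)) u = (\<Sum>i<k. pd d (b i c) u * \<xi> (j i, m i u))"
    and "q < n \<Longrightarrow> pd q (\<lambda>u. \<Sum>i<k. pd d (b i c) u * \<xi> (j i, m i u)) u = (\<Sum>i<k. pd q (pd d (b i c)) u * \<xi> (j i, m i u))"
proof -
  have N: "eopen n N" by (rule jet_repD(1)[OF l])
  note bs = jet_repD(5)[OF l]
  have xm: "smooth_fun_on n N (\<lambda>u. \<xi> (j i, m i u))" if "i < k" for i
    by (rule smooth_euclidean_compose_fun[OF jet_repD(4)[OF l that] smooth_testD[OF \<xi> jet_repD(2)[OF l that]]])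
  have prod: "pd d (\<lambda>u. \<Sum>i<k. g i u * \<xi> (j i, m i u)) u = (\<Sum>i<k. pd d (g i) u * \<xi> (j i, m i u)) + (\<Sum>i<k. g i u * pd d (\<lambda>u. \<xi> (j i, m i u)) u)"
    if g: "\<And>i. i < k \<Longrightarrow> smooth_fun_on n N (g i)" and d: "d < n" for g d
  proof -
    have "pd d (\<lambda>u. \<Sum>i<k. g i u * \<xi> (j i, m i u)) u = (\<Sum>i<k. pd d (\<lambda>u. g i u * \<xi> (j i, m i u)) u)"
      by (rule pd_sum[OF smooth_mult[OF g xm] d u]) auto
    also have "\<dots> = (\<Sum>i<k. pd d (g i) u * \<xi> (j i, m i u) + g i u * pd d (\<lambda>u. \<xi> (j i, m i u)) u)"
      by (rule sum.cong[OF refl]) (rule pd_mult[OF g xm d u], auto)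
    finally show ?thesis by (simp add: sum.distrib)
  qed
  have "(\<Sum>i<k. b i c u * pd d (\<lambda>u. \<xi> (j i, m i u)) u) = 0"
  proof (rule velocity_terms_cancel[OF p NU l \<xi> d _ _ u, of "\<lambda>i. b i c" c])
    show "continuous_on N (b i c)" if "i < k" for i by (rule smooth_continuous[OF bs[OF that]])
  qed
  moreover have "pd d (\<lambda>u. dipole_sum \<xi> c (p u)) u = pd d (\<lambda>u. \<Sum>i<k. b i c u * \<xi> (j i, m i u)) u"
    by (rule pd_cong[OF N u d]) (rule dipole_sum_jet_rep[OF l])
  ultimately show "pd d (\<lambda>u. dipole_sum \<xi> c (p u)) u = (\<Sum>i<k. pd d (b i c) u * \<xi> (j i, m i u))"
    using prod[OF bs d] by simp
  assume q: "q < n"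
  note bd = smooth_pd[OF bs d]
  have "(\<Sum>i<k. pd d (b i c) u * pd q (\<lambda>u. \<xi> (j i, m i u)) u) = 0"
  proof (rule velocity_terms_cancel[OF p NU l \<xi> q _ _ u, of "\<lambda>i. pd d (b i c)" c])
    show "continuous_on N (pd d (b i c))" if "i < k" for i by (rule smooth_continuous[OF bd[OF that]])
    fix W v I assume W: "eopen n W" "W \<subseteq> N" and v: "v \<in> W" and I: "I \<subseteq> {..<k}"
      and z: "\<And>v. v \<in> W \<Longrightarrow> (\<Sum>i\<in>I. b i c v) = 0"
    have "(\<Sum>i\<in>I. pd d (b i c) v) = pd d (\<lambda>v. \<Sum>i\<in>I. b i c v) v"
      by (rule pd_sum[OF bs d, symmetric]) (use I v W in auto)
    also have "\<dots> = 0" by (rule pd_vanish[OF W(1) z v d])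
    finally show "(\<Sum>i\<in>I. pd d (b i c) v) = 0" .
  qed
  then show "pd q (\<lambda>u. \<Sum>i<k. pd d (b i c) u * \<xi> (j i, m i u)) u = (\<Sum>i<k. pd q (pd d (b i c)) u * \<xi> (j i, m i u))"
    using prod[OF bd q] by simp
qed

end

section \<open>Local finiteness of the dipole support\<close>

lemma continuous_ebox_finite:
  assumes "finite F" and U: "eopen n U" and x: "x \<in> U" and F: "\<And>f. f \<in> F \<Longrightarrow> continuous_on U (f :: rvec \<Rightarrow> real)"
  shows "\<exists>d>0. ebox n x d \<subseteq> U \<and> (\<forall>f\<in>F. \<forall>y\<in>ebox n x d. \<bar>f y - f x\<bar> < 1)"
  using assms(1) F
proof (induction F rule: finite_induct)
  case empty then show ?case using eopen_ebox[OF U x] by simp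
next
  case (insert f F)
  obtain d1 where d1: "d1 > 0" "ebox n x d1 \<subseteq> U" "\<forall>f\<in>F. \<forall>y\<in>ebox n x d1. \<bar>f y - f x\<bar> < 1"
    using insert.IH insert.prems by blast
  have "continuous_on U f" using insert.prems by simp
  from continuous_ebox[OF U this x zero_less_one]
  obtain d2 where d2: "d2 > 0" "\<forall>y\<in>ebox n x d2. \<bar>f y - f x\<bar> < 1" by blast
  have "ebox n x (min d1 d2) \<subseteq> ebox n x d1" "ebox n x (min d1 d2) \<subseteq> ebox n x d2" by (simp_all add: ebox_mono)
  then show ?case using d1 d2 by (intro exI[of _ "min d1 d2"]) auto
qed

lemma eopen_finite_inter:
  assumes "finite I" "eopen n N" "\<And>i. i \<in> I \<Longrightarrow> eopen n (A i)"
  shows "eopen n {u\<in>N. \<forall>i\<in>I. u \<in> A i}"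
  using assms(1,3)
proof (induction I rule: finite_induct)
  case empty then show ?case using assms(2) by simp
next
  case (insert i I)
  have "{u\<in>N. \<forall>i\<in>insert i I. u \<in> A i} = {u\<in>N. \<forall>i\<in>I. u \<in> A i} \<inter> A i" by auto
  then show ?case using insert by auto
qed

text \<open>
  Finitely many functionals that separate the vectors of \<open>A\<close> have a dual family.  The induction splits off the
  kernel of the last functional.
\<close>

lemma left_inverse_of_functionals:
  fixes A :: "'v::real_vector set"
  assumes "subspace A"
    and "\<And>t v w. t < m \<Longrightarrow> v \<in> A \<Longrightarrow> w \<in> A \<Longrightarrow> g t (v + w) = g t v + g t w"
    and "\<And>t v r. t < m \<Longrightarrow> v \<in> A \<Longrightarrow> g t (r *\<^sub>R v) = r * g t v"
    and "\<And>v. v \<in> A \<Longrightarrow> (\<And>t. t < m \<Longrightarrow> g t v = 0) \<Longrightarrow> v = 0"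
  shows "\<exists>w. (\<forall>t<m. w t \<in> A) \<and> (\<forall>v\<in>A. v = (\<Sum>t<(m::nat). g t v *\<^sub>R w t))"
  using assms
proof (induction m arbitrary: A)
  case 0 then show ?case by (intro exI[of _ "\<lambda>_. 0"]) (metis lessThan_0 less_nat_zero_code sum.empty)
next
  case (Suc m)
  note sub = Suc.prems(1)
  note add = Suc.prems(2)[of m] and scale = Suc.prems(3)[of m]
  let ?K = "{v\<in>A. g m v = 0}"
  have g0: "g m 0 = 0" using scale[of 0 0] subspace_0[OF sub] by simp
  have K: "subspace ?K"
    unfolding subspace_def using sub add scale g0 by (auto simp: subspace_def)
  have "\<exists>w. (\<forall>t<m. w t \<in> ?K) \<and> (\<forall>v\<in>?K. v = (\<Sum>t<m. g t v *\<^sub>R w t))"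
  proof (rule Suc.IH[OF K])
    show "g t (v + w) = g t v + g t w" if "t < m" "v \<in> ?K" "w \<in> ?K" for t v w using Suc.prems(2)[of t v w] that by simp
    show "g t (r *\<^sub>R v) = r * g t v" if "t < m" "v \<in> ?K" for t v r using Suc.prems(3)[of t v r] that by simp
    show "v = 0" if "v \<in> ?K" "\<And>t. t < m \<Longrightarrow> g t v = 0" for v
    proof (rule Suc.prems(4))
      show "v \<in> A" using that(1) by simp
      show "g t v = 0" if "t < Suc m" for t using that \<open>v \<in> ?K\<close> \<open>\<And>t. t < m \<Longrightarrow> g t v = 0\<close> by (cases "t = m") auto
    qed
  qed
  then obtain w where w: "\<And>t. t < m \<Longrightarrow> w t \<in> ?K" "\<And>v. v \<in> ?K \<Longrightarrow> v = (\<Sum>t<m. g t v *\<^sub>R w t)" by blast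
  show ?case
  proof (cases "\<forall>v\<in>A. g m v = 0")
    case True
    have "\<forall>v\<in>A. v = (\<Sum>t<Suc m. g t v *\<^sub>R (if t = m then 0 else w t))"
    proof
      fix v assume "v \<in> A"
      then have "v = (\<Sum>t<m. g t v *\<^sub>R w t)" using w(2) True by simp
      also have "\<dots> = (\<Sum>t<m. g t v *\<^sub>R (if t = m then 0 else w t))" by (intro sum.cong) auto
      finally show "v = (\<Sum>t<Suc m. g t v *\<^sub>R (if t = m then 0 else w t))" by simp
    qed
    then show ?thesis using w(1) subspace_0[OF sub] by (intro exI[of _ "\<lambda>t. if t = m then 0 else w t"]) auto
  next
    case False
    then obtain z0 where z0: "z0 \<in> A" "g m z0 \<noteq> 0" by blast
    define z where "z = (1 / g m z0) *\<^sub>R z0"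
    have z: "z \<in> A" "g m z = 1" using z0 sub scale[of z0] by (auto simp: z_def subspace_scale)
    \<comment> \<open>the last vector is corrected by its components along the others; the latter lie in the kernel of the last functional\<close>
    define w' where "w' t = (if t = m then z - (\<Sum>t<m. g t z *\<^sub>R w t) else w t)" for t
    have wA: "w t \<in> A" if "t < m" for t using w(1)[OF that] by simp
    have "\<forall>v\<in>A. v = (\<Sum>t<Suc m. g t v *\<^sub>R w' t)"
    proof
      fix v assume v: "v \<in> A"
      let ?u = "v + (- g m v) *\<^sub>R z"
      have sz: "(- g m v) *\<^sub>R z \<in> A" using subspace_scale[OF sub z(1)] .
      have gu: "g t ?u = g t v - g m v * g t z" if "t < Suc m" for t
        using Suc.prems(2)[OF that v sz] Suc.prems(3)[OF that z(1), of "- g m v"] by simp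
      have uA: "?u \<in> A" using subspace_add[OF sub v sz] .
      have "g m ?u = 0" using gu[of m] z(2) by simp
      then have "?u = (\<Sum>t<m. g t ?u *\<^sub>R w t)" using w(2) uA by blast
      also have "\<dots> = (\<Sum>t<m. g t v *\<^sub>R w t - g m v *\<^sub>R (g t z *\<^sub>R w t))"
      proof (rule sum.cong[OF refl])
        fix t assume "t \<in> {..<m}"
        then have "g t ?u = g t v - g m v * g t z" using gu[of t] by simp
        then show "g t ?u *\<^sub>R w t = g t v *\<^sub>R w t - g m v *\<^sub>R (g t z *\<^sub>R w t)"
          unfolding scaleR_scaleR by (simp only: scaleR_diff_left)
      qed
      also have "\<dots> = (\<Sum>t<m. g t v *\<^sub>R w t) - g m v *\<^sub>R (\<Sum>t<m. g t z *\<^sub>R w t)"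
        by (simp add: sum_subtractf scaleR_sum_right)
      finally have e: "v = (\<Sum>t<m. g t v *\<^sub>R w t) - g m v *\<^sub>R (\<Sum>t<m. g t z *\<^sub>R w t) + g m v *\<^sub>R z"
        by (simp add: algebra_simps)
      have "(\<Sum>t<m. g t v *\<^sub>R w' t) = (\<Sum>t<m. g t v *\<^sub>R w t)" by (intro sum.cong) (auto simp: w'_def)
      moreover have "g m v *\<^sub>R w' m = g m v *\<^sub>R z - g m v *\<^sub>R (\<Sum>t<m. g t z *\<^sub>R w t)"
        by (simp add: w'_def scaleR_diff_right)
      ultimately show "v = (\<Sum>t<Suc m. g t v *\<^sub>R w' t)"
        by (subst e) (simp add: algebra_simps)
    qed
    moreover have "w' t \<in> A" if "t < Suc m" for t
    proof (cases "t = m")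
      case True
      have "z - (\<Sum>t<m. g t z *\<^sub>R w t) \<in> A"
        by (intro subspace_diff[OF sub] subspace_sum[OF sub] subspace_scale[OF sub] z(1) wA) simp
      then show ?thesis by (simp add: True w'_def)
    next
      case False
      then show ?thesis using that wA[of t] by (simp add: w'_def)
    qed
    ultimately show ?thesis by blast
  qed
qed

context plot_section
begin

text \<open>
  The derivative \<open>G\<close> of the functional along \<open>p\<close> vanishes at \<open>y\<close> if \<open>\<xi>\<close> vanishes at the points \<open>m\<^sub>i(y)\<close>, and the
  derivatives of \<open>G\<close> are bounded in terms of second derivatives of the coefficients of the jet, as \<open>\<bar>\<xi>\<bar> \<le> 1\<close>; both
  hold by \<open>dipole_sum_pd\<close>.  The point of the statement is that \<open>C\<close> and \<open>e\<close> do not depend on \<open>\<xi>\<close>, however steep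
  it may be.
\<close>

lemma dipole_sum_derivative_bound:
  assumes p: "plot V n U p" and y: "y \<in> U"
  shows "\<exists>e C S. e > 0 \<and> C \<ge> 0 \<and> finite S \<and> (\<forall>\<kappa>\<in>S. valid V (fst \<kappa>) \<and> snd \<kappa> \<in> idom (fst \<kappa>)) \<and>
    (\<forall>\<xi> c e' x d. smooth_test V \<xi> \<longrightarrow> (\<forall>\<kappa>. \<bar>\<xi> \<kappa>\<bar> \<le> 1) \<longrightarrow> (\<forall>\<kappa>\<in>S. \<xi> \<kappa> = 0) \<longrightarrow> e' \<le> e \<longrightarrow> x \<in> ebox n y e' \<longrightarrow> d < n \<longrightarrow>
       \<bar>pd d (\<lambda>u. dipole_sum \<xi> c (p u)) x\<bar> \<le> C * e')"
proof -
  obtain N k al j m b where N: "y \<in> N" "N \<subseteq> U" and l: "jet_rep n N p k al j m b"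
    using jet_rep_exists[OF p y] by (elim exE conjE)
  have oN: "eopen n N" by (rule jet_repD(1)[OF l])
  define D where "D = (\<Sum>i<k. idim (j i))"
  have Dge: "idim (j i) \<le> D" if "i < k" for i unfolding D_def using that by (intro member_le_sum) auto
  define F where "F = (\<lambda>(i, c, d, q). pd q (pd d (b i c))) ` ({..<k} \<times> {..<D} \<times> {..<n} \<times> {..<n})"
  have F: "finite F" unfolding F_def by simp
  have Fc: "continuous_on N f" if "f \<in> F" for f
    using that smooth_continuous[OF smooth_pd[OF smooth_pd[OF jet_repD(5)[OF l]]]] by (auto simp: F_def)
  obtain e where e: "e > 0" "ebox n y e \<subseteq> N" "\<And>f x. f \<in> F \<Longrightarrow> x \<in> ebox n y e \<Longrightarrow> \<bar>f x - f y\<bar> < 1"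
    using continuous_ebox_finite[OF F oN N(1) Fc] by blast
  define K where "K = (\<Sum>f\<in>F. \<bar>f y\<bar>) + 1"
  have K0: "K \<ge> 0" unfolding K_def by (simp add: sum_nonneg)
  have K: "\<bar>pd q (pd d (b i c)) x\<bar> \<le> K" if "i < k" "d < n" "q < n" "x \<in> ebox n y e" for i c d q x
  proof (cases "c < D")
    case True
    let ?f = "pd q (pd d (b i c))"
    have f: "?f \<in> F" unfolding F_def using that True by (intro image_eqI[of _ _ "(i, c, d, q)"]) auto
    have "\<bar>?f y\<bar> \<le> (\<Sum>f\<in>F. \<bar>f y\<bar>)" by (rule member_le_sum[OF f]) (use F in auto)
    then show ?thesis using e(3)[OF f that(4)] by (simp add: K_def)
  next
    case False
    then have z: "b i c u = 0" if "u \<in> N" for u using jet_repD(6)[OF l \<open>i < k\<close> _ that] Dge[OF \<open>i < k\<close>] by simp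
    have z1: "pd d (b i c) u = 0" if "u \<in> N" for u by (rule pd_vanish[OF oN z that \<open>d < n\<close>])
    have "x \<in> N" using that(4) e(2) by blast
    then have "pd q (pd d (b i c)) x = 0" by (intro pd_vanish[OF oN z1 _ \<open>q < n\<close>])
    then show ?thesis using K0 by simp
  qed
  define S where "S = (\<lambda>i. (j i, m i y)) ` {..<k}"
  define C where "C = real n * (real k * K)"
  have main: "\<bar>pd d (\<lambda>u. dipole_sum \<xi> c (p u)) x\<bar> \<le> C * e'"
    if \<xi>: "smooth_test V \<xi>" and b1: "\<And>\<kappa>. \<bar>\<xi> \<kappa>\<bar> \<le> 1" and \<xi>0: "\<And>\<kappa>. \<kappa> \<in> S \<Longrightarrow> \<xi> \<kappa> = 0" and e': "e' \<le> e"
      and x: "x \<in> ebox n y e'" and d: "d < n" for \<xi> c e' x d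
  proof -
    define G where "G u = (\<Sum>i<k. pd d (b i c) u * \<xi> (j i, m i u))" for u
    have xe: "x \<in> ebox n y e" using x ebox_mono[OF e'] by blast
    have xN: "x \<in> N" using xe e(2) by blast
    have "smooth_fun_on n N (\<lambda>u. pd d (b i c) u * \<xi> (j i, m i u))" if "i < k" for i
      by (rule smooth_mult[OF smooth_pd[OF jet_repD(5)[OF l that] d]
            smooth_euclidean_compose_fun[OF jet_repD(4)[OF l that] smooth_testD[OF \<xi> jet_repD(2)[OF l that]]]])
    then have Gs: "smooth_fun_on n N G" unfolding G_def by (intro smooth_sum[OF oN]) auto
    have G0: "G y = 0" unfolding G_def by (rule sum.neutral) (use \<xi>0 in \<open>auto simp: S_def\<close>)
    have Gq: "\<bar>pd q G z\<bar> \<le> real k * K" if z: "z \<in> ebox n y e" and q: "q < n" for z q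
    proof -
      have zN: "z \<in> N" using z e(2) by blast
      have "pd q G z = (\<Sum>i<k. pd q (pd d (b i c)) z * \<xi> (j i, m i z))"
        unfolding G_def by (rule dipole_sum_pd(2)[OF p N(2) l \<xi> d zN q])
      also have "\<bar>\<dots>\<bar> \<le> (\<Sum>i<k. \<bar>pd q (pd d (b i c)) z * \<xi> (j i, m i z)\<bar>)" by (rule sum_abs)
      also have "\<dots> \<le> (\<Sum>i<k. K)"
      proof (rule sum_mono)
        fix i assume "i \<in> {..<k}"
        then have "\<bar>pd q (pd d (b i c)) z\<bar> \<le> K" using K[of i d q z c] d q z by simp
        then have "\<bar>pd q (pd d (b i c)) z\<bar> * \<bar>\<xi> (j i, m i z)\<bar> \<le> K * 1" using b1 K0 by (intro mult_mono) auto
        then show "\<bar>pd q (pd d (b i c)) z * \<xi> (j i, m i z)\<bar> \<le> K" by (simp add: abs_mult)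
      qed
      finally show ?thesis by simp
    qed
    define g where "g t = (\<lambda>i. y i + t * (x i - y i))" for t :: real
    have gb: "g t \<in> ebox n y e" if "0 \<le> t" "t \<le> 1" for t
    proof -
      have "\<bar>g t i - y i\<bar> < e" if i: "i < n" for i
      proof -
        have "\<bar>g t i - y i\<bar> = t * \<bar>x i - y i\<bar>" using \<open>0 \<le> t\<close> by (simp add: g_def abs_mult)
        also have "\<dots> \<le> 1 * \<bar>x i - y i\<bar>" using \<open>t \<le> 1\<close> by (intro mult_right_mono) auto
        finally show ?thesis using xe i by (auto simp: ebox_def)
      qed
      moreover have "g t i = 0" if "i \<ge> n" for i
        using eopen_zero[OF oN N(1) that] eopen_zero[OF oN xN that] by (simp add: g_def)
      ultimately show ?thesis by (simp add: ebox_def)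
    qed
    have gd: "((\<lambda>t. G (g t)) has_real_derivative (\<Sum>q<n. pd q G (g t) * (x q - y q))) (at t)" if t: "0 \<le> t" "t \<le> 1" for t
    proof (rule chain_rule_curve[OF oN smooth_Ck[OF Gs]])
      show "g t \<in> N" using gb[OF t] e(2) by blast
      have "g s i = 0" if "i \<ge> n" for s i
        using eopen_zero[OF oN N(1) that] eopen_zero[OF oN xN that] by (simp add: g_def)
      then show "\<forall>\<^sub>F s in nhds t. \<forall>i\<ge>n. g s i = 0" by simp
      show "((\<lambda>t. g t q) has_real_derivative x q - y q) (at t)" for q
        unfolding g_def by (auto intro!: derivative_eq_intros)
    qed
    obtain t where t: "0 < t" "t < 1" "G (g 1) - G (g 0) = (1 - 0) * (\<Sum>q<n. pd q G (g t) * (x q - y q))"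
      using MVT2[of 0 1 "\<lambda>t. G (g t)" "\<lambda>t. \<Sum>q<n. pd q G (g t) * (x q - y q)"] gd by auto
    have "g 1 = x" "g 0 = y" by (auto simp: g_def)
    then have "G x = (\<Sum>q<n. pd q G (g t) * (x q - y q))" using t(3) G0 by simp
    also have "\<bar>\<dots>\<bar> \<le> (\<Sum>q<n. \<bar>pd q G (g t) * (x q - y q)\<bar>)" by (rule sum_abs)
    also have "\<dots> \<le> (\<Sum>q<n. real k * K * e')"
    proof (rule sum_mono)
      fix q assume "q \<in> {..<n}"
      then have q: "q < n" by simp
      have "\<bar>pd q G (g t)\<bar> \<le> real k * K" using Gq[OF gb q] t by simp
      moreover have "\<bar>x q - y q\<bar> \<le> e'" using x q by (auto simp: ebox_def intro: less_imp_le)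
      ultimately show "\<bar>pd q G (g t) * (x q - y q)\<bar> \<le> real k * K * e'"
        unfolding abs_mult using K0 by (intro mult_mono) auto
    qed
    finally have "\<bar>G x\<bar> \<le> C * e'" by (simp add: C_def mult_ac)
    moreover have "pd d (\<lambda>u. dipole_sum \<xi> c (p u)) x = G x" unfolding G_def by (rule dipole_sum_pd(1)[OF p N(2) l \<xi> d xN])
    ultimately show ?thesis by simp
  qed
  have S: "valid V (fst \<kappa>) \<and> snd \<kappa> \<in> idom (fst \<kappa>)" if "\<kappa> \<in> S" for \<kappa>
    using that jet_repD(2)[OF l] jet_repD(7)[OF l _ N(1)] by (auto simp: S_def)
  have C0: "C \<ge> 0" using K0 by (simp add: C_def)
  show ?thesis
  proof (intro exI conjI)
    show "e > 0" "C \<ge> 0" by fact+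
    show "finite S" by (simp add: S_def)
    show "\<forall>\<kappa>\<in>S. valid V (fst \<kappa>) \<and> snd \<kappa> \<in> idom (fst \<kappa>)" using S by blast
    show "\<forall>\<xi> c e' x d. smooth_test V \<xi> \<longrightarrow> (\<forall>\<kappa>. \<bar>\<xi> \<kappa>\<bar> \<le> 1) \<longrightarrow> (\<forall>\<kappa>\<in>S. \<xi> \<kappa> = 0) \<longrightarrow> e' \<le> e \<longrightarrow> x \<in> ebox n y e' \<longrightarrow> d < n \<longrightarrow>
       \<bar>pd d (\<lambda>u. dipole_sum \<xi> c (p u)) x\<bar> \<le> C * e'"
      by (intro allI impI) (rule main, auto)
  qed
qed

lemma isolating_bump:
  assumes Z: "finite Z" "\<And>\<kappa>. \<kappa> \<in> Z \<Longrightarrow> valid V (fst \<kappa>) \<and> snd \<kappa> \<in> idom (fst \<kappa>)"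
    and k: "valid V (fst \<kappa>0)" "snd \<kappa>0 \<in> idom (fst \<kappa>0)"
  shows "\<exists>\<xi>. smooth_test V \<xi> \<and> (\<forall>\<kappa>. \<bar>\<xi> \<kappa>\<bar> \<le> 1) \<and> \<xi> \<kappa>0 = 1 \<and> (\<forall>\<kappa>\<in>Z. \<kappa> \<noteq> \<kappa>0 \<longrightarrow> \<xi> \<kappa> = 0)"
proof -
  obtain J y where Jy: "\<kappa>0 = (J, y)" by (cases \<kappa>0)
  have vJ: "valid V J" and y: "y \<in> idom J" using k by (simp_all add: Jy)
  note o = valid_open[OF diffeological_space_axioms vJ]
  define Y where "Y = snd ` {\<kappa>\<in>Z. fst \<kappa> = J}"
  have Y: "z \<in> idom J" if "z \<in> Y" for z using Z(2) that by (auto simp: Y_def)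
  have "finite Y" using Z(1) by (simp add: Y_def)
  then obtain r where r: "r > 0" "\<And>z. z \<in> Y \<Longrightarrow> z \<noteq> y \<Longrightarrow> \<exists>i<idim J. r < \<bar>z i - y i\<bar>"
    using separating_radius[of Y "idim J" y] eopen_zero[OF o] Y y by metis
  have "bump_test J y r \<kappa> = 0" if "\<kappa> \<in> Z" "\<kappa> \<noteq> \<kappa>0" for \<kappa>
  proof (cases "fst \<kappa> = J")
    case True
    then have "snd \<kappa> \<in> Y" "snd \<kappa> \<noteq> y" using that by (auto simp: Y_def Jy)
    then obtain i where "i < idim J" "r < \<bar>snd \<kappa> i - y i\<bar>" using r(2) by blast
    then show ?thesis using bump_zero[of i "idim J" r "snd \<kappa>" y] r(1) by (simp add: bump_test_def)
  qed (simp add: bump_test_def)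
  moreover have "\<bar>bump_test J y r \<kappa>\<bar> \<le> 1" for \<kappa> by (simp add: bump_test_def bump_bounds)
  moreover have "bump_test J y r \<kappa>0 = 1" by (simp add: Jy bump_test_def bump_center)
  ultimately show ?thesis using bump_test_smooth[OF diffeological_space_axioms, of J y r] by blast
qed

lemma dipole_support_valid: "\<kappa> \<in> dipole_support v \<Longrightarrow> valid V (fst \<kappa>) \<and> snd \<kappa> \<in> idom (fst \<kappa>)"
  unfolding dipole_support_def using dipole_zero by blast

lemma dipole_sum_isolated:
  assumes v: "v \<in> points V" and x: "\<xi> \<kappa>0 = 1" "\<And>\<kappa>. \<kappa> \<in> dipole_support v \<Longrightarrow> \<kappa> \<noteq> \<kappa>0 \<Longrightarrow> \<xi> \<kappa> = 0"
  shows "dipole_sum \<xi> c v = dipole v \<kappa>0 c"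
proof -
  have f: "finite (insert \<kappa>0 (dipole_support v))" using dipole_support_finite[OF v] by simp
  have "dipole_sum \<xi> c v = (\<Sum>\<kappa>\<in>insert \<kappa>0 (dipole_support v). dipole v \<kappa> c * \<xi> \<kappa>)" by (rule dipole_sum_superset[OF f]) auto
  also have "\<dots> = (\<Sum>\<kappa>\<in>insert \<kappa>0 (dipole_support v). if \<kappa> = \<kappa>0 then dipole v \<kappa> c else 0)"
    by (rule sum.cong[OF refl]) (use x in auto)
  also have "\<dots> = dipole v \<kappa>0 c" using f by (simp add: sum.delta)
  finally show ?thesis .
qed

text \<open>
  A contraction argument.  Let \<open>S\<close> be the set of points \<open>m\<^sub>i(u0)\<close>.  For \<open>u\<close> near \<open>u0\<close> suppose that \<open>p u\<close> has dipoles
  outside \<open>S\<close>, and let \<open>\<mu> > 0\<close> be the largest absolute value of their coefficients, attained at \<open>\<kappa>0\<close>.  Choose a bump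
  \<open>\<xi>\<close> that is \<open>1\<close> at \<open>\<kappa>0\<close> and \<open>0\<close> at all other points of the support and at the points that
  \<open>dipole_sum_derivative_bound\<close> requires for the plots \<open>j\<^sub>i\<close>.  The functional \<open>dipole_sum \<xi> c0\<close> has absolute
  value \<open>\<mu>\<close> at \<open>p u\<close>.  By \<open>linear_by_dipoles\<close> its value is the sum of the dipole coefficients of \<open>p u\<close> times the
  derivatives of the same functional along the plots \<open>j\<^sub>i\<close>.  These derivatives are \<open>0\<close> at the points of \<open>S\<close>
  and at most \<open>C \<delta>\<close> at the points within \<open>\<delta>\<close> of \<open>S\<close>, so that \<open>\<mu> \<le> A \<delta> \<mu>\<close> with \<open>A \<delta> < 1\<close>.
\<close>

lemma dipole_support_locally_finite:
  assumes p: "plot V n U p" and u0: "u0 \<in> U"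
  shows "\<exists>W S. eopen n W \<and> u0 \<in> W \<and> W \<subseteq> U \<and> finite S \<and> (\<forall>\<kappa>\<in>S. valid V (fst \<kappa>) \<and> snd \<kappa> \<in> idom (fst \<kappa>)) \<and>
    (\<forall>u\<in>W. dipole_support (p u) \<subseteq> S)"
proof -
  obtain N k al j m b where N: "u0 \<in> N" "N \<subseteq> U" and l: "jet_rep n N p k al j m b"
    using jet_rep_exists[OF p u0] by (elim exE conjE)
  have oN: "eopen n N" by (rule jet_repD(1)[OF l])
  have jv: "valid V (j i)" and my: "m i u0 \<in> idom (j i)" if "i < k" for i
    using jet_repD(2)[OF l that] jet_repD(7)[OF l that N(1)] by auto
  have jp: "plot V (idim (j i)) (idom (j i)) (imap (j i))" if "i < k" for i using jv[OF that] by (simp add: valid_def)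
  define R where "R i e C S \<longleftrightarrow> e > 0 \<and> C \<ge> 0 \<and> finite S \<and> (\<forall>\<kappa>\<in>S. valid V (fst \<kappa>) \<and> snd \<kappa> \<in> idom (fst \<kappa>)) \<and>
    (\<forall>\<xi> c e' x d. smooth_test V \<xi> \<longrightarrow> (\<forall>\<kappa>. \<bar>\<xi> \<kappa>\<bar> \<le> 1) \<longrightarrow> (\<forall>\<kappa>\<in>S. \<xi> \<kappa> = 0) \<longrightarrow> e' \<le> e \<longrightarrow>
       x \<in> ebox (idim (j i)) (m i u0) e' \<longrightarrow> d < idim (j i) \<longrightarrow>
       \<bar>pd d (\<lambda>u. dipole_sum \<xi> c (imap (j i) u)) x\<bar> \<le> C * e')" for i e C S
  have "\<exists>e C S. R i e C S" if "i < k" for i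
    using dipole_sum_derivative_bound[OF jp[OF that] my[OF that]] unfolding R_def .
  then have "\<forall>i\<in>{..<k}. \<exists>e C S. R i e C S" by simp
  then obtain eE CC SS where R: "\<forall>i\<in>{..<k}. R i (eE i) (CC i) (SS i)"
    unfolding bchoice_iff by (elim exE)
  then have R: "R i (eE i) (CC i) (SS i)" if "i < k" for i using that by simp
  have eE: "eE i > 0" and CC: "CC i \<ge> 0" and SSf: "finite (SS i)" if "i < k" for i
    using R[OF that] by (simp_all add: R_def)
  have SSv: "valid V (fst \<kappa>) \<and> snd \<kappa> \<in> idom (fst \<kappa>)" if "i < k" "\<kappa> \<in> SS i" for i \<kappa>
    using R[OF that(1)] that(2) unfolding R_def by simp
  have bound: "\<bar>pd d (\<lambda>u. dipole_sum \<xi> c (imap (j i) u)) x\<bar> \<le> CC i * e'"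
    if "i < k" "smooth_test V \<xi>" "\<forall>\<kappa>. \<bar>\<xi> \<kappa>\<bar> \<le> 1" "\<forall>\<kappa>\<in>SS i. \<xi> \<kappa> = 0" "e' \<le> eE i"
      "x \<in> ebox (idim (j i)) (m i u0) e'" "d < idim (j i)" for i \<xi> c e' x d
    using R[OF that(1)] that(2-) unfolding R_def by simp
  define S where "S = (\<lambda>i. (j i, m i u0)) ` {..<k}"
  \<comment> \<open>where \<open>\<xi>\<close> has to vanish for the derivative bounds along the plots \<open>j i\<close> around \<open>m i u0\<close>\<close>
  define T where "T = S \<union> (\<Union>i<k. SS i)"
  have Sf: "finite S" by (simp add: S_def)
  have Tf: "finite T" using Sf SSf by (auto simp: T_def)
  have Sv: "valid V (fst \<kappa>) \<and> snd \<kappa> \<in> idom (fst \<kappa>)" if "\<kappa> \<in> S" for \<kappa> using that jv my by (auto simp: S_def)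
  have Tv: "valid V (fst \<kappa>) \<and> snd \<kappa> \<in> idom (fst \<kappa>)" if "\<kappa> \<in> T" for \<kappa>
  proof -
    consider "\<kappa> \<in> S" | i where "i < k" "\<kappa> \<in> SS i" using \<open>\<kappa> \<in> T\<close> unfolding T_def by blast
    then show ?thesis by cases (erule Sv, erule (1) SSv)
  qed
  define C where "C = (\<Sum>i<k. CC i)"
  have C: "CC i \<le> C" if "i < k" for i unfolding C_def using that CC by (intro member_le_sum) auto
  have C0: "C \<ge> 0" unfolding C_def using CC by (intro sum_nonneg) auto
  define D where "D = (\<Sum>i<k. idim (j i))"
  have D: "idim (j i) \<le> D" if "i < k" for i unfolding D_def using that by (intro member_le_sum) auto
  have "\<exists>r>0. \<forall>z\<in>snd ` {\<kappa>\<in>T. fst \<kappa> = j i}. z \<noteq> m i u0 \<longrightarrow> (\<exists>c<idim (j i). r < \<bar>z c - m i u0 c\<bar>)" if i: "i < k" for i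
  proof (rule separating_radius)
    note o = valid_open[OF diffeological_space_axioms jv[OF i]]
    show "finite (snd ` {\<kappa>\<in>T. fst \<kappa> = j i})" using Tf by simp
    show "z c = 0" if "z \<in> snd ` {\<kappa>\<in>T. fst \<kappa> = j i}" "c \<ge> idim (j i)" for z c
    proof -
      from \<open>z \<in> snd ` {\<kappa>\<in>T. fst \<kappa> = j i}\<close> obtain \<kappa> where "\<kappa> \<in> T" "fst \<kappa> = j i" "snd \<kappa> = z" by blast
      then have "z \<in> idom (j i)" using Tv[of \<kappa>] by simp
      then show ?thesis by (rule eopen_zero[OF o _ that(2)])
    qed
    show "m i u0 c = 0" if "c \<ge> idim (j i)" for c by (rule eopen_zero[OF o my[OF i] that])
  qed
  then obtain r where r: "\<And>i. i < k \<Longrightarrow> r i > 0"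
    "\<And>i \<kappa>. i < k \<Longrightarrow> \<kappa> \<in> T \<Longrightarrow> fst \<kappa> = j i \<Longrightarrow> snd \<kappa> \<noteq> m i u0 \<Longrightarrow> \<exists>c<idim (j i). r i < \<bar>snd \<kappa> c - m i u0 c\<bar>"
    by (metis (mono_tags, lifting) imageI mem_Collect_eq)
  define A where "A = real k * (real D * C)"
  have A0: "A \<ge> 0" using C0 by (simp add: A_def)
  \<comment> \<open>small enough for a contraction, for the derivative bounds, and to keep points outside \<open>S\<close> off the set \<open>T\<close>\<close>
  define \<delta> where "\<delta> = Min (insert (1 / (2 * (A + 1))) (eE ` {..<k} \<union> r ` {..<k}))"
  have \<delta>: "\<delta> > 0" "\<delta> \<le> 1 / (2 * (A + 1))" "\<And>i. i < k \<Longrightarrow> \<delta> \<le> eE i" "\<And>i. i < k \<Longrightarrow> \<delta> \<le> r i"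
    unfolding \<delta>_def using eE r(1) A0 by auto
  have A\<delta>: "A * \<delta> < 1"
  proof -
    have "A * \<delta> \<le> A * (1 / (2 * (A + 1)))" using \<delta>(2) A0 by (rule mult_left_mono)
    also have "\<dots> < 1" using A0 by (simp add: field_simps)
    finally show ?thesis .
  qed
  define W where "W = {u\<in>N. \<forall>i\<in>{..<k}. u \<in> {u\<in>N. m i u \<in> ebox (idim (j i)) (m i u0) \<delta>}}"
  have W: "eopen n W" unfolding W_def
    by (rule eopen_finite_inter[OF _ oN smooth_preimage_open[OF jet_repD(4)[OF l] eopen_ebox_self]]) auto
  have WN: "u \<in> N" if "u \<in> W" for u using that by (simp add: W_def)
  have Wm: "m i u \<in> ebox (idim (j i)) (m i u0) \<delta>" if "u \<in> W" "i < k" for u i using that by (simp add: W_def)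
  have u0W: "u0 \<in> W" unfolding W_def using N(1) ebox_center[OF valid_open[OF diffeological_space_axioms jv] my \<delta>(1)] by simp
  have "dipole_support (p u) \<subseteq> S" if u: "u \<in> W" for u
  proof (rule ccontr)
    assume ns: "\<not> dipole_support (p u) \<subseteq> S"
    have uN: "u \<in> N" by (rule WN[OF u])
    have pu: "p u \<in> points V" using plot_in[OF p] uN N(2) by blast
    define P where "P = dipole_support (p u) - S"
    have PL: "\<kappa> \<in> dipole_support (p u)" if "\<kappa> \<in> P" for \<kappa> using that by (simp add: P_def)
    have Lf: "finite (dipole_support (p u))" by (rule dipole_support_finite[OF pu])
    have Pf: "finite P" using Lf by (simp add: P_def)
    have Lm: "\<exists>i<k. \<kappa> = (j i, m i u)" if "\<kappa> \<in> dipole_support (p u)" for \<kappa> using dipole_support_jet_rep[OF l uN] that by blast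
    have cP: "card P \<le> k"
    proof -
      have "P \<subseteq> (\<lambda>i. (j i, m i u)) ` {..<k}" using dipole_support_jet_rep[OF l uN] by (auto simp: P_def)
      then have "card P \<le> card ((\<lambda>i. (j i, m i u)) ` {..<k})" by (intro card_mono) auto
      also have "\<dots> \<le> card {..<k}" by (rule card_image_le) simp
      finally show ?thesis by simp
    qed
    define Q where "Q = (\<lambda>(\<kappa>, c). \<bar>dipole (p u) \<kappa> c\<bar>) ` (P \<times> {..<D})"
    have Qf: "finite Q" using Pf by (simp add: Q_def)
    have small: "c < D" if "\<kappa> \<in> dipole_support (p u)" "dipole (p u) \<kappa> c \<noteq> 0" for \<kappa> c
    proof -
      from Lm[OF that(1)] obtain i where "i < k" "\<kappa> = (j i, m i u)" by blast
      moreover have "c < idim (fst \<kappa>)" using that(2) dipole_zero by blast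
      ultimately show ?thesis using D[of i] by simp
    qed
    obtain \<kappa>1 c1 where k1: "\<kappa>1 \<in> P" "dipole (p u) \<kappa>1 c1 \<noteq> 0" using ns unfolding P_def dipole_support_def by blast
    have Q1: "\<bar>dipole (p u) \<kappa>1 c1\<bar> \<in> Q" unfolding Q_def using k1 small[of \<kappa>1 c1]
      by (intro image_eqI[of _ _ "(\<kappa>1, c1)"]) (auto simp: P_def)
    define \<mu> where "\<mu> = Max Q"
    have \<mu>1: "\<bar>dipole (p u) \<kappa>1 c1\<bar> \<le> \<mu>" unfolding \<mu>_def using Qf Q1 by simp
    then have \<mu>0: "\<mu> > 0" using k1(2) by linarith
    have "\<mu> \<in> Q" unfolding \<mu>_def using Qf Q1 by (intro Max_in) auto
    then obtain \<kappa>0 c0 where k0: "\<kappa>0 \<in> P" "c0 < D" "\<mu> = \<bar>dipole (p u) \<kappa>0 c0\<bar>" by (auto simp: Q_def)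
    have \<mu>: "\<bar>dipole (p u) \<kappa> c\<bar> \<le> \<mu>" if "\<kappa> \<in> P" for \<kappa> c
    proof (cases "dipole (p u) \<kappa> c = 0")
      case False
      then have "\<bar>dipole (p u) \<kappa> c\<bar> \<in> Q" unfolding Q_def using that small[of \<kappa> c]
        by (intro image_eqI[of _ _ "(\<kappa>, c)"]) (auto simp: P_def)
      then show ?thesis unfolding \<mu>_def using Qf by simp
    qed (use \<mu>0 in simp)
    have k0L: "\<kappa>0 \<in> dipole_support (p u)" using k0(1) by (simp add: P_def)
    obtain i0 where i0: "i0 < k" "\<kappa>0 = (j i0, m i0 u)" using Lm[OF k0L] by blast
    have k0T: "\<kappa>0 \<notin> T"
    proof
      assume kT: "\<kappa>0 \<in> T"
      have ne: "m i0 u \<noteq> m i0 u0"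
      proof
        assume "m i0 u = m i0 u0"
        then have "\<kappa>0 \<in> S" using i0 by (auto simp: S_def)
        then show False using k0(1) by (simp add: P_def)
      qed
      have "\<exists>c<idim (j i0). r i0 < \<bar>snd \<kappa>0 c - m i0 u0 c\<bar>" by (rule r(2)[OF i0(1) kT]) (use i0 ne in simp_all)
      then obtain c where "c < idim (j i0)" "r i0 < \<bar>m i0 u c - m i0 u0 c\<bar>" using i0(2) by auto
      then show False using Wm[OF u i0(1)] \<delta>(4)[OF i0(1)] by (auto simp: ebox_def)
    qed
    have k0v: "valid V (fst \<kappa>0)" "snd \<kappa>0 \<in> idom (fst \<kappa>0)" using dipole_support_valid[OF k0L] by auto
    obtain \<xi> where \<xi>: "smooth_test V \<xi>" "\<forall>\<kappa>. \<bar>\<xi> \<kappa>\<bar> \<le> 1" "\<xi> \<kappa>0 = 1" "\<forall>\<kappa>\<in>T \<union> dipole_support (p u). \<kappa> \<noteq> \<kappa>0 \<longrightarrow> \<xi> \<kappa> = 0"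
      using isolating_bump[of "T \<union> dipole_support (p u)" \<kappa>0] Tf Lf Tv dipole_support_valid k0v by blast
    have \<xi>T: "\<forall>\<kappa>\<in>SS i. \<xi> \<kappa> = 0" if "i < k" for i
    proof
      fix \<kappa> assume "\<kappa> \<in> SS i"
      then have "\<kappa> \<in> T" using that by (auto simp: T_def)
      then have "\<kappa> \<noteq> \<kappa>0" "\<kappa> \<in> T \<union> dipole_support (p u)" using k0T by auto
      then show "\<xi> \<kappa> = 0" using bspec[OF \<xi>(4)] by simp
    qed
    let ?g = "\<lambda>\<kappa> c. pd c (\<lambda>z. dipole_sum \<xi> c0 (imap (fst \<kappa>) z)) (snd \<kappa>)"
    have gS: "?g \<kappa> c = 0" if "\<kappa> \<in> S" "c < idim (fst \<kappa>)" for \<kappa> c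
    proof -
      from that(1) obtain i where i: "i < k" "\<kappa> = (j i, m i u0)" by (auto simp: S_def)
      have "\<bar>?g \<kappa> c\<bar> \<le> CC i * e'" if e': "0 < e'" "e' \<le> eE i" for e'
        using bound[OF i(1) \<xi>(1,2) \<xi>T[OF i(1)] e'(2) ebox_center[OF valid_open[OF diffeological_space_axioms jv[OF i(1)]] my[OF i(1)] e'(1)]]
          \<open>c < idim (fst \<kappa>)\<close> by (simp add: i(2))
      note small = this
      have "\<bar>?g \<kappa> c\<bar> \<le> 0 + x" if x: "x > 0" for x
      proof -
        define e' where "e' = min (eE i) (x / (CC i + 1))"
        have e': "0 < e'" "e' \<le> eE i" "e' \<le> x / (CC i + 1)" using eE[OF i(1)] CC[OF i(1)] x by (auto simp: e'_def)
        have "CC i * e' \<le> CC i * (x / (CC i + 1))" using e'(3) CC[OF i(1)] by (rule mult_left_mono)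
        also have "\<dots> \<le> x" using CC[OF i(1)] x by (simp add: field_simps)
        finally show ?thesis using small[OF e'(1,2)] by simp
      qed
      then have "\<bar>?g \<kappa> c\<bar> \<le> 0" by (rule field_le_epsilon)
      then show ?thesis by simp
    qed
    have gP: "\<bar>?g \<kappa> c\<bar> \<le> C * \<delta>" if "\<kappa> \<in> P" "c < idim (fst \<kappa>)" for \<kappa> c
    proof -
      from Lm[OF PL[OF that(1)]] obtain i where i: "i < k" "\<kappa> = (j i, m i u)" by blast
      have "\<bar>?g \<kappa> c\<bar> \<le> CC i * \<delta>"
        using bound[OF i(1) \<xi>(1,2) \<xi>T[OF i(1)] \<delta>(3)[OF i(1)] Wm[OF u i(1)]] that(2) by (simp add: i(2))
      also have "\<dots> \<le> C * \<delta>" using C[OF i(1)] \<delta>(1) by (simp add: mult_right_mono)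
      finally show ?thesis .
    qed
    have "dipole (p u) \<kappa>0 c0 = dipole_sum \<xi> c0 (p u)"
    proof (rule dipole_sum_isolated[of "p u" \<xi> \<kappa>0 c0, OF pu \<xi>(3), symmetric])
      show "\<xi> \<kappa> = 0" if "\<kappa> \<in> dipole_support (p u)" "\<kappa> \<noteq> \<kappa>0" for \<kappa> using bspec[OF \<xi>(4), of \<kappa>] that by simp
    qed
    also have "\<dots> = (\<Sum>\<kappa>\<in>dipole_support (p u). \<Sum>c<idim (fst \<kappa>). dipole (p u) \<kappa> c * ?g \<kappa> c)"
      by (rule linear_by_dipoles[OF pu dipole_sum_linear dipole_sum_smooth[OF \<xi>(1)] Lf subset_refl])
    also have "\<dots> = (\<Sum>\<kappa>\<in>P. \<Sum>c<idim (fst \<kappa>). dipole (p u) \<kappa> c * ?g \<kappa> c)"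
      by (rule sum.mono_neutral_right[OF Lf]) (use gS in \<open>auto simp: P_def\<close>)
    finally have "\<mu> = \<bar>\<Sum>\<kappa>\<in>P. \<Sum>c<idim (fst \<kappa>). dipole (p u) \<kappa> c * ?g \<kappa> c\<bar>" using k0(3) by simp
    also have "\<dots> \<le> (\<Sum>\<kappa>\<in>P. \<bar>\<Sum>c<idim (fst \<kappa>). dipole (p u) \<kappa> c * ?g \<kappa> c\<bar>)" by (rule sum_abs)
    also have "\<dots> \<le> (\<Sum>\<kappa>\<in>P. real D * (\<mu> * (C * \<delta>)))"
    proof (rule sum_mono)
      fix \<kappa> assume \<kappa>: "\<kappa> \<in> P"
      obtain i where i: "i < k" "\<kappa> = (j i, m i u)" using Lm[OF PL[OF \<kappa>]] by blast
      have "\<bar>\<Sum>c<idim (fst \<kappa>). dipole (p u) \<kappa> c * ?g \<kappa> c\<bar> \<le> (\<Sum>c<idim (fst \<kappa>). \<bar>dipole (p u) \<kappa> c * ?g \<kappa> c\<bar>)" by (rule sum_abs)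
      also have "\<dots> \<le> (\<Sum>c<idim (fst \<kappa>). \<mu> * (C * \<delta>))"
        unfolding abs_mult by (intro sum_mono mult_mono) (use \<mu>[OF \<kappa>] gP[OF \<kappa>] \<mu>0 in auto)
      also have "\<dots> = real (idim (fst \<kappa>)) * (\<mu> * (C * \<delta>))" by simp
      also have "\<dots> \<le> real D * (\<mu> * (C * \<delta>))"
        using D[OF i(1)] i(2) \<mu>0 C0 \<delta>(1) by (intro mult_right_mono) auto
      finally show "\<bar>\<Sum>c<idim (fst \<kappa>). dipole (p u) \<kappa> c * ?g \<kappa> c\<bar> \<le> real D * (\<mu> * (C * \<delta>))" .
    qed
    also have "\<dots> = real (card P) * (real D * (\<mu> * (C * \<delta>)))" by simp
    also have "\<dots> \<le> real k * (real D * (\<mu> * (C * \<delta>)))"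
      using cP \<mu>0 C0 \<delta>(1) by (intro mult_right_mono) auto
    also have "\<dots> = \<mu> * (A * \<delta>)" by (simp add: A_def)
    also have "\<dots> < \<mu> * 1" using A\<delta> \<mu>0 by (rule mult_strict_left_mono)
    finally show False by simp
  qed
  then show ?thesis using W u0W WN N(2) Sf Sv by (intro exI[of _ W] exI[of _ S]) auto
qed

text \<open>
  The dipole coefficients at the points of the finite set \<open>S\<close> separate the vectors whose dipoles lie in \<open>S\<close>.  On
  these vectors they agree with the functionals given by bumps that isolate the points of \<open>S\<close>, which are smooth.
\<close>

theorem locally_finite_plot:
  assumes p: "plot V n U p" and u0: "u0 \<in> U"
  shows "\<exists>W m f w. eopen n W \<and> u0 \<in> W \<and> W \<subseteq> U \<and> (\<forall>t<m::nat. smooth_fun_on n W (f t) \<and> w t \<in> points V) \<and>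
    (\<forall>u\<in>W. p u = (\<Sum>t<m. f t u *\<^sub>R w t))"
proof -
  obtain W S where W: "eopen n W" "u0 \<in> W" "W \<subseteq> U" and S1: "finite S"
    and S2: "\<forall>\<kappa>\<in>S. valid V (fst \<kappa>) \<and> snd \<kappa> \<in> idom (fst \<kappa>)" and L': "\<forall>u\<in>W. dipole_support (p u) \<subseteq> S"
    using dipole_support_locally_finite[OF p u0] by (elim exE conjE)
  note L = bspec[OF L'] and S = S1 bspec[OF S2]
  have "\<exists>\<xi>. smooth_test V \<xi> \<and> \<xi> \<kappa> = 1 \<and> (\<forall>\<kappa>'\<in>S. \<kappa>' \<noteq> \<kappa> \<longrightarrow> \<xi> \<kappa>' = 0)" if "\<kappa> \<in> S" for \<kappa>
    using isolating_bump[OF S, of \<kappa>] S(2)[OF that] by blast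
  then obtain \<xi> where \<xi>: "\<And>\<kappa>. \<kappa> \<in> S \<Longrightarrow> smooth_test V (\<xi> \<kappa>) \<and> \<xi> \<kappa> \<kappa> = 1 \<and> (\<forall>\<kappa>'\<in>S. \<kappa>' \<noteq> \<kappa> \<longrightarrow> \<xi> \<kappa> \<kappa>' = 0)" by metis
  define I where "I = (SIGMA \<kappa>:S. {..<idim (fst \<kappa>)})"
  have If: "finite I" using S(1) by (simp add: I_def)
  define m where "m = card I"
  obtain h where h: "bij_betw h {0..<m} I" using ex_bij_betw_nat_finite[OF If] by (auto simp: m_def)
  have hI: "h t \<in> I" if "t < m" for t using h that by (auto simp: bij_betw_def)
  define g where "g t = dipole_sum (\<xi> (fst (h t))) (snd (h t))" for t
  define A where "A = {v\<in>points V. dipole_support v \<subseteq> S}"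
  have A: "subspace A"
    unfolding subspace_def
  proof (intro conjI ballI allI)
    have V0: "0 \<in> points V" by (rule subspace_0[OF points_subspace])
    have "dipole 0 \<kappa> c = 0" for \<kappa> c using dipole_scale[OF V0, of 0 \<kappa> c] by simp
    then show "0 \<in> A" using V0 by (simp add: A_def dipole_support_def)
    fix v w assume v: "v \<in> A" and w: "w \<in> A"
    have "dipole_support (v + w) \<subseteq> dipole_support v \<union> dipole_support w" using dipole_add[of v w] v w by (fastforce simp: dipole_support_def A_def)
    then show "v + w \<in> A" using v w subspace_add[OF points_subspace] by (auto simp: A_def)
  next
    fix c v assume v: "v \<in> A"
    have "dipole_support (c *\<^sub>R v) \<subseteq> dipole_support v" using dipole_scale[of v c] v by (fastforce simp: dipole_support_def A_def)
    then show "c *\<^sub>R v \<in> A" using v subspace_scale[OF points_subspace] by (auto simp: A_def)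
  qed
  have "\<exists>w. (\<forall>t<m. w t \<in> A) \<and> (\<forall>v\<in>A. v = (\<Sum>t<m. g t v *\<^sub>R w t))"
  proof (rule left_inverse_of_functionals[OF A])
    show "g t (v + w) = g t v + g t w" if "v \<in> A" "w \<in> A" for t v w
      using dipole_sum_linear that unfolding g_def lin_on_def A_def by blast
    show "g t (r *\<^sub>R v) = r * g t v" if "v \<in> A" for t v r
      using dipole_sum_linear that unfolding g_def lin_on_def A_def by blast
    fix v assume v: "v \<in> A" and z: "\<And>t. t < m \<Longrightarrow> g t v = 0"
    have vV: "v \<in> points V" and vS: "dipole_support v \<subseteq> S" using v by (auto simp: A_def)
    have "dipole v \<kappa> c = 0" for \<kappa> c
    proof (cases "\<kappa> \<in> S \<and> c < idim (fst \<kappa>)")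
      case True
      then have "(\<kappa>, c) \<in> I" by (simp add: I_def)
      then obtain t where t: "t < m" "h t = (\<kappa>, c)" using h by (auto simp: bij_betw_def)
      have "dipole_sum (\<xi> \<kappa>) c v = dipole v \<kappa> c" by (rule dipole_sum_isolated[OF vV]) (use \<xi>[of \<kappa>] True vS in auto)
      then show ?thesis using z[OF t(1)] t(2) by (simp add: g_def)
    next
      case False
      then show ?thesis using vS dipole_zero[of \<kappa> c v] unfolding dipole_support_def by blast
    qed
    then show "v = 0" by (intro dipole_injective[OF vV]) (simp add: dipole_support_def)
  qed
  then obtain w where w: "\<And>t. t < m \<Longrightarrow> w t \<in> A" "\<And>v. v \<in> A \<Longrightarrow> v = (\<Sum>t<m. g t v *\<^sub>R w t)" by blast
  have "p u = (\<Sum>t<m. g t (p u) *\<^sub>R w t)" if "u \<in> W" for u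
    by (rule w(2)) (use that plot_in[OF p] W(3) L[OF that] in \<open>auto simp: A_def\<close>)
  moreover have "smooth_fun_on n W (\<lambda>u. g t (p u))" if t: "t < m" for t
  proof -
    have "fst (h t) \<in> S" using hI[OF t] by (auto simp: I_def)
    then have "smooth_test V (\<xi> (fst (h t)))" using \<xi> by blast
    from dipole_sum_smooth[OF this, rule_format, OF plot_restrict[OF p W(1,3)]] show ?thesis unfolding g_def .
  qed
  ultimately show ?thesis using W w(1) unfolding A_def
    by (intro exI[of _ W] exI[of _ m] exI[of _ "\<lambda>t u. g t (p u)"] exI[of _ w]) auto
qed

end

section \<open>Locally finite-dimensional plots and projectivity\<close>

text \<open>
  Equivalently, \<open>V\<close> carries the fine diffeology, the smallest one that makes it a diffeological vector space.
\<close>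

definition plots_locally_finite :: "'v::real_vector dspace \<Rightarrow> bool" where
  "plots_locally_finite V \<longleftrightarrow> (\<forall>n U p u. plot V n U p \<longrightarrow> u \<in> U \<longrightarrow>
     (\<exists>W (m::nat) f w. eopen n W \<and> u \<in> W \<and> W \<subseteq> U \<and> (\<forall>t<m. smooth_fun_on n W (f t) \<and> w t \<in> points V) \<and>
        (\<forall>v\<in>W. p v = (\<Sum>t<m. f t v *\<^sub>R w t))))"

lemma eopen_point: "eopen 0 {\<lambda>_. 0}"
proof -
  have "ebox 0 (\<lambda>_. 0) 1 \<subseteq> {\<lambda>_. 0}" by (auto simp: ebox_def fun_eq_iff)
  then show ?thesis unfolding eopen_iff by (intro conjI ballI exI[of _ 1]) auto
qed

text \<open>
  Lift a constant plot whose domain is the single point of \<open>\<real>\<^sup>0\<close>.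
\<close>

lemma subduction_surj:
  assumes W2: "diffeological_space W\<^sub>2" and \<pi>: "subduction W\<^sub>1 W\<^sub>2 \<pi>" and W1: "diffeological_space W\<^sub>1" and y: "y \<in> points W\<^sub>2"
  shows "\<exists>x\<in>points W\<^sub>1. \<pi> x = y"
proof -
  have o: "eopen 0 {\<lambda>_. 0}" by (rule eopen_point)
  have "plot W\<^sub>2 0 {\<lambda>_. 0} (\<lambda>_. y)" by (rule diffeological_space.plot_const[OF W2 o y])
  then have "locally_lifts W\<^sub>1 \<pi> 0 {\<lambda>_. 0} (\<lambda>_. y)" using \<pi> by (simp add: subduction_def)
  then obtain V p where V: "(\<lambda>_. 0) \<in> V" "plot W\<^sub>1 0 V p" "\<forall>v\<in>V. y = \<pi> (p v)"
    unfolding locally_lifts_def by blast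
  have "p (\<lambda>_. 0) \<in> points W\<^sub>1" by (rule diffeological_space.plot_in[OF W1 V(2,1)])
  then show ?thesis using bspec[OF V(3) V(1)] by (intro bexI[of _ "p (\<lambda>_. 0)"]) simp_all
qed

lemma linear_smooth_if_locally_finite:
  assumes V: "diffeological_vector_space V" and locally_finite: "plots_locally_finite V" and W: "diffeological_vector_space W"
    and g: "linear g" and gW: "\<And>v. v \<in> points V \<Longrightarrow> g v \<in> points W"
  shows "smooth_linear V W g"
proof -
  interpret V: dvs V by (rule dvs_intro[OF V])
  interpret W: dvs W by (rule dvs_intro[OF W])
  have "smooth_map V W g"
  proof (rule smooth_mapI[OF gW])
    fix n U p assume p: "plot V n U p"
    show "plot W n U (\<lambda>u. g (p u))"
    proof (rule W.plot_local[OF V.plot_domain[OF p]])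
      fix u assume u: "u \<in> U"
      from locally_finite[unfolded plots_locally_finite_def, rule_format, OF p u]
      obtain N f w and m :: nat where N: "eopen n N" "u \<in> N" "N \<subseteq> U"
        and fw': "\<forall>t<m. smooth_fun_on n N (f t) \<and> w t \<in> points V" and pe': "\<forall>v\<in>N. p v = (\<Sum>t<m. f t v *\<^sub>R w t)"
        by (elim exE conjE)
      note pe = bspec[OF pe']
      have fw: "smooth_fun_on n N (f t)" "w t \<in> points V" if "t < m" for t using fw' that by simp_all
      have "plot W n N (\<lambda>v. \<Sum>t<m. f t v *\<^sub>R g (w t))"
        by (intro W.plot_sum N W.plot_scale fw W.plot_const gW)
      moreover have "g (p v) = (\<Sum>t<m. f t v *\<^sub>R g (w t))" if "v \<in> N" for v
        using pe[OF that] linear_sum[OF g, of "\<lambda>t. f t v *\<^sub>R w t" "{..<m}"] linear_cmul[OF g] by simp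
      ultimately have "plot W n N (\<lambda>u. g (p u))" by (rule W.plot_cong)
      then show "\<exists>N. eopen n N \<and> u \<in> N \<and> N \<subseteq> U \<and> plot W n N (\<lambda>u. g (p u))" using N by blast
    qed
  qed
  then show ?thesis unfolding smooth_linear_def using linear_add[OF g] linear_cmul[OF g] by blast
qed

text \<open>
  Lift the images of the members of a Hamel basis one by one, and extend linearly.
\<close>

lemma projective_if_locally_finite:
  fixes V :: "'v::real_vector dspace"
  assumes V: "diffeological_vector_space V" and locally_finite: "plots_locally_finite V"
  shows "projective TYPE('a::real_vector \<times> 'b::real_vector) V"
  unfolding projective_def
proof (intro allI impI, elim conjE)
  fix W1 :: "'a dspace" and W2 :: "'b dspace" and \<pi> f
  assume W1: "diffeological_vector_space W1" and W2: "diffeological_vector_space W2"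
    and \<pi>: "smooth_linear W1 W2 \<pi>" and sub: "subduction W1 W2 \<pi>" and f: "smooth_linear V W2 f"
  interpret V: dvs V by (rule dvs_intro[OF V])
  interpret W1: dvs W1 by (rule dvs_intro[OF W1])
  interpret W2: dvs W2 by (rule dvs_intro[OF W2])
  obtain B where B: "B \<subseteq> points V" "independent B" "points V \<subseteq> span B"
    using maximal_independent_subset[of "points V"] by blast
  have spB: "span B = points V" using B(1,3) span_minimal[OF B(1) V.points_subspace] by blast
  have "\<forall>b\<in>B. \<exists>x\<in>points W1. \<pi> x = f b"
  proof
    fix b assume "b \<in> B"
    then have "b \<in> points V" using B(1) by blast
    then have "f b \<in> points W2" using f smooth_map_point[of V W2 f b] by (simp add: smooth_linear_def)
    then show "\<exists>x\<in>points W1. \<pi> x = f b"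
      by (rule subduction_surj[OF W2.diffeological_space_axioms sub W1.diffeological_space_axioms])
  qed
  then obtain l where l: "\<And>b. b \<in> B \<Longrightarrow> l b \<in> points W1" "\<And>b. b \<in> B \<Longrightarrow> \<pi> (l b) = f b"
    using bchoice[of B] by metis
  from linear_independent_extend[OF B(2), of l]
  obtain g where g: "linear g" and gl: "\<And>b. b \<in> B \<Longrightarrow> g b = l b" by blast
  have both: "v \<in> points V \<and> g v \<in> points W1 \<and> \<pi> (g v) = f v" if "v \<in> span B" for v
    using that
  proof (induction rule: span_induct_alt)
    case base
    have "\<pi> (0 *\<^sub>R 0) = 0 *\<^sub>R \<pi> 0" "f (0 *\<^sub>R 0) = 0 *\<^sub>R f 0"
      using \<pi> f subspace_0[OF W1.points_subspace] subspace_0[OF V.points_subspace] unfolding smooth_linear_def by blast+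
    then show ?case using subspace_0[OF W1.points_subspace] subspace_0[OF V.points_subspace] linear_0[OF g] by simp
  next
    case (step c b v)
    have bV: "b \<in> points V" and vV: "v \<in> points V" using step(1,2) B(1) by auto
    have cV: "c *\<^sub>R b + v \<in> points V" by (rule subspace_add[OF V.points_subspace subspace_scale[OF V.points_subspace bV] vV])
    have gb: "g b \<in> points W1" "\<pi> (g b) = f b" using l gl step(1) by auto
    have gv: "g v \<in> points W1" "\<pi> (g v) = f v" using step by auto
    note cb = subspace_scale[OF W1.points_subspace gb(1), of c]
    have e: "g (c *\<^sub>R b + v) = c *\<^sub>R g b + g v" using linear_add[OF g] linear_cmul[OF g] by simp
    have "\<pi> (c *\<^sub>R g b + g v) = \<pi> (c *\<^sub>R g b) + \<pi> (g v)" using \<pi> cb gv(1) unfolding smooth_linear_def by blast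
    also have "\<pi> (c *\<^sub>R g b) = c *\<^sub>R \<pi> (g b)" using \<pi> gb(1) unfolding smooth_linear_def by blast
    finally have 1: "\<pi> (c *\<^sub>R g b + g v) = c *\<^sub>R f b + f v" by (simp add: gb gv)
    have "f (c *\<^sub>R b + v) = f (c *\<^sub>R b) + f v"
      using f subspace_scale[OF V.points_subspace bV] vV unfolding smooth_linear_def by blast
    also have "f (c *\<^sub>R b) = c *\<^sub>R f b" using f bV unfolding smooth_linear_def by blast
    finally show ?case unfolding e using 1 cV subspace_add[OF W1.points_subspace cb gv(1)] by simp
  qed
  have "smooth_linear V W1 g" by (rule linear_smooth_if_locally_finite[OF V locally_finite W1 g]) (use both spB in blast)
  then show "\<exists>g. smooth_linear V W1 g \<and> (\<forall>x\<in>points V. f x = \<pi> (g x))"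
    using both spB by (intro exI[of _ g]) auto
qed

lemma universal_bundle_nontrivial:
  fixes V :: "'v::real_vector dspace"
  assumes V: "diffeological_vector_space V" and np: "\<not> projective TYPE('a::real_vector \<times> 'b::real_vector) V"
  shows "\<not> trivial_bundle (kernel_space V) V (universal_bundle V)"
proof
  assume t: "trivial_bundle (kernel_space V) V (universal_bundle V)"
  interpret V: dvs V by (rule dvs_intro[OF V])
  from universal_bundle_section[OF V.diffeological_space_axioms t] obtain s
    where s: "smooth_map V (free_space V) s" "\<And>v f. v \<in> points V \<Longrightarrow> ev (f \<circ> plot_value) (s v) = f v" by blast
  interpret plot_section V s by unfold_locales (use s in auto)
  have "plots_locally_finite V" unfolding plots_locally_finite_def using locally_finite_plot by blast
  from projective_if_locally_finite[OF V this, where ?'a = 'a and ?'b = 'b] np show False by simp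
qed

section \<open>Smooth homotopy\<close>

lemma eopen_superlevel:
  assumes U: "eopen n U" and f: "continuous_on U f"
  shows "eopen n {u\<in>U. c < (f u :: real)}"
  unfolding eopen_iff
proof (intro conjI ballI)
  show "{u\<in>U. c < f u} \<subseteq> {x. \<forall>i\<ge>n. x i = 0}" using U unfolding eopen_iff by blast
  fix u assume u: "u \<in> {u\<in>U. c < f u}"
  then have "u \<in> U" "f u - c > 0" by simp_all
  from continuous_ebox[OF U f this] obtain d where d: "d > 0" "ebox n u d \<subseteq> U" "\<forall>y\<in>ebox n u d. \<bar>f y - f u\<bar> < f u - c"
    by blast
  have "ebox n u d \<subseteq> {u\<in>U. c < f u}" using d by fastforce
  then show "\<exists>e>0. ebox n u e \<subseteq> {u\<in>U. c < f u}" using d(1) by blast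
qed

lemma plot_real: "plot real_dspace n U t \<longleftrightarrow> smooth_fun_on n U t"
  by (simp add: real_dspace_def)

lemma real_dspace_diffeological: "diffeological_space real_dspace"
proof
  show "plot real_dspace m V (p \<circ> h)" if "plot real_dspace n U p" "smooth_euclidean m V n U h" for n U p m V h
    using that smooth_euclidean_compose_fun[of m V n U h p] by (simp add: plot_real o_def)
  show "plot real_dspace n U p" if "eopen n U" "\<And>u. u \<in> U \<Longrightarrow> \<exists>V. eopen n V \<and> u \<in> V \<and> V \<subseteq> U \<and> plot real_dspace n V p" for n U p
    using that smooth_local[of n U p] by (simp add: plot_real)
qed (auto simp: real_dspace_def intro: smooth_open smooth_const smooth_cong)

lemma smoothly_homotopicI:
  assumes "smooth_map X Z f" "smooth_map X Z g" "smooth_map (prod_dspace X real_dspace) Z F"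
    "\<And>x. x \<in> points X \<Longrightarrow> F (x, 0) = f x" "\<And>x. x \<in> points X \<Longrightarrow> F (x, 1) = g x"
  shows "smoothly_homotopic X Z f g"
  unfolding smoothly_homotopic_def using assms by blast

lemma reparametrize:
  assumes F: "smooth_map (prod_dspace X real_dspace) Z F"
    and a: "\<And>n U t. smooth_fun_on n U t \<Longrightarrow> smooth_fun_on n U (\<lambda>u. a (t u))"
  shows "smooth_map (prod_dspace X real_dspace) Z (\<lambda>z. F (fst z, a (snd z)))"
proof (rule smooth_mapI)
  show "F (fst z, a (snd z)) \<in> points Z" if "z \<in> points (prod_dspace X real_dspace)" for z
    using smooth_map_point[OF F, of "(fst z, a (snd z))"] that by (auto simp: points_prod real_dspace_def)
  show "plot Z n U (\<lambda>u. F (fst (p u), a (snd (p u))))" if "plot (prod_dspace X real_dspace) n U p" for n U p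
    by (rule smooth_map_plot[OF F]) (use that a in \<open>simp add: plot_prod_iff plot_real\<close>)
qed

lemma homotopic_sym: assumes "smoothly_homotopic X Z f g" shows "smoothly_homotopic X Z g f"
proof -
  obtain F where fg: "smooth_map X Z f" "smooth_map X Z g" and F: "smooth_map (prod_dspace X real_dspace) Z F"
    and F01: "\<And>x. x \<in> points X \<Longrightarrow> F (x, 0) = f x \<and> F (x, 1) = g x"
    using assms unfolding smoothly_homotopic_def by blast
  have "smooth_map (prod_dspace X real_dspace) Z (\<lambda>z. F (fst z, 1 - snd z))"
    by (rule reparametrize[OF F]) (rule smooth_diff[OF smooth_const[OF smooth_open]])
  then show ?thesis by (rule smoothly_homotopicI[OF fg(2,1)]) (simp_all add: F01)
qed

text \<open>
  Reparametrise so that the first homotopy is stationary from time \<open>1/3\<close> on and the second until time \<open>2/3\<close>.  Between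
  these times both equal \<open>g\<close>, so that the two halves overlap in an open set and glue to a smooth map.
\<close>

lemma homotopic_trans:
  assumes Z: "diffeological_space Z" and X: "diffeological_space X"
    and "smoothly_homotopic X Z f g" "smoothly_homotopic X Z g h"
  shows "smoothly_homotopic X Z f h"
proof -
  interpret Z: diffeological_space Z by fact
  interpret X: diffeological_space X by fact
  let ?P = "prod_dspace X real_dspace"
  obtain F where f: "smooth_map X Z f" and F: "smooth_map ?P Z F"
    and F01: "\<And>x. x \<in> points X \<Longrightarrow> F (x, 0) = f x \<and> F (x, 1) = g x"
    using assms(3) unfolding smoothly_homotopic_def by blast
  obtain G where h: "smooth_map X Z h" and G: "smooth_map ?P Z G"
    and G01: "\<And>x. x \<in> points X \<Longrightarrow> G (x, 0) = g x \<and> G (x, 1) = h x"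
    using assms(4) unfolding smoothly_homotopic_def by blast
  \<comment> \<open>normalises the time changes so that they start at \<open>0\<close> and end at \<open>1\<close>\<close>
  define K where "K = inverse (flat_exp 0 (1 / 3))"
  have K: "K * flat_exp 0 (1 / 3) = 1" by (simp add: K_def flat_exp_def)
  define a where "a t = 1 - K * flat_exp 0 (1 / 3 - t)" for t
  define b where "b t = K * flat_exp 0 (t - 2 / 3)" for t
  have a: "a 0 = 0" "\<And>t. t \<ge> 1 / 3 \<Longrightarrow> a t = 1" using K by (simp_all add: a_def flat_exp_def)
  have b: "b 1 = 1" "\<And>t. t \<le> 2 / 3 \<Longrightarrow> b t = 0" using K by (simp_all add: b_def flat_exp_def)
  have Fa: "smooth_map ?P Z (\<lambda>z. F (fst z, a (snd z)))"
    unfolding a_def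
    by (rule reparametrize[OF F])
      (intro smooth_diff smooth_mult smooth_flat_exp smooth_const, (erule smooth_open | assumption)+)
  have Gb: "smooth_map ?P Z (\<lambda>z. G (fst z, b (snd z)))"
    unfolding b_def
    by (rule reparametrize[OF G])
      (intro smooth_diff smooth_mult smooth_flat_exp smooth_const, (erule smooth_open | assumption)+)
  define H where "H z = (if snd z < 1 / 2 then F (fst z, a (snd z)) else G (fst z, b (snd z)))" for z
  have HF: "H z = F (fst z, a (snd z))" if "fst z \<in> points X" "snd z < 2 / 3" for z
    using that a(2)[of "snd z"] b(2)[of "snd z"] F01[of "fst z"] G01[of "fst z"] by (simp add: H_def)
  have HG: "H z = G (fst z, b (snd z))" if "fst z \<in> points X" "1 / 3 < snd z" for z
    using that a(2)[of "snd z"] b(2)[of "snd z"] F01[of "fst z"] G01[of "fst z"] by (simp add: H_def)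
  have "smooth_map ?P Z H"
  proof (rule smooth_mapI)
    show "H z \<in> points Z" if "z \<in> points ?P" for z
      using smooth_map_point[OF Fa that] smooth_map_point[OF Gb that] by (simp add: H_def)
    fix n U p assume p: "plot ?P n U p"
    then have x: "plot X n U (\<lambda>u. fst (p u))" and t: "smooth_fun_on n U (\<lambda>u. snd (p u))"
      by (simp_all add: plot_prod_iff plot_real)
    have U: "eopen n U" by (rule smooth_open[OF t])
    have P: "diffeological_space ?P"
      by (intro prod_dspace_diffeological X) (rule real_dspace_diffeological)
    have o1: "eopen n {u\<in>U. - 2 / 3 < - snd (p u)}" 
      by (rule eopen_superlevel[OF U]) (intro continuous_on_minus smooth_continuous[OF t])
    have o2: "eopen n {u\<in>U. 1 / 3 < snd (p u)}" by (rule eopen_superlevel[OF U smooth_continuous[OF t]])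
    have p1: "plot ?P n {u\<in>U. - 2 / 3 < - snd (p u)} p" "plot ?P n {u\<in>U. 1 / 3 < snd (p u)} p"
      by (rule diffeological_space.plot_restrict[OF P p o1], blast, rule diffeological_space.plot_restrict[OF P p o2], blast)
    have q1: "plot Z n {u\<in>U. - 2 / 3 < - snd (p u)} (\<lambda>u. H (p u))"
      by (rule Z.plot_cong[OF smooth_map_plot[OF Fa p1(1)]]) (use X.plot_in[OF x] HF in auto)
    have q2: "plot Z n {u\<in>U. 1 / 3 < snd (p u)} (\<lambda>u. H (p u))"
      by (rule Z.plot_cong[OF smooth_map_plot[OF Gb p1(2)]]) (use X.plot_in[OF x] HG in auto)
    show "plot Z n U (\<lambda>u. H (p u))"
    proof (rule Z.plot_local[OF U])
      fix u assume u: "u \<in> U"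
      show "\<exists>N. eopen n N \<and> u \<in> N \<and> N \<subseteq> U \<and> plot Z n N (\<lambda>u. H (p u))"
      proof (cases "1 / 3 < snd (p u)")
        case True
        then show ?thesis using u by (intro exI[of _ "{u\<in>U. 1 / 3 < snd (p u)}"] conjI o2 q2) auto
      next
        case False
        then show ?thesis using u by (intro exI[of _ "{u\<in>U. - 2 / 3 < - snd (p u)}"] conjI o1 q1) auto
      qed
    qed
  qed
  then show ?thesis
  proof (rule smoothly_homotopicI[OF f h])
    show "H (x, 0) = f x" "H (x, 1) = h x" if "x \<in> points X" for x
      using that a(1) b(1) F01 G01 by (simp_all add: H_def)
  qed
qed

text \<open>
  Scaling by \<open>1 - t\<close> contracts \<open>V\<close> to its zero vector.
\<close>

lemma precompose_scaling_homotopic: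
  assumes V: "diffeological_vector_space V" and k: "smooth_map V Z k"
  shows "smoothly_homotopic V Z (k \<circ> id) (k \<circ> (\<lambda>_. 0))"
proof -
  interpret dvs V by (rule dvs_intro[OF V])
  have V0: "0 \<in> points V" by (rule subspace_0[OF points_subspace])
  have c: "smooth_map V V (\<lambda>_. 0)" by (rule smooth_mapI) (auto intro: V0 plot_const plot_domain)
  have s: "smooth_map (prod_dspace V real_dspace) V (\<lambda>z. (1 - snd z) *\<^sub>R fst z)"
  proof (rule smooth_mapI)
    show "(1 - snd z) *\<^sub>R fst z \<in> points V" if "z \<in> points (prod_dspace V real_dspace)" for z
      using that by (intro subspace_scale[OF points_subspace]) (auto simp: points_prod)
    show "plot V n U (\<lambda>u. (1 - snd (p u)) *\<^sub>R fst (p u))" if "plot (prod_dspace V real_dspace) n U p" for n U p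
      using that by (intro plot_scale smooth_diff smooth_const) (auto simp: plot_prod_iff plot_real intro: smooth_open)
  qed
  show ?thesis
  proof (rule smoothly_homotopicI)
    show "smooth_map V Z (k \<circ> id)" using k by simp
    show "smooth_map V Z (k \<circ> (\<lambda>_. 0))" using smooth_map_compose[OF c k] by (simp add: o_def)
    show "smooth_map (prod_dspace V real_dspace) Z (\<lambda>z. k ((1 - snd z) *\<^sub>R fst z))" by (rule smooth_map_compose[OF s k])
  qed simp_all
qed

lemma precompose_id_const:
  assumes V: "diffeological_vector_space V" and Z: "diffeological_space Z" and d: "d \<in> homotopy_classes V Z"
  shows "precompose_class V Z id d = precompose_class V Z (\<lambda>_. 0) d"
proof -
  have Vd: "diffeological_space V" using V by (simp add: diffeological_vector_space_def)
  have h: "smoothly_homotopic V Z (k \<circ> id) (k \<circ> (\<lambda>_. 0))" if "k \<in> d" for k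
  proof (rule precompose_scaling_homotopic[OF V])
    show "smooth_map V Z k" using d that unfolding homotopy_classes_def quotient_def smoothly_homotopic_def by blast
  qed
  show ?thesis
    unfolding precompose_class_def
    using homotopic_trans[OF Z Vd homotopic_sym[OF h]] homotopic_trans[OF Z Vd h] by blast
qed

section \<open>Isomorphism classes of bundles\<close>

lemma bundle_isomorphic_refl:
  assumes "fibrewise_action G B E" shows "bundle_isomorphic G E E"
  by (rule bundle_isomorphicI[where f = "\<lambda>x. x" and g = "\<lambda>x. x"]) (simp_all add: smooth_map_def image_subset_iff o_def)

lemma bundle_isomorphic_sym:
  assumes E: "fibrewise_action G B E" and i: "bundle_isomorphic G E F"
  shows "bundle_isomorphic G F E"
proof -
  obtain f g where f: "smooth_map (total_space E) (total_space F) f" and g: "smooth_map (total_space F) (total_space E) g"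
    and gf: "\<And>x. x \<in> points (total_space E) \<Longrightarrow> g (f x) = x" and fg: "\<And>y. y \<in> points (total_space F) \<Longrightarrow> f (g y) = y"
    and pr: "\<And>x. x \<in> points (total_space E) \<Longrightarrow> proj F (f x) = proj E x"
    and eq: "\<And>x h. x \<in> points (total_space E) \<Longrightarrow> h \<in> points G \<Longrightarrow> f (act E x h) = act F (f x) h"
    using i unfolding bundle_isomorphic_def diffeomorphism_def by blast
  show ?thesis
  proof (rule bundle_isomorphicI[OF g f fg gf])
    fix y assume y: "y \<in> points (total_space F)"
    have gy: "g y \<in> points (total_space E)" by (rule smooth_map_point[OF g y])
    show "proj E (g y) = proj F y" using pr[OF gy] fg[OF y] by simp
    fix h assume h: "h \<in> points G"
    have "smooth_map (prod_dspace (total_space E) G) (total_space E) (\<lambda>(x, g). act E x g)"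
      using E by (simp add: fibrewise_action_def)
    from smooth_map_point[OF this, of "(g y, h)"] have "act E (g y) h \<in> points (total_space E)"
      using gy h by (simp add: points_prod)
    from gf[OF this] show "g (act F y h) = act E (g y) h" using eq[OF gy h] fg[OF y] by simp
  qed
qed

lemma bundle_isomorphic_trans:
  assumes "bundle_isomorphic G E F" "bundle_isomorphic G F H"
  shows "bundle_isomorphic G E H"
proof -
  obtain f g where f: "smooth_map (total_space E) (total_space F) f" and g: "smooth_map (total_space F) (total_space E) g"
    and gf: "\<And>x. x \<in> points (total_space E) \<Longrightarrow> g (f x) = x" and fg: "\<And>y. y \<in> points (total_space F) \<Longrightarrow> f (g y) = y"
    and pr: "\<And>x. x \<in> points (total_space E) \<Longrightarrow> proj F (f x) = proj E x"
    and eq: "\<And>x h. x \<in> points (total_space E) \<Longrightarrow> h \<in> points G \<Longrightarrow> f (act E x h) = act F (f x) h"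
    using assms(1) unfolding bundle_isomorphic_def diffeomorphism_def by blast
  obtain f' g' where f': "smooth_map (total_space F) (total_space H) f'" and g': "smooth_map (total_space H) (total_space F) g'"
    and gf': "\<And>x. x \<in> points (total_space F) \<Longrightarrow> g' (f' x) = x" and fg': "\<And>y. y \<in> points (total_space H) \<Longrightarrow> f' (g' y) = y"
    and pr': "\<And>x. x \<in> points (total_space F) \<Longrightarrow> proj H (f' x) = proj F x"
    and eq': "\<And>x h. x \<in> points (total_space F) \<Longrightarrow> h \<in> points G \<Longrightarrow> f' (act F x h) = act H (f' x) h"
    using assms(2) unfolding bundle_isomorphic_def diffeomorphism_def by blast
  show ?thesis
    using smooth_map_point[OF f] smooth_map_point[OF g']
    by (intro bundle_isomorphicI[OF smooth_map_compose[OF f f'] smooth_map_compose[OF g' g]])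
      (simp_all add: gf fg gf' fg' pr pr' eq eq')
qed

lemma product_fibrewise:
  assumes G: "diffeological_group G" and B: "diffeological_space B"
  shows "fibrewise_action G B (product_bundle G B)"
proof -
  have Gd: "diffeological_space G" and ad: "smooth_map (prod_dspace G G) G (\<lambda>(x, y). x + y)"
    using G by (simp_all add: diffeological_group_def)
  have 1: "smooth_map (prod_dspace B G) B fst" by (rule smooth_mapI) (auto simp: points_prod plot_prod_iff)
  have 2: "smooth_map (prod_dspace (prod_dspace B G) G) (prod_dspace B G) (\<lambda>(x, g). (\<lambda>(b, g) g'. (b, g + g')) x g)"
  proof (rule smooth_mapI)
    show "(\<lambda>(x, g). (\<lambda>(b, g) g'. (b, g + g')) x g) z \<in> points (prod_dspace B G)"
      if "z \<in> points (prod_dspace (prod_dspace B G) G)" for z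
      using that smooth_map_point[OF ad, of "(snd (fst z), snd z)"] by (auto simp: points_prod)
    show "plot (prod_dspace B G) n U (\<lambda>u. (\<lambda>(x, g). (\<lambda>(b, g) g'. (b, g + g')) x g) (p u))"
      if "plot (prod_dspace (prod_dspace B G) G) n U p" for n U p
      using that smooth_map_plot[OF ad, of n U "\<lambda>u. (snd (fst (p u)), snd (p u))"]
      by (simp add: plot_prod_iff case_prod_beta)
  qed
  show ?thesis
    unfolding fibrewise_action_def product_bundle_def
    using G B prod_dspace_diffeological[OF B Gd] 1 2 by (auto simp: points_prod add.assoc)
qed

lemma pullback_product:
  assumes C: "diffeological_space C" and f: "smooth_map C B f"
  shows "bundle_isomorphic G (pullback_bundle C f (product_bundle G B)) (product_bundle G C)"
proof (rule bundle_isomorphicI[where f = "\<lambda>x. (fst x, snd (snd x))" and g = "\<lambda>y. (fst y, (f (fst y), snd y))"])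
  show "smooth_map (total_space (pullback_bundle C f (product_bundle G B))) (total_space (product_bundle G C)) (\<lambda>x. (fst x, snd (snd x)))"
    by (rule smooth_mapI) (auto simp: pullback_bundle_def product_bundle_def points_prod points_sub plot_prod_iff plot_sub_iff)
  show "smooth_map (total_space (product_bundle G C)) (total_space (pullback_bundle C f (product_bundle G B))) (\<lambda>y. (fst y, (f (fst y), snd y)))"
    using smooth_map_point[OF f] smooth_map_plot[OF f]
    by (intro smooth_mapI) (auto simp: pullback_bundle_def product_bundle_def points_prod points_sub plot_prod_iff plot_sub_iff)
qed (auto simp: pullback_bundle_def product_bundle_def points_prod points_sub)

lemma product_principal:
  assumes G: "diffeological_group G" and B: "diffeological_space B"
  shows "principal_bundle G B (product_bundle G B)"
  unfolding principal_bundle_def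
proof (intro conjI allI impI product_fibrewise[OF G B])
  fix n U p assume p: "plot B n U p"
  have C: "diffeological_space (open_dspace n U)"
    by (rule open_dspace_diffeological[OF diffeological_space.plot_domain[OF B p]])
  note f = smooth_map_of_plot[OF B p]
  show "locally_trivial_bundle G (open_dspace n U) (pullback_bundle (open_dspace n U) p (product_bundle G B))"
    using fibrewise_pullback[OF product_fibrewise[OF G B] C f] pullback_product[OF C f]
    by (intro trivial_locally_trivial) (simp add: trivial_bundle_def)
qed

lemma pullback_id:
  assumes E: "fibrewise_action G B E"
  shows "bundle_isomorphic G (pullback_bundle B id E) E"
proof -
  have T: "diffeological_space (total_space E)" and pr: "smooth_map (total_space E) B (proj E)"
    using E by (simp_all add: fibrewise_action_def)
  show ?thesis
  proof (rule bundle_isomorphicI[where f = snd and g = "\<lambda>y. (proj E y, y)"])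
    show "smooth_map (total_space (pullback_bundle B id E)) (total_space E) snd"
      by (rule smooth_mapI) (auto simp: pullback_bundle_def points_prod points_sub plot_prod_iff plot_sub_iff)
    show "smooth_map (total_space E) (total_space (pullback_bundle B id E)) (\<lambda>y. (proj E y, y))"
      using smooth_map_point[OF pr] smooth_map_plot[OF pr]
      by (intro smooth_mapI) (auto simp: pullback_bundle_def points_prod points_sub plot_prod_iff plot_sub_iff)
  qed (auto simp: pullback_bundle_def points_prod points_sub)
qed

text \<open>
  A point \<open>b\<close> is a plot on \<open>\<real>\<^sup>0\<close>.  The pullback along it is locally trivial over a single point, so it is trivial, and
  its total space is the fibre over \<open>b\<close>.
\<close>

lemma fibre_of_principal:
  assumes E: "principal_bundle G B E" and b: "b \<in> points B"
  shows "\<exists>f g. smooth_map (sub_dspace (total_space E) (proj E -` {b})) G f \<and>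
    smooth_map G (sub_dspace (total_space E) (proj E -` {b})) g \<and>
    (\<forall>x\<in>points (total_space E). proj E x = b \<longrightarrow> g (f x) = x) \<and> (\<forall>y\<in>points G. f (g y) = y) \<and>
    (\<forall>x\<in>points (total_space E). \<forall>h\<in>points G. proj E x = b \<longrightarrow> f (act E x h) = f x + h)"
proof -
  let ?o = "\<lambda>_::nat. 0::real"
  let ?C = "open_dspace 0 {?o}" and ?F = "sub_dspace (total_space E) (proj E -` {b})"
  have o: "eopen 0 {?o}" by (rule eopen_point)
  have fw: "fibrewise_action G B E" using E by (simp add: principal_bundle_def)
  have B: "diffeological_space B" and T: "diffeological_space (total_space E)" and Gd: "diffeological_space G"
    using fw by (simp_all add: fibrewise_action_def diffeological_group_def)
  have C: "diffeological_space ?C" by (rule open_dspace_diffeological[OF o])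
  have co: "plot ?C n U (\<lambda>_. ?o)" if "eopen n U" for n U
    by (rule diffeological_space.plot_const[OF C that]) (simp add: open_dspace_def)
  have "plot B 0 {?o} (\<lambda>_. b)" by (rule diffeological_space.plot_const[OF B o b])
  then have "locally_trivial_bundle G ?C (pullback_bundle ?C (\<lambda>_. b) E)" using E unfolding principal_bundle_def by blast
  then obtain \<C> where cov: "\<Union>\<C> = {?o}"
    and tr: "\<And>A. A \<in> \<C> \<Longrightarrow> trivial_bundle G (sub_dspace ?C A) (restrict_bundle (pullback_bundle ?C (\<lambda>_. b) E) A)"
    unfolding locally_trivial_bundle_def by (auto simp: open_dspace_def)
  then obtain A where A: "A \<in> \<C>" "?o \<in> A" by blast
  let ?R = "restrict_bundle (pullback_bundle ?C (\<lambda>_. b) E) A" and ?P = "prod_dspace (sub_dspace ?C A) G"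
  obtain f g where f: "smooth_map (total_space ?R) ?P f" and g: "smooth_map ?P (total_space ?R) g"
    and gf: "\<And>x. x \<in> points (total_space ?R) \<Longrightarrow> g (f x) = x" and fg: "\<And>y. y \<in> points ?P \<Longrightarrow> f (g y) = y"
    and eq: "\<And>x h. x \<in> points (total_space ?R) \<Longrightarrow> h \<in> points G \<Longrightarrow> f (act ?R x h) = act (product_bundle G (sub_dspace ?C A)) (f x) h"
    using tr[OF A(1)] unfolding trivial_bundle_def bundle_isomorphic_def diffeomorphism_def
    by (auto simp: product_bundle_def)
  have PR: "z \<in> points (total_space ?R) \<longleftrightarrow> fst z = ?o \<and> snd z \<in> points (total_space E) \<and> proj E (snd z) = b" for z
    using A(2) by (cases z) (auto simp: restrict_bundle_def pullback_bundle_def points_sub points_prod open_dspace_def)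
  have PP: "z \<in> points ?P \<longleftrightarrow> fst z = ?o \<and> snd z \<in> points G" for z
    using A(2) by (cases z) (auto simp: points_sub points_prod open_dspace_def)
  have incl: "smooth_map ?F (total_space ?R) (\<lambda>x. (?o, x))"
  proof (rule smooth_mapI)
    show "(?o, x) \<in> points (total_space ?R)" if "x \<in> points ?F" for x using that by (auto simp: PR points_sub)
    show "plot (total_space ?R) n U (\<lambda>u. (?o, p u))" if "plot ?F n U p" for n U p
      using that co[OF diffeological_space.plot_domain[OF T, of n U p]] A(2)
      by (auto simp: restrict_bundle_def pullback_bundle_def plot_sub_iff plot_prod_iff)
  qed
  have incl': "smooth_map G ?P (\<lambda>y. (?o, y))"
  proof (rule smooth_mapI)
    show "(?o, y) \<in> points ?P" if "y \<in> points G" for y using that by (simp add: PP)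
    show "plot ?P n U (\<lambda>u. (?o, p u))" if "plot G n U p" for n U p
      using that co[OF diffeological_space.plot_domain[OF Gd that]] A(2) by (auto simp: plot_sub_iff plot_prod_iff)
  qed
  have sP: "smooth_map ?P G snd" by (rule smooth_mapI) (auto simp: points_prod plot_prod_iff)
  have sR: "smooth_map (total_space ?R) ?F snd"
  proof (rule smooth_mapI)
    show "snd z \<in> points ?F" if "z \<in> points (total_space ?R)" for z using that by (simp add: PR points_sub)
    show "plot ?F n U (\<lambda>u. snd (p u))" if "plot (total_space ?R) n U p" for n U p
      using that by (auto simp: restrict_bundle_def pullback_bundle_def plot_sub_iff plot_prod_iff case_prod_beta)
  qed
  have ag: "(?o, snd (f z)) = f z" if "z \<in> points (total_space ?R)" for z
    using smooth_map_point[OF f that] by (simp add: PP prod_eq_iff)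
  have ag': "(?o, snd (g y)) = g y" if "y \<in> points ?P" for y
    using smooth_map_point[OF g that] by (simp add: PR prod_eq_iff)
  show ?thesis
  proof (intro exI conjI ballI impI)
    show "smooth_map ?F G (\<lambda>x. snd (f (?o, x)))" by (rule smooth_map_compose[OF smooth_map_compose[OF incl f] sP])
    show "smooth_map G ?F (\<lambda>y. snd (g (?o, y)))" by (rule smooth_map_compose[OF smooth_map_compose[OF incl' g] sR])
    show "snd (g (?o, snd (f (?o, x)))) = x" if "x \<in> points (total_space E)" "proj E x = b" for x
    proof -
      have z: "(?o, x) \<in> points (total_space ?R)" using that by (simp add: PR)
      show ?thesis unfolding ag[OF z] gf[OF z] by simp
    qed
    show "snd (f (?o, snd (g (?o, y)))) = y" if "y \<in> points G" for y
    proof -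
      have z: "(?o, y) \<in> points ?P" using that by (simp add: PP)
      show ?thesis unfolding ag'[OF z] fg[OF z] by simp
    qed
    show "snd (f (?o, act E x h)) = snd (f (?o, x)) + h" if "x \<in> points (total_space E)" "h \<in> points G" "proj E x = b" for x h
    proof -
      have z: "(?o, x) \<in> points (total_space ?R)" using that by (simp add: PR)
      show ?thesis using eq[OF z that(2)] by (simp add: restrict_bundle_def pullback_bundle_def product_bundle_def case_prod_beta)
    qed
  qed
qed

lemma pullback_const:
  assumes E: "principal_bundle G B E" and b: "b \<in> points B" and C: "diffeological_space C"
  shows "bundle_isomorphic G (pullback_bundle C (\<lambda>_. b) E) (product_bundle G C)"
proof -
  let ?F = "sub_dspace (total_space E) (proj E -` {b})"
  obtain f g where f: "smooth_map ?F G f" and g: "smooth_map G ?F g"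
    and gf: "\<And>x. x \<in> points (total_space E) \<Longrightarrow> proj E x = b \<Longrightarrow> g (f x) = x" and fg: "\<And>y. y \<in> points G \<Longrightarrow> f (g y) = y"
    and eq: "\<And>x h. x \<in> points (total_space E) \<Longrightarrow> h \<in> points G \<Longrightarrow> proj E x = b \<Longrightarrow> f (act E x h) = f x + h"
    using fibre_of_principal[OF E b] by blast
  show ?thesis
  proof (rule bundle_isomorphicI[where f = "\<lambda>x. (fst x, f (snd x))" and g = "\<lambda>y. (fst y, g (snd y))"])
    show "smooth_map (total_space (pullback_bundle C (\<lambda>_. b) E)) (total_space (product_bundle G C)) (\<lambda>x. (fst x, f (snd x)))"
    proof (rule smooth_mapI)
      show "(fst z, f (snd z)) \<in> points (total_space (product_bundle G C))"
        if "z \<in> points (total_space (pullback_bundle C (\<lambda>_. b) E))" for z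
        using that smooth_map_point[OF f, of "snd z"]
        by (auto simp: pullback_bundle_def product_bundle_def points_prod points_sub)
      show "plot (total_space (product_bundle G C)) n U (\<lambda>u. (fst (p u), f (snd (p u))))"
        if "plot (total_space (pullback_bundle C (\<lambda>_. b) E)) n U p" for n U p
        using that smooth_map_plot[OF f, of n U "\<lambda>u. snd (p u)"]
        by (auto simp: pullback_bundle_def product_bundle_def plot_prod_iff plot_sub_iff case_prod_beta)
    qed
    show "smooth_map (total_space (product_bundle G C)) (total_space (pullback_bundle C (\<lambda>_. b) E)) (\<lambda>y. (fst y, g (snd y)))"
    proof (rule smooth_mapI)
      show "(fst z, g (snd z)) \<in> points (total_space (pullback_bundle C (\<lambda>_. b) E))"
        if "z \<in> points (total_space (product_bundle G C))" for z
        using that smooth_map_point[OF g, of "snd z"]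
        by (auto simp: pullback_bundle_def product_bundle_def points_prod points_sub)
      show "plot (total_space (pullback_bundle C (\<lambda>_. b) E)) n U (\<lambda>u. (fst (p u), g (snd (p u))))"
        if "plot (total_space (product_bundle G C)) n U p" for n U p
        using that smooth_map_plot[OF g, of n U "\<lambda>u. snd (p u)"]
        by (auto simp: pullback_bundle_def product_bundle_def plot_prod_iff plot_sub_iff case_prod_beta)
    qed
  qed (auto simp: pullback_bundle_def product_bundle_def points_prod points_sub gf fg eq)
qed

section \<open>Contractible bases and classifying spaces\<close>

definition isoclass :: "'g::group_add dspace \<Rightarrow> 'x dspace \<Rightarrow> ('x, 'g) std_bundle \<Rightarrow> ('x, 'g) std_bundle set" where
  "isoclass G X E = {F. principal_bundle G X F \<and> bundle_isomorphic G E F}"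

lemma isoclass_in: "principal_bundle G X E \<Longrightarrow> isoclass G X E \<in> iso_classes G X"
  unfolding iso_classes_def isoclass_def quotient_def by blast

lemma principal_fibrewise: "principal_bundle G X E \<Longrightarrow> fibrewise_action G X E"
  by (simp add: principal_bundle_def)

text \<open>
  The hypothesis speaks of all members of the class of \<open>E\<close>; this takes the place of the fact that pullback
  preserves isomorphism.
\<close>

lemma pullback_class_isoclass:
  fixes E :: "('y, 'g::group_add) std_bundle" and P :: "('x, 'g) std_bundle"
  assumes E: "principal_bundle G Y E" and X: "diffeological_space X" and f: "smooth_map X Y f"
    and P: "\<And>F :: ('y, 'g) std_bundle. principal_bundle G Y F \<Longrightarrow> bundle_isomorphic G E F \<Longrightarrow> bundle_isomorphic G (pullback_bundle X f F) P"
  shows "pullback_class G X f (isoclass G Y E) = isoclass G X P"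
proof (intro set_eqI iffI)
  fix F assume "F \<in> pullback_class G X f (isoclass G Y E)"
  then obtain E' :: "('y, 'g) std_bundle" where E': "principal_bundle G Y E'" "bundle_isomorphic G E E'"
    and F: "principal_bundle G X F" "bundle_isomorphic G (pullback_bundle X f E') F"
    unfolding pullback_class_def isoclass_def mem_Collect_eq Bex_def by (elim exE conjE)
  have "bundle_isomorphic G P (pullback_bundle X f E')"
    by (rule bundle_isomorphic_sym[OF fibrewise_pullback[OF principal_fibrewise[OF E'(1)] X f] P[OF E']])
  from bundle_isomorphic_trans[OF this F(2)] show "F \<in> isoclass G X P" using F(1) by (simp add: isoclass_def)
next
  fix F assume "F \<in> isoclass G X P"
  then have F: "principal_bundle G X F" "bundle_isomorphic G P F" by (simp_all add: isoclass_def)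
  have r: "bundle_isomorphic G E E" by (rule bundle_isomorphic_refl[OF principal_fibrewise[OF E]])
  from bundle_isomorphic_trans[OF P[OF E r] F(2)] show "F \<in> pullback_class G X f (isoclass G Y E)"
    using F(1) E r unfolding pullback_class_def isoclass_def mem_Collect_eq Bex_def by (intro conjI exI[of _ E])
qed

text \<open>
  The identity and the constant map \<open>0\<close> of \<open>V\<close> are smoothly homotopic and therefore act equally on \<open>[V, Z]\<close>.  By
  naturality and injectivity of \<open>\<Phi>\<close> they act equally on the class of \<open>E\<close>; the identity fixes it and the constant map
  takes it to the class of the product.
\<close>

theorem nontrivial_bundle_not_classified:
  fixes V :: "'v::real_vector dspace" and W :: "'g::group_add dspace" and E :: "('v, 'g) std_bundle"
  assumes V: "diffeological_vector_space V" and E: "principal_bundle W V E" and nt: "\<not> trivial_bundle W V E"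
  shows "\<not> classifying_space TYPE('v) W Z"
proof
  assume "classifying_space TYPE('v) W Z"
  then obtain \<Phi> :: "'v dspace \<Rightarrow> ('v, 'g) std_bundle set \<Rightarrow> _" where Z: "diffeological_space Z"
    and bij: "\<And>X. diffeological_space X \<Longrightarrow> bij_betw (\<Phi> X) (iso_classes W X) (homotopy_classes X Z)"
    and nat: "\<And>X Y f c. diffeological_space X \<Longrightarrow> diffeological_space Y \<Longrightarrow> smooth_map X Y f \<Longrightarrow> c \<in> iso_classes W Y \<Longrightarrow>
              \<Phi> X (pullback_class W X f c) = precompose_class X Z f (\<Phi> Y c)"
    unfolding classifying_space_def by blast
  interpret V: dvs V by (rule dvs_intro[OF V])
  note Vd = V.diffeological_space_axioms
  have V0: "0 \<in> points V" by (rule subspace_0[OF V.points_subspace])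
  have fw: "fibrewise_action W V E" by (rule principal_fibrewise[OF E])
  have W: "diffeological_group W" using fw by (simp add: fibrewise_action_def)
  have id: "smooth_map V V id" by (rule smooth_mapI) simp_all
  have c0: "smooth_map V V (\<lambda>_. 0)" by (rule smooth_mapI) (auto intro: V0 V.plot_const V.plot_domain)
  let ?c = "isoclass W V E" and ?t = "isoclass W V (product_bundle W V)"
  have c: "?c \<in> iso_classes W V" by (rule isoclass_in[OF E])
  have t: "?t \<in> iso_classes W V" by (rule isoclass_in[OF product_principal[OF W Vd]])
  have 1: "pullback_class W V id ?c = ?c"
  proof (rule pullback_class_isoclass[OF E Vd id])
    fix F :: "('v, 'g) std_bundle" assume F: "principal_bundle W V F" "bundle_isomorphic W E F"
    show "bundle_isomorphic W (pullback_bundle V id F) E"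
      by (rule bundle_isomorphic_trans[OF pullback_id[OF principal_fibrewise[OF F(1)]] bundle_isomorphic_sym[OF fw F(2)]])
  qed
  have 2: "pullback_class W V (\<lambda>_. 0) ?c = ?t"
    by (rule pullback_class_isoclass[OF E Vd c0]) (rule pullback_const[OF _ V0 Vd])
  have "\<Phi> V ?c \<in> homotopy_classes V Z" using bij[OF Vd] c by (auto simp: bij_betw_def)
  from precompose_id_const[OF V Z this] have "\<Phi> V ?c = \<Phi> V ?t"
    using nat[OF Vd Vd id c] nat[OF Vd Vd c0 c] unfolding 1 2 by simp
  then have "?c = ?t" using bij[OF Vd] c t by (auto simp: bij_betw_def inj_on_def)
  moreover have "E \<in> ?c" using E bundle_isomorphic_refl[OF fw] by (simp add: isoclass_def)
  ultimately have "bundle_isomorphic W (product_bundle W V) E" by (simp add: isoclass_def)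
  then have "trivial_bundle W V E"
    using fw bundle_isomorphic_sym[OF product_fibrewise[OF W Vd]] by (simp add: trivial_bundle_def)
  then show False using nt by simp
qed

theorem theorem3p6:
  fixes V :: "'v::real_vector dspace"
  assumes "diffeological_vector_space V"
    and "\<not> projective TYPE('a::real_vector \<times> 'b::real_vector) V"
  shows "(\<exists>W :: 'v plot_vectors dspace. diffeological_vector_space W \<and>
            (\<exists>E :: ('v, 'v plot_vectors) std_bundle.
               principal_bundle W V E \<and> \<not> trivial_bundle W V E)) \<and>
         (\<forall>W :: 'v plot_vectors dspace. diffeological_vector_space W \<and>
            (\<exists>E :: ('v, 'v plot_vectors) std_bundle.
               principal_bundle W V E \<and> \<not> trivial_bundle W V E) \<longrightarrow>
            \<not> (\<exists>Z :: 'z dspace. classifying_space TYPE('v) W Z))"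
proof (intro conjI allI impI)
  have V: "diffeological_space V" using assms(1) by (simp add: diffeological_vector_space_def)
  show "\<exists>W :: 'v plot_vectors dspace. diffeological_vector_space W \<and>
      (\<exists>E :: ('v, 'v plot_vectors) std_bundle. principal_bundle W V E \<and> \<not> trivial_bundle W V E)"
    using kernel_space_dvs[OF V] universal_bundle_principal[OF V] universal_bundle_nontrivial[OF assms] by blast
next
  fix W :: "'v plot_vectors dspace"
  assume "diffeological_vector_space W \<and>
      (\<exists>E :: ('v, 'v plot_vectors) std_bundle. principal_bundle W V E \<and> \<not> trivial_bundle W V E)"
  then show "\<not> (\<exists>Z :: 'z dspace. classifying_space TYPE('v) W Z)"
    using nontrivial_bundle_not_classified[OF assms(1)] by blast
qed

end
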